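(* Let $d\ge 3$. Assume that $\varepsilon\in C^{(3)}(\mathbb{T}^d)$ is a real-valued even Morse function with a unique minimum at $0\in\mathbb{T}^d$ and that $\hat v\in\ell^1(\mathbb{Z}^d)$ is non-positive and even. Suppose that for some $\mu_0>0$ and $k_0\in\mathbb{G}$ the threshold $\mathcal{E}_{\min}(k_0)$ is a regular point of the essential spectrum of the operator $\widehat H_{\mu_0}(k_0)=\widehat H_0(k_0)+\mu_0\widehat V$. Then there exist neighborhoods $\mathrm{U}(\mu_0)\subset\mathbb{R}$ of $\mu_0$ and $\mathrm{G}(k_0)\subset\mathbb{G}$ of $k_0$ such that for all $\mu\in\mathrm{U}(\mu_0)$ and $k\in\mathrm{G}(k_0)$ the number of eigenvalues of the operator $\widehat H_\mu(k)$ below the threshold $\mathcal{E}_{\min}(k)$ remains unchanged (that is, does not depend on $(\mu,k)\in \mathrm{U}(\mu_0)\times\mathrm{G}(k_0)$).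
   Context: Let $\mathbb{T}^d=(\mathbb{R}/2\pi\mathbb{Z})^d$, identified with $[-\pi,\pi)^d$ (so that $k/2$ is well defined for $k\in\mathbb{T}^d$), with normalized Haar measure $\eta(\mathrm{d}p)=\mathrm{d}^dp/(2\pi)^d$, and $(p,x)=\sum_j p_jx_j$. Let $\ell^{2,e}(\mathbb{Z}^d)$ be the Hilbert space of square-summable even functions on $\mathbb{Z}^d$. Let $\hat\varepsilon\in\ell^1(\mathbb{Z}^d)$ be real-valued and even, and $\varepsilon(p)=\sum_{x\in\mathbb{Z}^d}e^{\mathrm{i}(p,x)}\hat\varepsilon(x)$. For $k\in\mathbb{T}^d$ put $\mathcal{E}_k(p)=\varepsilon(\tfrac k2+p)+\varepsilon(\tfrac k2-p)$ and $\mathcal{E}_{\min}(k)=\min_q\mathcal{E}_k(q)$. On $\ell^{2,e}(\mathbb{Z}^d)$ define $(\widehat H_0(k)\hat f)(x)=\sum_{s\in\mathbb{Z}^d}\hat{\mathcal{E}}_k(x-s)\hat f(s)$ with $\hat{\mathcal{E}}_k(x)=\int_{\mathbb{T}^d}e^{-\mathrm{i}(p,x)}\mathcal{E}_k(p)\,\eta(\mathrm{d}p)$, $(\widehat V\hat f)(x)=\hat v(x)\hat f(x)$, and $\widehat H_\mu(k)=\widehat H_0(k)+\mu\widehat V$, $\mu>0$. The bottom (threshold) of the essential spectrum of $\widehat H_\mu(k)$ is $\mathcal{E}_{\min}(k)$. Eigenvalues are counted with multiplicity. $\mathbb{G}\subset\mathbb{T}^d$ denotes the maximal open neighborhood of $0\in\mathbb{T}^d$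 such that for every $k\in\mathbb{G}$ the function $\mathcal{E}_k(\cdot)\in C^{(3)}(\mathbb{T}^d)$ is a Morse function and its minimum $\mathcal{E}_{\min}(k)$ is attained at the point $p=0$. For $d\ge3$, $k\in\mathbb{G}$, the generalized Birman–Schwinger operator $\mathbb{B}_\mu(k,\mathcal{E}_{\min}(k))$ is the compact operator on $\ell^{2,e}(\mathbb{Z}^d)$ with kernel $$\mu|\hat v(x)|^{1/2}\left(\int_{\mathbb{T}^d}\frac{e^{\mathrm{i}(q,x-y)}}{\mathcal{E}_k(q)-\mathcal{E}_{\min}(k)}\eta(\mathrm{d}q)\right)|\hat v(y)|^{1/2},\quad x,y\in\mathbb{Z}^d.$$ The threshold $\mathcal{E}_{\min}(k)$ is called a regular point of (the essential spectrum of) $\widehat H_\mu(k)$ if $1$ is not an eigenvalue of $\mathbb{B}_\mu(k,\mathcal{E}_{\min}(k))$. *)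

theory Defs
  imports "HOL-Analysis.Analysis" "HOL-Library.Function_Algebras"
begin

section \<open>The torus\<close>

text \<open>
  The torus is identified with the half-open box, on which \<open>k / 2\<close> is defined. Its topology is the
  quotient topology, not the subspace topology of the box. Functions on the torus are represented
  by \<open>2 \<pi>\<close>-periodic functions on \<open>real ^ 'd\<close>.
\<close>

definition torus :: "(real ^ 'd) set"
  where "torus = {k. \<forall>i. - pi \<le> k $ i \<and> k $ i < pi}"

definition torus_proj :: "real ^ 'd \<Rightarrow> real ^ 'd"
  where "torus_proj x = (\<chi> i. x $ i - 2 * pi * of_int \<lfloor>(x $ i + pi) / (2 * pi)\<rfloor>)"

lemma torus_proj_in_torus: "torus_proj x \<in> torus"
proof -
  have "- pi \<le> t - 2 * pi * of_int \<lfloor>(t + pi) / (2 * pi)\<rfloor> \<and>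
        t - 2 * pi * of_int \<lfloor>(t + pi) / (2 * pi)\<rfloor> < pi" for t :: real
  proof -
    define n where "n = real_of_int \<lfloor>(t + pi) / (2 * pi)\<rfloor>"
    have "n \<le> (t + pi) / (2 * pi)" "(t + pi) / (2 * pi) < n + 1"
      unfolding n_def by linarith+
    then have "n * (2 * pi) \<le> t + pi" "t + pi < (n + 1) * (2 * pi)"
      by (simp_all add: pos_le_divide_eq pos_divide_less_eq)
    then show ?thesis
      unfolding n_def[symmetric] by (simp add: algebra_simps)
  qed
  then show ?thesis
    by (simp add: torus_def torus_proj_def)
qed

lemma torus_proj_id: "torus_proj k = k" if "k \<in> torus"
proof -
  have "\<lfloor>(k $ i + pi) / (2 * pi)\<rfloor> = 0" for i
  proof -
    have "- pi \<le> k $ i" "k $ i < pi"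
      using that by (auto simp: torus_def)
    then show ?thesis
      by (simp add: floor_eq_iff pos_divide_less_eq)
  qed
  then show ?thesis
    by (simp add: torus_proj_def vec_eq_iff)
qed

definition torus_open :: "(real ^ 'd) set \<Rightarrow> bool"
  where "torus_open U \<longleftrightarrow> U \<subseteq> torus \<and> open (torus_proj -` U)"

definition haar :: "(real ^ 'd) measure"
  where "haar = scale_measure (ennreal (1 / (2 * pi) ^ CARD('d))) (restrict_space lborel torus)"

definition lattice_pair :: "real ^ 'd \<Rightarrow> int ^ 'd \<Rightarrow> real"
  where "lattice_pair p x = (\<Sum>j\<in>UNIV. p $ j * of_int (x $ j))"


section \<open>Continuously differentiable functions and Morse functions\<close>

definition partial_deriv :: "'d \<Rightarrow> (real ^ 'd \<Rightarrow> real) \<Rightarrow> real ^ 'd \<Rightarrow> real"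
  where "partial_deriv i f p = frechet_derivative f (at p) (axis i 1)"

primrec Ck :: "nat \<Rightarrow> (real ^ 'd \<Rightarrow> real) \<Rightarrow> bool" where
  "Ck 0 f \<longleftrightarrow> continuous_on UNIV f"
| "Ck (Suc n) f \<longleftrightarrow> f differentiable_on UNIV \<and> (\<forall>i. Ck n (partial_deriv i f))"

definition hessian :: "(real ^ 'd \<Rightarrow> real) \<Rightarrow> real ^ 'd \<Rightarrow> real ^ 'd ^ 'd"
  where "hessian f p = (\<chi> i j. partial_deriv i (partial_deriv j f) p)"

definition morse :: "(real ^ 'd \<Rightarrow> real) \<Rightarrow> bool"
  where "morse f \<longleftrightarrow> (\<forall>p. (\<forall>i. partial_deriv i f p = 0) \<longrightarrow> det (hessian f p) \<noteq> 0)"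


section \<open>Even square-summable functions and eigenvalue counting\<close>

definition l2e :: "(int ^ 'd \<Rightarrow> complex) set"
  where "l2e = {f. (\<lambda>x. (cmod (f x))\<^sup>2) summable_on UNIV \<and> (\<forall>x. f (- x) = f x)}"

definition fun_scale :: "complex \<Rightarrow> ('a \<Rightarrow> complex) \<Rightarrow> 'a \<Rightarrow> complex"
  where "fun_scale c f = (\<lambda>x. c * f x)"

interpretation cfun: vector_space "fun_scale :: complex \<Rightarrow> ('a \<Rightarrow> complex) \<Rightarrow> 'a \<Rightarrow> complex"
  by unfold_locales (auto simp: fun_scale_def algebra_simps)

text \<open>The library's \<open>dim\<close> is \<open>0\<close> for infinite-dimensional spaces, hence the case distinction.\<close>

definition cdim :: "('a \<Rightarrow> complex) set \<Rightarrow> enat"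
  where "cdim V = (if \<exists>B. finite B \<and> V \<subseteq> cfun.span B then enat (cfun.dim V) else \<infinity>)"

definition eigenspace ::
    "((int ^ 'd \<Rightarrow> complex) \<Rightarrow> int ^ 'd \<Rightarrow> complex) \<Rightarrow> real \<Rightarrow> (int ^ 'd \<Rightarrow> complex) set"
  where "eigenspace T z = {f \<in> l2e. T f = fun_scale (of_real z) f}"

definition is_eigenvalue ::
    "((int ^ 'd \<Rightarrow> complex) \<Rightarrow> int ^ 'd \<Rightarrow> complex) \<Rightarrow> real \<Rightarrow> bool"
  where "is_eigenvalue T z \<longleftrightarrow> (\<exists>f \<in> eigenspace T z. f \<noteq> (\<lambda>_. 0))"

text \<open>
  The multiplicities of all eigenvalues below \<open>z\<close> are added up. In \<open>enat\<close> every family is summable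
  (\<open>nonneg_summable_on_complete\<close>), so that \<open>infsum\<close> is the true, possibly infinite, sum.
\<close>

definition eigenvalues_below ::
    "((int ^ 'd \<Rightarrow> complex) \<Rightarrow> int ^ 'd \<Rightarrow> complex) \<Rightarrow> real \<Rightarrow> enat"
  where "eigenvalues_below T z =
    (\<Sum>\<^sub>\<infinity>w\<in>{w. w < z \<and> is_eigenvalue T w}. cdim (eigenspace T w))"


section \<open>The two-particle operators\<close>

definition disp :: "(real ^ 'd \<Rightarrow> real) \<Rightarrow> real ^ 'd \<Rightarrow> real ^ 'd \<Rightarrow> real"
  where "disp \<epsilon> k p = \<epsilon> (k /\<^sub>R 2 + p) + \<epsilon> (k /\<^sub>R 2 - p)"

definition disp_min :: "(real ^ 'd \<Rightarrow> real) \<Rightarrow> real ^ 'd \<Rightarrow> real"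
  where "disp_min \<epsilon> k = (INF q\<in>torus. disp \<epsilon> k q)"

definition disp_hat :: "(real ^ 'd \<Rightarrow> real) \<Rightarrow> real ^ 'd \<Rightarrow> int ^ 'd \<Rightarrow> complex"
  where "disp_hat \<epsilon> k x = (LINT p|haar. cis (- lattice_pair p x) * of_real (disp \<epsilon> k p))"

definition H0 ::
    "(real ^ 'd \<Rightarrow> real) \<Rightarrow> real ^ 'd \<Rightarrow> (int ^ 'd \<Rightarrow> complex) \<Rightarrow> int ^ 'd \<Rightarrow> complex"
  where "H0 \<epsilon> k f x = (\<Sum>\<^sub>\<infinity>s. disp_hat \<epsilon> k (x - s) * f s)"

definition H ::
    "(real ^ 'd \<Rightarrow> real) \<Rightarrow> (int ^ 'd \<Rightarrow> real) \<Rightarrow> real \<Rightarrow> real ^ 'd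
      \<Rightarrow> (int ^ 'd \<Rightarrow> complex) \<Rightarrow> int ^ 'd \<Rightarrow> complex"
  where "H \<epsilon> v \<mu> k f x = H0 \<epsilon> k f x + of_real \<mu> * (of_real (v x) * f x)"

text \<open>
  The maximal open neighborhood of \<open>0\<close> with the stated property is the union of all of them;
  the minimum of \<open>disp \<epsilon> k\<close> at \<open>0\<close> is not required to be unique.
\<close>

definition GG :: "(real ^ 'd \<Rightarrow> real) \<Rightarrow> (real ^ 'd) set"
  where "GG \<epsilon> = \<Union>{U. torus_open U \<and> 0 \<in> U \<and>
    (\<forall>k\<in>U. Ck 3 (disp \<epsilon> k) \<and> morse (disp \<epsilon> k) \<and> disp \<epsilon> k 0 = disp_min \<epsilon> k)}"

definition BS_kernel ::
    "(real ^ 'd \<Rightarrow> real) \<Rightarrow> (int ^ 'd \<Rightarrow> real) \<Rightarrow> real \<Rightarrow> real ^ 'd \<Rightarrow> int ^ 'd \<Rightarrow> int ^ 'd \<Rightarrow> complex"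
  where "BS_kernel \<epsilon> v \<mu> k x y =
    of_real (\<mu> * sqrt \<bar>v x\<bar>)
      * (LINT q|haar. cis (lattice_pair q (x - y)) / of_real (disp \<epsilon> k q - disp_min \<epsilon> k))
      * of_real (sqrt \<bar>v y\<bar>)"

definition BS ::
    "(real ^ 'd \<Rightarrow> real) \<Rightarrow> (int ^ 'd \<Rightarrow> real) \<Rightarrow> real \<Rightarrow> real ^ 'd
      \<Rightarrow> (int ^ 'd \<Rightarrow> complex) \<Rightarrow> int ^ 'd \<Rightarrow> complex"
  where "BS \<epsilon> v \<mu> k f x = (\<Sum>\<^sub>\<infinity>y. BS_kernel \<epsilon> v \<mu> k x y * f y)"

definition regular_threshold ::
    "(real ^ 'd \<Rightarrow> real) \<Rightarrow> (int ^ 'd \<Rightarrow> real) \<Rightarrow> real \<Rightarrow> real ^ 'd \<Rightarrow> bool"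
  where "regular_threshold \<epsilon> v \<mu> k \<longleftrightarrow> \<not> is_eigenvalue (BS \<epsilon> v \<mu> k) 1"

end

theory Submission
  imports Defs "HOL-Library.Diagonal_Subsequence"
begin

text \<open>
  Put \<open>w = \<bar>v\<bar>\<^bsup>1/2\<^esup>\<close> and let \<open>a = \<E>\<^sub>k - \<E>\<^sub>m\<^sub>i\<^sub>n(k)\<close>. For square-summable \<open>g\<close> the product \<open>w g\<close> is
  absolutely summable, so its Fourier series is a bounded continuous function, and the form
  \<open>b(g) = \<mu> \<integral> \<bar>ft (w g)\<bar>\<^sup>2 / a\<close> of the Birman-Schwinger operator makes sense as soon as \<open>1 / a\<close> is
  integrable. The number of eigenvalues below the threshold is the largest dimension of a space on
  which \<open>b(g) > \<parallel>g\<parallel>\<^sup>2\<close>; this is proved on the level of forms, without square roots of operators.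

  The operator of \<open>b\<close> is weakly continuous on bounded sets, so if \<open>1\<close> is not an eigenvalue then no
  eigenvalue lies in a whole neighborhood of \<open>1\<close>, and the dimension above does not change when \<open>b\<close>
  is replaced by a form at distance at most \<open>\<eta> \<parallel>g\<parallel>\<^sup>2\<close>. That distance is controlled by the \<open>L\<^sup>1\<close> norm of the
  difference of the functions \<open>1 / a\<close>. Near the minima of \<open>\<E>\<^sub>k\<close>, for \<open>k\<close> close to \<open>k\<^sub>0\<close>, the Morse property gives
  \<open>a(p) \<ge> c \<bar>p - m\<bar>\<^sup>2\<close> with \<open>c\<close> independent of \<open>k\<close>. For \<open>d \<ge> 3\<close> this bounds the integrals
  of \<open>a\<^bsup>-5/4\<^esup>\<close> uniformly in \<open>k\<close>, and the exponent beyond \<open>1\<close> turns the uniform continuity of \<open>a\<close> in \<open>k\<close>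
  into the \<open>L\<^sup>1\<close> continuity of \<open>1 / a\<close>.
\<close>

section \<open>Square-summable functions and weak limits\<close>

text \<open>The obstacle is the singular resolvent at the threshold. Near a nondegenerate minimum
  \<open>1 / a\<close> is integrable for d \<ge> 3 but, for d = 3 and d = 4, not square-integrable,
  so inverting the free operator on \<open>w g\<close> may leave the Hilbert space. What survives is
  the pairing of an integrable function on the torus with a summable sequence; square-summable
  resolvents appear only after \<open>a\<close> is replaced by \<open>a + \<delta>\<close>.
  Eigenvalues are counted through finite families: for each \<open>m\<close>, the claim that there
  are at least \<open>m\<close> of them becomes the existence of \<open>m\<close> vectors on whose
  nontrivial combinations a form is positive. This treats multiplicities and an infinite count
  alike, and families can be mapped from one operator to another. Strict positivity carries no
  margin, however, so a family is exchanged for orthonormal eigenvectors before its form is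
  perturbed. The exponent 5/4 comes from 2 * 5/4 < 3: any exponent strictly between 1 and 3/2 keeps
  the power of \<open>1 / a\<close> integrable in dimension 3.\<close>

definition ell2 :: "('a \<Rightarrow> complex) set"
  where "ell2 = {f. (\<lambda>x. (cmod (f x))\<^sup>2) summable_on UNIV}"

definition n2 :: "('a \<Rightarrow> complex) \<Rightarrow> real"
  where "n2 f = (\<Sum>\<^sub>\<infinity>x. (cmod (f x))\<^sup>2)"

text \<open>Linear in the first slot. \<open>infsum\<close> is 0 off summability and commutes
  unconditionally with \<open>cnj\<close> and scalars, so \<open>ip_cnj\<close> and the scaling laws
  hold for all functions, while additivity asks for \<open>ell2\<close>.\<close>

definition ip :: "('a \<Rightarrow> complex) \<Rightarrow> ('a \<Rightarrow> complex) \<Rightarrow> complex"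
  where "ip f g = (\<Sum>\<^sub>\<infinity>x. f x * cnj (g x))"

text \<open>A family with explicit coefficients in place of a span: nontriviality of
  \<open>c\<close> takes over the role of linear independence.\<close>

definition comb :: "'i set \<Rightarrow> ('i \<Rightarrow> complex) \<Rightarrow> ('i \<Rightarrow> 'a \<Rightarrow> complex) \<Rightarrow> 'a \<Rightarrow> complex"
  where "comb I c g = (\<lambda>x. \<Sum>i\<in>I. c i * g i x)"

lemma n2_nonneg: "0 \<le> n2 f"
  unfolding n2_def by (rule infsum_nonneg) simp

lemma ell2_sum: "f \<in> ell2 \<Longrightarrow> (\<lambda>x. (cmod (f x))\<^sup>2) summable_on UNIV"
  by (simp add: ell2_def)

lemma ell2_bound:
  assumes "\<And>S. finite S \<Longrightarrow> (\<Sum>x\<in>S. (cmod (f x))\<^sup>2) \<le> C"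
  shows "f \<in> ell2" "n2 f \<le> C"
proof -
  have s: "(\<lambda>x. (cmod (f x))\<^sup>2) summable_on UNIV"
    by (rule nonneg_bdd_above_summable_on) (use assms in \<open>auto intro!: bdd_aboveI[where M=C]\<close>)
  then show "f \<in> ell2" by (simp add: ell2_def)
  show "n2 f \<le> C"
    unfolding n2_def by (rule infsum_le_finite_sums[OF s]) (use assms in auto)
qed

lemma n2_finite_le: "f \<in> ell2 \<Longrightarrow> finite S \<Longrightarrow> (\<Sum>x\<in>S. (cmod (f x))\<^sup>2) \<le> n2 f"
  unfolding n2_def by (rule finite_sum_le_infsum) (auto simp: ell2_def)

lemma ell2_point: "f \<in> ell2 \<Longrightarrow> (cmod (f x))\<^sup>2 \<le> n2 f"
  using n2_finite_le[of f "{x}"] by simp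

lemma ell2_le:
  assumes "g \<in> ell2" "\<And>x. cmod (f x) \<le> C * cmod (g x)"
  shows "f \<in> ell2" "n2 f \<le> C\<^sup>2 * n2 g"
proof -
  have "(\<Sum>x\<in>S. (cmod (f x))\<^sup>2) \<le> C\<^sup>2 * n2 g" if "finite S" for S
  proof -
    have "(\<Sum>x\<in>S. (cmod (f x))\<^sup>2) \<le> (\<Sum>x\<in>S. C\<^sup>2 * (cmod (g x))\<^sup>2)"
      by (rule sum_mono) (metis assms(2) norm_ge_zero power_mono power_mult_distrib)
    also have "\<dots> \<le> C\<^sup>2 * n2 g"
      using n2_finite_le[OF assms(1) that] by (simp add: sum_distrib_left[symmetric] mult_left_mono)
    finally show ?thesis .
  qed
  then show "f \<in> ell2" "n2 f \<le> C\<^sup>2 * n2 g" using ell2_bound by blast+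
qed

lemma ell2_prod:
  assumes "f \<in> ell2" "g \<in> ell2"
  shows "(\<lambda>x. cmod (f x) * cmod (g x)) summable_on UNIV"
proof (rule summable_on_comparison_test)
  show "(\<lambda>x. (cmod (f x))\<^sup>2 + (cmod (g x))\<^sup>2) summable_on UNIV"
    using assms by (intro summable_on_add) (auto simp: ell2_def)
  show "cmod (f x) * cmod (g x) \<le> (cmod (f x))\<^sup>2 + (cmod (g x))\<^sup>2" for x
    using sum_squares_bound[of "cmod (f x)" "cmod (g x)"] mult_nonneg_nonneg[of "cmod (f x)" "cmod (g x)"]
      norm_ge_zero[of "f x"] norm_ge_zero[of "g x"] unfolding mult.assoc by linarith
qed auto

lemma ip_sum:
  assumes "f \<in> ell2" "g \<in> ell2"
  shows "(\<lambda>x. f x * cnj (g x)) summable_on UNIV"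
  by (rule abs_summable_summable) (use ell2_prod[OF assms] in \<open>simp add: norm_mult\<close>)

lemma ell2_lin:
  assumes "f \<in> ell2" "g \<in> ell2"
  shows "(\<lambda>x. a * f x + b * g x) \<in> ell2"
proof -
  have "(\<lambda>x. (cmod (a * f x + b * g x))\<^sup>2) summable_on UNIV"
  proof (rule summable_on_comparison_test)
    show "(\<lambda>x. 2 * (cmod a)\<^sup>2 * (cmod (f x))\<^sup>2 + 2 * (cmod b)\<^sup>2 * (cmod (g x))\<^sup>2) summable_on UNIV"
      using assms by (intro summable_on_add summable_on_cmult_right) (auto simp: ell2_def)
    fix x
    have "(cmod (a * f x + b * g x))\<^sup>2 \<le> (cmod (a * f x) + cmod (b * g x))\<^sup>2"
      by (intro power_mono norm_triangle_ineq) auto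
    also have "\<dots> \<le> 2 * (cmod (a * f x))\<^sup>2 + 2 * (cmod (b * g x))\<^sup>2"
      using sum_squares_bound[of "cmod (a * f x)" "cmod (b * g x)"] by (simp add: power2_sum)
    finally show "(cmod (a * f x + b * g x))\<^sup>2 \<le> 2 * (cmod a)\<^sup>2 * (cmod (f x))\<^sup>2 + 2 * (cmod b)\<^sup>2 * (cmod (g x))\<^sup>2"
      by (simp add: norm_mult power_mult_distrib)
  qed auto
  then show ?thesis by (simp add: ell2_def)
qed

lemma ell2_scale: "f \<in> ell2 \<Longrightarrow> (\<lambda>x. a * f x) \<in> ell2"
  using ell2_lin[of f f a 0] by simp

lemma ell2_diff: "f \<in> ell2 \<Longrightarrow> g \<in> ell2 \<Longrightarrow> (\<lambda>x. f x - g x) \<in> ell2"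
  using ell2_lin[of f g 1 "-1"] by simp

lemma ell2_zero: "(\<lambda>x. 0) \<in> ell2"
  by (simp add: ell2_def)

lemma ip_cnj: "ip g f = cnj (ip f g)"
  unfolding ip_def by (simp add: infsum_cnj[symmetric] mult.commute del: infsum_cnj)

lemma ip_lin_left:
  assumes "f \<in> ell2" "g \<in> ell2" "h \<in> ell2"
  shows "ip (\<lambda>x. a * f x + b * g x) h = a * ip f h + b * ip g h"
proof -
  have "ip (\<lambda>x. a * f x + b * g x) h = (\<Sum>\<^sub>\<infinity>x. a * (f x * cnj (h x)) + b * (g x * cnj (h x)))"
    unfolding ip_def by (simp add: algebra_simps)
  also have "\<dots> = a * ip f h + b * ip g h"
    unfolding ip_def
    by (subst infsum_add) (auto intro!: summable_on_cmult_right ip_sum assms simp: infsum_cmult_right')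
  finally show ?thesis .
qed

lemma ip_lin_right:
  assumes "f \<in> ell2" "g \<in> ell2" "h \<in> ell2"
  shows "ip h (\<lambda>x. a * f x + b * g x) = cnj a * ip h f + cnj b * ip h g"
  using ip_lin_left[OF assms, of a b] by (simp add: ip_cnj[of h])

lemma ip_scale_left: "ip (\<lambda>x. a * f x) h = a * ip f h"
  unfolding ip_def by (simp add: mult.assoc infsum_cmult_right')

lemma ip_scale_right: "ip h (\<lambda>x. a * f x) = cnj a * ip h f"
  using ip_scale_left[of a f h] by (simp add: ip_cnj[of h])

lemma ip_diff_left:
  "f \<in> ell2 \<Longrightarrow> g \<in> ell2 \<Longrightarrow> h \<in> ell2 \<Longrightarrow> ip (\<lambda>x. f x - g x) h = ip f h - ip g h"
  using ip_lin_left[of f g h 1 "-1"] by simp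

lemma ip_diff_right:
  "f \<in> ell2 \<Longrightarrow> g \<in> ell2 \<Longrightarrow> h \<in> ell2 \<Longrightarrow> ip h (\<lambda>x. f x - g x) = ip h f - ip h g"
  using ip_lin_right[of f g h 1 "-1"] by simp

lemma ip_self: "f \<in> ell2 \<Longrightarrow> ip f f = of_real (n2 f)"
proof -
  assume f: "f \<in> ell2"
  have "((\<lambda>x. complex_of_real ((cmod (f x))\<^sup>2)) has_sum of_real (n2 f)) UNIV"
    unfolding n2_def by (intro has_sum_of_real has_sum_infsum ell2_sum f)
  then show ?thesis
    unfolding ip_def using infsumI by (simp only: complex_norm_square)
qed

lemma n2_zero: "n2 (\<lambda>x. 0) = 0"
  by (simp add: n2_def)

lemma n2_eq_0: "f \<in> ell2 \<Longrightarrow> n2 f \<le> 0 \<Longrightarrow> f = (\<lambda>_. 0)"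
  using ell2_point[of f] by (metis (no_types, opaque_lifting) norm_eq_zero order.trans power2_less_eq_zero_iff)

lemma n2_scale: "n2 (\<lambda>x. a * f x) = (cmod a)\<^sup>2 * n2 f"
  unfolding n2_def by (simp add: norm_mult power_mult_distrib infsum_cmult_right')

lemma n2_lin:
  assumes "f \<in> ell2" "g \<in> ell2"
  shows "n2 (\<lambda>x. f x + of_real t * g x) = n2 f + 2 * t * Re (ip f g) + t\<^sup>2 * n2 g"
proof -
  have e: "(\<lambda>x. f x + of_real t * g x) = (\<lambda>x. 1 * f x + of_real t * g x)" by simp
  have m: "(\<lambda>x. 1 * f x + of_real t * g x) \<in> ell2" by (rule ell2_lin[OF assms])
  define F where "F = (\<lambda>x. 1 * f x + of_real t * g x)"
  have F: "F \<in> ell2" using m by (simp add: F_def)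
  have "complex_of_real (n2 (\<lambda>x. f x + of_real t * g x)) = ip F F"
    unfolding e F_def[symmetric] by (rule ip_self[OF F, symmetric])
  also have "\<dots> = 1 * ip f F + of_real t * ip g F"
    using ip_lin_left[OF assms F, of 1 "of_real t"] by (simp only: F_def)
  also have "ip f F = cnj 1 * ip f f + cnj (of_real t) * ip f g"
    using ip_lin_right[OF assms assms(1), of 1 "of_real t"] by (simp only: F_def)
  also have "ip g F = cnj 1 * ip g f + cnj (of_real t) * ip g g"
    using ip_lin_right[OF assms assms(2), of 1 "of_real t"] by (simp only: F_def)
  also have "1 * (cnj 1 * ip f f + cnj (of_real t) * ip f g) +
      of_real t * (cnj 1 * ip g f + cnj (of_real t) * ip g g) =
    ip f f + of_real t * ip f g + of_real t * ip g f + of_real (t\<^sup>2) * ip g g"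
    by (simp add: algebra_simps power2_eq_square)
  also have "\<dots> = of_real (n2 f + 2 * t * Re (ip f g) + t\<^sup>2 * n2 g)"
  proof -
    have "ip g f = cnj (ip f g)" by (rule ip_cnj)
    then show ?thesis by (simp add: ip_self[OF assms(1)] ip_self[OF assms(2)] complex_eq_iff)
  qed
  finally show ?thesis using of_real_eq_iff by blast
qed

lemma ell2_CS:
  assumes "f \<in> ell2" "g \<in> ell2"
  shows "(\<Sum>\<^sub>\<infinity>x. cmod (f x) * cmod (g x)) \<le> sqrt (n2 f * n2 g)"
proof (rule infsum_le_finite_sums[OF ell2_prod[OF assms]])
  fix S :: "'a set" assume S: "finite S"
  have "(\<Sum>x\<in>S. cmod (f x) * cmod (g x))\<^sup>2 \<le> (\<Sum>x\<in>S. (cmod (f x))\<^sup>2) * (\<Sum>x\<in>S. (cmod (g x))\<^sup>2)"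
    by (rule Cauchy_Schwarz_ineq_sum)
  also have "\<dots> \<le> n2 f * n2 g"
    by (intro mult_mono n2_finite_le assms S sum_nonneg n2_nonneg) auto
  finally show "(\<Sum>x\<in>S. cmod (f x) * cmod (g x)) \<le> sqrt (n2 f * n2 g)"
    by (rule real_le_rsqrt)
qed

lemma ip_CS:
  assumes "f \<in> ell2" "g \<in> ell2"
  shows "cmod (ip f g) \<le> sqrt (n2 f * n2 g)"
proof -
  have "cmod (ip f g) \<le> (\<Sum>\<^sub>\<infinity>x. cmod (f x * cnj (g x)))"
    unfolding ip_def by (rule norm_infsum_bound) (use ell2_prod[OF assms] in \<open>simp add: norm_mult\<close>)
  also have "\<dots> \<le> sqrt (n2 f * n2 g)"
    using ell2_CS[OF assms] by (simp add: norm_mult)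
  finally show ?thesis .
qed

section \<open>Weak convergence: bounded sequences with pointwise limits\<close>

lemma infsum_tail:
  fixes f :: "'a \<Rightarrow> real"
  assumes "f summable_on UNIV" "e > 0" "\<And>x. f x \<ge> 0"
  shows "\<exists>S. finite S \<and> infsum f (- S) < e"
proof -
  obtain S where S: "finite S" "norm (sum f S - infsum f UNIV) \<le> e/2"
    using infsum_finite_approximation[OF assms(1), of "e/2"] assms(2)
    unfolding dist_norm by (metis half_gt_zero)
  have "infsum f UNIV = infsum f S + infsum f (- S)"
    using infsum_Un_disjoint[of f S "- S"] summable_on_subset_banach[OF assms(1), of S]
      summable_on_subset_banach[OF assms(1), of "- S"] by simp
  then have "infsum f (- S) < e" using S assms(2) by simp
  with S show ?thesis by blast
qed

lemma tail_ell2: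
  assumes "f \<in> ell2" "e > 0"
  shows "\<exists>S. finite S \<and> n2 (\<lambda>x. if x \<in> S then 0 else f x) < e"
proof -
  obtain S where S: "finite S" "infsum (\<lambda>x. (cmod (f x))\<^sup>2) (- S) < e"
    using infsum_tail[OF ell2_sum[OF assms(1)] assms(2)] by auto
  have "n2 (\<lambda>x. if x \<in> S then 0 else f x) = infsum (\<lambda>x. (cmod (f x))\<^sup>2) (- S)"
    unfolding n2_def by (rule infsum_cong_neutral) auto
  with S show ?thesis by auto
qed

text \<open>Split at a finite set carrying all but \<open>e\<close> of the norm of \<open>g\<close>:
  the finite part tends to 0 term by term, the tail is small uniformly in \<open>n\<close> by
  Cauchy-Schwarz. The absolute values stay inside the sum because it later bounds a Fourier series
  uniformly on the torus.\<close>

lemma weak_abs: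
  fixes F :: "nat \<Rightarrow> 'a \<Rightarrow> complex"
  assumes g: "g \<in> ell2" and F: "\<And>n. F n \<in> ell2" "\<And>n. n2 (F n) \<le> C"
    and lim: "\<And>x. (\<lambda>n. F n x) \<longlonglongrightarrow> 0"
  shows "(\<lambda>n. \<Sum>\<^sub>\<infinity>x. cmod (g x) * cmod (F n x)) \<longlonglongrightarrow> 0"
proof (rule LIMSEQ_I)
  fix r :: real assume r: "r > 0"
  have C: "C \<ge> 0" using F(2)[of 0] n2_nonneg[of "F 0"] by linarith
  \<comment> \<open>Makes the tail bound \<open>sqrt (e * C)\<close> at most \<open>r/2\<close>; the
    \<open>+ 1\<close> covers \<open>C = 0\<close>.\<close>
  define e where "e = (r/2)\<^sup>2 / (C + 1)"
  have e: "e > 0" using r C by (simp add: e_def)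
  obtain S where S: "finite S" "n2 (\<lambda>x. if x \<in> S then 0 else g x) < e"
    using tail_ell2[OF g e] by blast
  define g1 where "g1 = (\<lambda>x. if x \<in> S then 0 else g x)"
  have g1: "g1 \<in> ell2" by (rule ell2_le(1)[OF g, of _ 1]) (auto simp: g1_def)
  have bd: "(\<Sum>\<^sub>\<infinity>x. cmod (g x) * cmod (F n x)) \<le> (\<Sum>x\<in>S. cmod (g x) * cmod (F n x)) + sqrt (e * C)" for n
  proof -
    have s: "(\<lambda>x. cmod (g x) * cmod (F n x)) summable_on A" for A
      using ell2_prod[OF g F(1)] summable_on_subset_banach by blast
    have "(\<Sum>\<^sub>\<infinity>x. cmod (g x) * cmod (F n x)) = (\<Sum>x\<in>S. cmod (g x) * cmod (F n x)) + infsum (\<lambda>x. cmod (g x) * cmod (F n x)) (- S)"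
      using infsum_Un_disjoint[of "\<lambda>x. cmod (g x) * cmod (F n x)" S "- S"] s S(1) by simp
    also have "infsum (\<lambda>x. cmod (g x) * cmod (F n x)) (- S) = (\<Sum>\<^sub>\<infinity>x. cmod (g1 x) * cmod (F n x))"
      by (rule infsum_cong_neutral) (auto simp: g1_def)
    also have "\<dots> \<le> sqrt (n2 g1 * n2 (F n))" by (rule ell2_CS[OF g1 F(1)])
    also have "\<dots> \<le> sqrt (e * C)"
      using S(2) F(2)[of n] by (intro real_sqrt_le_mono mult_mono n2_nonneg) (auto simp: g1_def e less_imp_le)
    finally show ?thesis by simp
  qed
  have "(\<lambda>n. \<Sum>x\<in>S. cmod (g x) * cmod (F n x)) \<longlonglongrightarrow> (\<Sum>x\<in>S. cmod (g x) * cmod (0::complex))"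
    by (intro tendsto_sum tendsto_mult tendsto_norm lim tendsto_const)
  then have "(\<lambda>n. \<Sum>x\<in>S. cmod (g x) * cmod (F n x)) \<longlonglongrightarrow> 0" by simp
  then obtain N where N: "\<forall>n\<ge>N. norm ((\<Sum>x\<in>S. cmod (g x) * cmod (F n x)) - 0) < r/2"
    using r LIMSEQ_D[of _ 0 "r/2"] by (meson half_gt_zero)
  have "sqrt (e * C) \<le> sqrt ((r/2)\<^sup>2)"
    using C r by (intro real_sqrt_le_mono) (simp add: e_def field_simps)
  then have sq: "sqrt (e * C) \<le> r/2" using r by simp
  have "norm ((\<Sum>\<^sub>\<infinity>x. cmod (g x) * cmod (F n x)) - 0) < r" if "n \<ge> N" for n
  proof -
    have "0 \<le> (\<Sum>\<^sub>\<infinity>x. cmod (g x) * cmod (F n x))" by (rule infsum_nonneg) simp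
    then show ?thesis using bd[of n] N that sq by fastforce
  qed
  then show "\<exists>N. \<forall>n\<ge>N. norm ((\<Sum>\<^sub>\<infinity>x. cmod (g x) * cmod (F n x)) - 0) < r" by blast
qed

text \<open>Fatou's lemma for counting measure, through finite partial sums: norms can only drop in
  a weak limit.\<close>

lemma weak_limit_ell2:
  fixes F :: "nat \<Rightarrow> 'a \<Rightarrow> complex"
  assumes F: "\<And>n. F n \<in> ell2" "\<And>n. n2 (F n) \<le> C"
    and lim: "\<And>x. (\<lambda>n. F n x) \<longlonglongrightarrow> f x"
  shows "f \<in> ell2" "n2 f \<le> C"
proof -
  have "(\<Sum>x\<in>S. (cmod (f x))\<^sup>2) \<le> C" if "finite S" for S
  proof (rule LIMSEQ_le_const2)
    show "(\<lambda>n. \<Sum>x\<in>S. (cmod (F n x))\<^sup>2) \<longlonglongrightarrow> (\<Sum>x\<in>S. (cmod (f x))\<^sup>2)"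
      by (intro tendsto_sum tendsto_power tendsto_norm lim)
    show "\<exists>N. \<forall>n\<ge>N. (\<Sum>x\<in>S. (cmod (F n x))\<^sup>2) \<le> C"
      using n2_finite_le[OF F(1) that] F(2) order.trans by blast
  qed
  then show "f \<in> ell2" "n2 f \<le> C" using ell2_bound by blast+
qed

text \<open>Parallelogram law with the term of \<open>f + g\<close> dropped.\<close>

lemma n2_diff_le:
  assumes "f \<in> ell2" "g \<in> ell2"
  shows "n2 (\<lambda>x. f x - g x) \<le> 2 * n2 f + 2 * n2 g"
proof -
  have 1: "n2 (\<lambda>x. f x - g x) = n2 f - 2 * Re (ip f g) + n2 g"
    using n2_lin[OF assms, of "-1"] by simp
  have 2: "0 \<le> n2 f + 2 * Re (ip f g) + n2 g"
    using n2_lin[OF assms, of "1"] n2_nonneg[of "\<lambda>x. f x + of_real 1 * g x"] by simp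
  show ?thesis using 1 2 by linarith
qed

lemma weak_abs_diff:
  fixes F :: "nat \<Rightarrow> 'a \<Rightarrow> complex"
  assumes g: "g \<in> ell2" and F: "\<And>n. F n \<in> ell2" "\<And>n. n2 (F n) \<le> C"
    and lim: "\<And>x. (\<lambda>n. F n x) \<longlonglongrightarrow> f x"
  shows "(\<lambda>n. \<Sum>\<^sub>\<infinity>x. cmod (g x) * cmod (F n x - f x)) \<longlonglongrightarrow> 0"
proof (rule weak_abs[OF g])
  note f = weak_limit_ell2[OF F lim]
  show "(\<lambda>x. F n x - f x) \<in> ell2" for n by (rule ell2_diff[OF F(1) f(1)])
  show "n2 (\<lambda>x. F n x - f x) \<le> 4 * C" for n
    using n2_diff_le[OF F(1) f(1), of n] F(2)[of n] f(2) by linarith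
  show "(\<lambda>n. F n x - f x) \<longlonglongrightarrow> 0" for x using lim LIM_zero by blast
qed

lemma weak_ip:
  fixes F :: "nat \<Rightarrow> 'a \<Rightarrow> complex"
  assumes g: "g \<in> ell2" and F: "\<And>n. F n \<in> ell2" "\<And>n. n2 (F n) \<le> C"
    and lim: "\<And>x. (\<lambda>n. F n x) \<longlonglongrightarrow> f x"
  shows "(\<lambda>n. ip (F n) g) \<longlonglongrightarrow> ip f g"
proof -
  note f = weak_limit_ell2[OF F lim]
  have "norm (ip (F n) g - ip f g) \<le> (\<Sum>\<^sub>\<infinity>x. cmod (g x) * cmod (F n x - f x))" for n
  proof -
    have "ip (F n) g - ip f g = ip (\<lambda>x. F n x - f x) g"
      by (rule ip_diff_left[symmetric]) (use F f g in auto)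
    moreover have "norm \<dots> \<le> (\<Sum>\<^sub>\<infinity>x. cmod ((F n x - f x) * cnj (g x)))"
      unfolding ip_def
      by (rule norm_infsum_bound)
         (use ell2_prod[OF ell2_diff[OF F(1) f(1)] g] in \<open>simp add: norm_mult\<close>)
    ultimately show ?thesis by (simp add: norm_mult mult.commute)
  qed
  then have "(\<lambda>n. ip (F n) g - ip f g) \<longlonglongrightarrow> 0"
    by (rule Lim_null_comparison[OF always_eventually[OF allI] weak_abs_diff[OF g F lim]])
  then show ?thesis by (simp add: LIM_zero_iff)
qed

text \<open>Weak sequential compactness of bounded sets, by Cantor's diagonal argument over the
  countable index type.\<close>

lemma pointwise_subseq:
  fixes F :: "nat \<Rightarrow> 'a::countable \<Rightarrow> complex"
  assumes "\<And>n x. cmod (F n x) \<le> C"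
  shows "\<exists>r f. strict_mono r \<and> (\<forall>x. (\<lambda>n. F (r n) x) \<longlonglongrightarrow> f x)"
proof -
  \<comment> \<open>Stage \<open>k\<close> secures convergence at the point with code
    \<open>k\<close>; it is vacuous when no point has that code.\<close>
  interpret subseqs "\<lambda>k s. \<forall>x. to_nat (x::'a) = k \<longrightarrow> convergent (\<lambda>n. F (s n) x)"
  proof
    fix k and s :: "nat \<Rightarrow> nat" assume "strict_mono s"
    show "\<exists>r'. strict_mono r' \<and> (\<forall>x. to_nat (x::'a) = k \<longrightarrow> convergent (\<lambda>n. F ((s \<circ> r') n) x))"
    proof (cases "\<exists>x::'a. to_nat x = k")
      case True
      then obtain x :: 'a where x: "to_nat x = k" by blast
      have "compact (cball (0::complex) C)" by simp
      moreover have "\<forall>n. F (s n) x \<in> cball 0 C" using assms by simp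
      ultimately obtain l r where "strict_mono r" "((\<lambda>n. F (s n) x) \<circ> r) \<longlonglongrightarrow> l"
        unfolding compact_def by metis
      then have "strict_mono r \<and> (\<forall>y. to_nat (y::'a) = k \<longrightarrow> convergent (\<lambda>n. F ((s \<circ> r) n) y))"
        using x by (auto simp: convergent_def o_def)
      then show ?thesis by blast
    next
      case False
      then show ?thesis using strict_mono_id by blast
    qed
  qed
  have "convergent (\<lambda>n. F (diagseq n) x)" for x
  proof -
    \<comment> \<open>Past stage \<open>to_nat x\<close> the diagonal sequence is a subsequence of
      one that converges at \<open>x\<close>.\<close>
    have "\<forall>y. to_nat (y::'a) = to_nat x \<longrightarrow> convergent (\<lambda>n. F ((diagseq \<circ> (+) (Suc (to_nat x))) n) y)"
    proof (rule diagseq_holds)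
      fix r s :: "nat \<Rightarrow> nat" and n
      assume "strict_mono r" and a: "\<forall>x. to_nat (x::'a) = n \<longrightarrow> convergent (\<lambda>n. F (s n) x)"
      then show "\<forall>x. to_nat (x::'a) = n \<longrightarrow> convergent (\<lambda>n. F ((s \<circ> r) n) x)"
        using convergent_subseq_convergent[of "\<lambda>n. F (s n) x" r for x] by (simp only: o_def) blast
    qed
    then have "convergent (\<lambda>n. F (diagseq (Suc (to_nat x) + n)) x)"
      by (simp add: o_def)
    then have "convergent (\<lambda>n. F (diagseq (n + Suc (to_nat x))) x)"
      by (subst add.commute)
    then show ?thesis
      by (rule iffD1[OF convergent_ignore_initial_segment[where f="\<lambda>n. F (diagseq n) x"]])
  qed
  then have "\<forall>x. (\<lambda>n. F (diagseq n) x) \<longlonglongrightarrow> lim (\<lambda>n. F (diagseq n) x)"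
    by (simp add: convergent_LIMSEQ_iff)
  with subseq_diagseq show ?thesis
    by (intro exI[of _ diagseq] exI[of _ "\<lambda>x. lim (\<lambda>n. F (diagseq n) x)"] conjI)
qed

section \<open>Finite linear combinations\<close>

lemma ell2_comb:
  assumes "finite I" "\<And>i. i \<in> I \<Longrightarrow> g i \<in> ell2"
  shows "comb I c g \<in> ell2"
  using assms
proof (induction I rule: finite_induct)
  case empty then show ?case by (simp add: comb_def ell2_zero)
next
  case (insert i I)
  have "comb (insert i I) c g = (\<lambda>x. c i * g i x + 1 * comb I c g x)"
    using insert by (simp add: comb_def)
  then show ?case using insert ell2_lin[of "g i" "comb I c g" "c i" 1] by auto
qed

lemma ip_comb_left:
  assumes "finite I" "\<And>i. i \<in> I \<Longrightarrow> g i \<in> ell2" "h \<in> ell2"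
  shows "ip (comb I c g) h = (\<Sum>i\<in>I. c i * ip (g i) h)"
  using assms
proof (induction I rule: finite_induct)
  case empty then show ?case by (simp add: comb_def ip_def)
next
  case (insert i I)
  have "comb (insert i I) c g = (\<lambda>x. c i * g i x + 1 * comb I c g x)"
    using insert by (simp add: comb_def)
  then show ?case using insert ip_lin_left[of "g i" "comb I c g" h "c i" 1]
    by (simp add: ell2_comb)
qed

lemma ip_comb_right:
  assumes "finite I" "\<And>i. i \<in> I \<Longrightarrow> g i \<in> ell2" "h \<in> ell2"
  shows "ip h (comb I c g) = (\<Sum>i\<in>I. cnj (c i) * ip h (g i))"
proof -
  have "ip h (comb I c g) = cnj (\<Sum>i\<in>I. c i * ip (g i) h)"
    using ip_comb_left[OF assms, where c=c] ip_cnj[of h "comb I c g"] by (simp only:)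
  also have "\<dots> = (\<Sum>i\<in>I. cnj (c i) * cnj (ip (g i) h))" by simp
  also have "\<dots> = (\<Sum>i\<in>I. cnj (c i) * ip h (g i))"
    by (rule sum.cong[OF refl]) (simp only: ip_cnj[of h])
  finally show ?thesis .
qed

lemma n2_comb_orthonormal:
  assumes "finite I" "\<And>i. i \<in> I \<Longrightarrow> g i \<in> ell2"
    and "\<And>i j. i \<in> I \<Longrightarrow> j \<in> I \<Longrightarrow> ip (g i) (g j) = (if i = j then 1 else 0)"
  shows "n2 (comb I c g) = (\<Sum>i\<in>I. (cmod (c i))\<^sup>2)"
proof -
  have "complex_of_real (n2 (comb I c g)) = ip (comb I c g) (comb I c g)"
    by (rule ip_self[symmetric]) (rule ell2_comb[OF assms(1,2)])
  also have "\<dots> = (\<Sum>i\<in>I. c i * (\<Sum>j\<in>I. cnj (c j) * ip (g i) (g j)))"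
  proof (subst ip_comb_left[OF assms(1,2) ell2_comb[OF assms(1,2)]])
    show "(\<Sum>i\<in>I. c i * ip (g i) (comb I c g)) = (\<Sum>i\<in>I. c i * (\<Sum>j\<in>I. cnj (c j) * ip (g i) (g j)))"
      by (intro sum.cong refl arg_cong2[where f=times] ip_comb_right assms)
  qed
  also have "\<dots> = (\<Sum>i\<in>I. c i * cnj (c i))"
  proof (rule sum.cong[OF refl])
    fix i assume i: "i \<in> I"
    have "(\<Sum>j\<in>I. cnj (c j) * ip (g i) (g j)) = (\<Sum>j\<in>I. if i = j then cnj (c j) else 0)"
      by (rule sum.cong) (auto simp: assms(3) i)
    then show "c i * (\<Sum>j\<in>I. cnj (c j) * ip (g i) (g j)) = c i * cnj (c i)"
      using assms(1) i by simp
  qed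
  also have "\<dots> = of_real (\<Sum>i\<in>I. (cmod (c i))\<^sup>2)" by (simp add: complex_norm_square[symmetric] flip: of_real_power)
  finally show ?thesis using of_real_eq_iff by blast
qed

text \<open>A homogeneous system of \<open>j\<close> equations in more than \<open>j\<close>
  unknowns, by induction on the number of equations. It supplies the vector orthogonal to given
  eigenvectors in the Courant-Fischer argument.\<close>

lemma nontrivial_comb:
  fixes u :: "'i \<Rightarrow> nat \<Rightarrow> complex"
  assumes "finite I" "j < card I"
  shows "\<exists>c. (\<exists>i\<in>I. c i \<noteq> 0) \<and> (\<forall>l<j. (\<Sum>i\<in>I. c i * u i l) = 0)"
  using assms
proof (induction j arbitrary: I u)
  case 0
  then have "I \<noteq> {}" by auto
  then show ?case by (intro exI[of _ "\<lambda>_. 1"]) auto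
next
  case (Suc j)
  show ?case
  proof (cases "\<forall>i\<in>I. u i j = 0")
    case True
    have "j < card I" using Suc.prems by simp
    then obtain c where c: "\<exists>i\<in>I. c i \<noteq> 0" "\<forall>l<j. (\<Sum>i\<in>I. c i * u i l) = 0"
      using Suc.IH[OF Suc.prems(1)] by blast
    then show ?thesis using True by (intro exI[of _ c]) (auto simp: less_Suc_eq)
  next
    case False
    then obtain p where p: "p \<in> I" "u p j \<noteq> 0" by blast
    \<comment> \<open>Gaussian elimination: equation \<open>j\<close> is solved for the unknown
      \<open>p\<close>, after which its reduced coefficients \<open>v i j\<close> vanish.\<close>
    define v where "v = (\<lambda>i l. u i l - u i j / u p j * u p l)"
    have "finite (I - {p})" "j < card (I - {p})"
      using Suc.prems p by auto
    from Suc.IH[OF this, of v] obtain d where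
      d: "\<exists>i\<in>I-{p}. d i \<noteq> 0" "\<forall>l<j. (\<Sum>i\<in>I-{p}. d i * v i l) = 0" by blast
    define b where "b = - (\<Sum>i\<in>I-{p}. d i * (u i j / u p j))"
    define c where "c = d(p := b)"
    have s: "(\<Sum>i\<in>I. c i * u i l) = (\<Sum>i\<in>I-{p}. d i * v i l)" for l
    proof -
      have "(\<Sum>i\<in>I. c i * u i l) = b * u p l + (\<Sum>i\<in>I-{p}. d i * u i l)"
        using p Suc.prems by (subst sum.remove[of I p]) (auto simp: c_def intro!: sum.cong)
      also have "\<dots> = (\<Sum>i\<in>I-{p}. d i * v i l)"
        by (simp add: b_def v_def algebra_simps sum_subtractf sum_distrib_left)
      finally show ?thesis .
    qed
    have "v i j = 0" for i using p by (simp add: v_def)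
    then have "\<forall>l<Suc j. (\<Sum>i\<in>I. c i * u i l) = 0"
      using d(2) by (auto simp: s less_Suc_eq)
    moreover have "\<exists>i\<in>I. c i \<noteq> 0" using d(1) by (auto simp: c_def)
    ultimately show ?thesis by blast
  qed
qed

section \<open>Eigenvectors of weakly semicontinuous forms\<close>

text \<open>The subspace is a parameter because the free operator is studied on all of
  \<open>ell2\<close> while eigenvalues are counted on \<open>l2e\<close>.\<close>

locale herm_op =
  fixes S :: "('a \<Rightarrow> complex) set" and T
  assumes S_ell2: "f \<in> S \<Longrightarrow> f \<in> ell2"
    and S_lin: "f \<in> S \<Longrightarrow> g \<in> S \<Longrightarrow> (\<lambda>x. a * f x + b * g x) \<in> S"
    and T_S: "f \<in> S \<Longrightarrow> T f \<in> S"
    and T_lin: "f \<in> S \<Longrightarrow> g \<in> S \<Longrightarrow> T (\<lambda>x. a * f x + b * g x) = (\<lambda>x. a * T f x + b * T g x)"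
    and T_herm: "f \<in> S \<Longrightarrow> g \<in> S \<Longrightarrow> ip (T f) g = ip f (T g)"
begin

lemma S_scale: "f \<in> S \<Longrightarrow> (\<lambda>x. a * f x) \<in> S"
  using S_lin[of f f a 0] by simp

lemma T_scale: "f \<in> S \<Longrightarrow> T (\<lambda>x. a * f x) = (\<lambda>x. a * T f x)"
  using T_lin[of f f a 0] by simp

lemma form_scale: "f \<in> S \<Longrightarrow> Re (ip (T (\<lambda>x. a * f x)) (\<lambda>x. a * f x)) = (cmod a)\<^sup>2 * Re (ip (T f) f)"
proof -
  assume f: "f \<in> S"
  have "ip (T (\<lambda>x. a * f x)) (\<lambda>x. a * f x) = (a * cnj a) * ip (T f) f"
    unfolding T_scale[OF f] ip_scale_left ip_scale_right by simp
  also have "a * cnj a = of_real ((cmod a)\<^sup>2)" by (simp only: complex_norm_square)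
  finally show ?thesis by simp
qed

lemma form_add:
  assumes "f \<in> S" "h \<in> S"
  shows "Re (ip (T (\<lambda>x. f x + of_real t * h x)) (\<lambda>x. f x + of_real t * h x)) =
     Re (ip (T f) f) + 2 * t * Re (ip (T f) h) + t\<^sup>2 * Re (ip (T h) h)"
proof -
  define F where "F = (\<lambda>x. 1 * f x + of_real t * h x)"
  have F: "F \<in> S" unfolding F_def by (rule S_lin[OF assms])
  note m = S_ell2[OF assms(1)] S_ell2[OF assms(2)] S_ell2[OF F]
    S_ell2[OF T_S[OF assms(1)]] S_ell2[OF T_S[OF assms(2)]]
  have TF: "T F = (\<lambda>x. 1 * T f x + of_real t * T h x)"
    unfolding F_def by (rule T_lin[OF assms])
  have "ip (T F) F = 1 * ip (T f) F + of_real t * ip (T h) F"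
    unfolding TF by (rule ip_lin_left[OF m(4,5,3)])
  also have "ip (T f) F = cnj 1 * ip (T f) f + cnj (of_real t) * ip (T f) h"
    unfolding F_def by (rule ip_lin_right[OF m(1,2,4)])
  also have "ip (T h) F = cnj 1 * ip (T h) f + cnj (of_real t) * ip (T h) h"
    unfolding F_def by (rule ip_lin_right[OF m(1,2,5)])
  also have "ip (T h) f = cnj (ip (T f) h)"
    using T_herm[OF assms(2,1)] ip_cnj[of h "T f"] by simp
  finally have "Re (ip (T F) F) =
     Re (ip (T f) f) + 2 * t * Re (ip (T f) h) + t\<^sup>2 * Re (ip (T h) h)"
    by (simp add: algebra_simps power2_eq_square)
  then show ?thesis by (simp add: F_def)
qed

end

text \<open>
  A bounded sequence with pointwise limits is a weakly convergent one. Upper semicontinuity of the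
  form along such sequences is what remains of compactness for \<open>e - H\<close>, whose form is a
  compact one minus a nonnegative one; so the same argument yields the eigenvalues of \<open>e - H\<close>
  above \<open>0\<close> and those of the Birman-Schwinger operator above any \<open>\<theta> \<ge> 0\<close>.
\<close>

locale usc_form_op = herm_op S T for S :: "('a::countable \<Rightarrow> complex) set" and T +
  assumes S_lim: "(\<And>n. F n \<in> S) \<Longrightarrow> (\<And>x. (\<lambda>n. F n x) \<longlonglongrightarrow> f x) \<Longrightarrow> f \<in> ell2 \<Longrightarrow> f \<in> S"
    and T_bdd: "\<exists>C. \<forall>f\<in>S. Re (ip (T f) f) \<le> C * n2 f"
    and T_usc: "(\<And>n. F n \<in> S) \<Longrightarrow> (\<And>n. n2 (F n) \<le> 1) \<Longrightarrow> (\<And>x. (\<lambda>n. F n x) \<longlonglongrightarrow> f x) \<Longrightarrow> f \<in> S \<Longrightarrow>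
       (\<lambda>n. Re (ip (T (F n)) (F n))) \<longlonglongrightarrow> l \<Longrightarrow> l \<le> Re (ip (T f) f)"
begin

text \<open>The form is maximized over the unit ball of the complement of the earlier eigenvectors.
  The ball replaces the sphere since a weak limit of unit vectors may lose norm; a supremum above
  \<theta> \<ge> 0 is positive, and this forces the maximizer back to norm 1.\<close>

lemma max_vector:
  fixes e :: "nat \<Rightarrow> 'a \<Rightarrow> complex" and lam :: "nat \<Rightarrow> real"
  assumes e: "\<And>l. l < j \<Longrightarrow> e l \<in> S"
    and eig: "\<And>l. l < j \<Longrightarrow> T (e l) = (\<lambda>x. of_real (lam l) * e l x)"
    and th: "\<theta> \<ge> 0" and g0: "g0 \<in> S" and g0e: "\<And>l. l < j \<Longrightarrow> ip g0 (e l) = 0"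
    and g0T: "Re (ip (T g0) g0) > \<theta> * n2 g0"
  shows "\<exists>f s. f \<in> S \<and> n2 f = 1 \<and> (\<forall>l<j. ip f (e l) = 0) \<and> T f = (\<lambda>x. of_real s * f x) \<and> s > \<theta>"
proof -
  define R where "R = (\<lambda>f. Re (ip (T f) f))"
  define P where "P = {f \<in> S. \<forall>l<j. ip f (e l) = 0}"
  define D where "D = {f \<in> P. n2 f \<le> 1}"
  define s where "s = Sup (R ` D)"
  have PS: "f \<in> S" if "f \<in> P" for f using that by (simp add: P_def)
  have P_scale: "(\<lambda>x. a * f x) \<in> P" if "f \<in> P" for a f
    using that by (auto simp: P_def S_scale ip_scale_left)
  obtain C where C: "\<forall>f\<in>S. R f \<le> C * n2 f" using T_bdd by (auto simp: R_def)
  have bdd: "bdd_above (R ` D)"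
  proof (rule bdd_aboveI2[of _ _ "\<bar>C\<bar>"])
    fix f assume "f \<in> D"
    then have "R f \<le> C * n2 f" "n2 f \<le> 1" using C by (auto simp: D_def P_def)
    moreover have "C * n2 f \<le> \<bar>C\<bar> * n2 f" using n2_nonneg[of f] by (simp add: mult_right_mono)
    moreover have "\<bar>C\<bar> * n2 f \<le> \<bar>C\<bar> * 1" using calculation(2) by (intro mult_left_mono) auto
    ultimately show "R f \<le> \<bar>C\<bar>" by simp
  qed
  have g0P: "g0 \<in> P" using g0 g0e by (simp add: P_def)
  have R0: "R f = 0" if "f \<in> S" "n2 f \<le> 0" for f
  proof -
    have "f = (\<lambda>_. 0)" by (rule n2_eq_0[OF S_ell2[OF that(1)] that(2)])
    then show ?thesis by (simp add: R_def ip_def)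
  qed
  have nrm: "(\<lambda>x. of_real (1 / sqrt (n2 f)) * f x) \<in> D \<and>
     R (\<lambda>x. of_real (1 / sqrt (n2 f)) * f x) = R f / n2 f" if "f \<in> P" "n2 f > 0" for f
  proof -
    have c: "(cmod (of_real (1 / sqrt (n2 f))))\<^sup>2 = 1 / n2 f"
      using that(2) by (simp add: norm_divide power_divide)
    show ?thesis
      unfolding D_def R_def
      using P_scale[OF that(1)] that(2) form_scale[OF PS[OF that(1)]]
      by (simp only: n2_scale c mem_Collect_eq) simp
  qed
  have Rle: "R f \<le> s * n2 f" if "f \<in> P" for f
  proof (cases "n2 f > 0")
    case True
    then have "R f / n2 f \<le> s"
      unfolding s_def using nrm[OF that True] by (metis bdd cSup_upper imageI)
    then show ?thesis using True by (simp add: pos_divide_le_eq)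
  next
    case False
    then show ?thesis using R0[OF PS[OF that]] n2_nonneg[of f] by (simp add: not_less order.antisym)
  qed
  have n0: "n2 g0 > 0"
  proof (rule ccontr)
    assume "\<not> n2 g0 > 0"
    then have "R g0 = 0" "n2 g0 = 0" using R0[OF g0] n2_nonneg[of g0] by auto
    then show False using g0T by (simp add: R_def)
  qed
  have sth: "s > \<theta>"
  proof -
    have "\<theta> * n2 g0 < s * n2 g0" using Rle[OF g0P] g0T by (simp add: R_def)
    then show ?thesis using n0 by simp
  qed
  have Dne: "R ` D \<noteq> {}" using nrm[OF g0P n0] by blast
  have "\<exists>f\<in>D. s - 1 / real (Suc n) < R f" for n
  proof -
    have "s - 1 / real (Suc n) < Sup (R ` D)" by (simp add: s_def)
    then show ?thesis using less_cSup_iff[OF Dne bdd] by auto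
  qed
  then obtain F where F: "\<And>n. F n \<in> D" "\<And>n. s - 1 / real (Suc n) < R (F n)" by metis
  have FS: "F n \<in> S" "n2 (F n) \<le> 1" for n using F(1)[of n] by (auto simp: D_def P_def)
  have Fb: "cmod (F n x) \<le> 1" for n x
  proof -
    have "(cmod (F n x))\<^sup>2 \<le> 1"
      using ell2_point[OF S_ell2[OF FS(1)[of n]], of x] FS(2)[of n] by linarith
    then show ?thesis by (simp add: abs_square_le_1)
  qed
  obtain r f where r: "strict_mono r" and lim: "\<And>x. (\<lambda>n. F (r n) x) \<longlonglongrightarrow> f x"
    using pointwise_subseq[of F 1] Fb by blast
  have fl: "f \<in> ell2" "n2 f \<le> 1"
    using weak_limit_ell2[of "\<lambda>n. F (r n)" 1 f] FS S_ell2 lim by auto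
  have fS: "f \<in> S" by (rule S_lim[of "\<lambda>n. F (r n)"]) (use FS lim fl in auto)
  have fe: "ip f (e l) = 0" if "l < j" for l
  proof -
    have "(\<lambda>n. ip (F (r n)) (e l)) \<longlonglongrightarrow> ip f (e l)"
      by (rule weak_ip[where C=1]) (use FS S_ell2 lim e that in auto)
    moreover have "(\<lambda>n. ip (F (r n)) (e l)) = (\<lambda>n. 0)"
      using F(1) that by (auto simp: D_def P_def)
    ultimately show ?thesis using LIMSEQ_unique tendsto_const by metis
  qed
  then have fP: "f \<in> P" using fS by (simp add: P_def)
  have "(\<lambda>n. R (F n)) \<longlonglongrightarrow> s"
  proof (rule tendsto_sandwich)
    show "\<forall>\<^sub>F n in sequentially. s - 1 / real (Suc n) \<le> R (F n)" using F(2) by (simp add: less_imp_le)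
    show "\<forall>\<^sub>F n in sequentially. R (F n) \<le> s"
      using cSup_upper[OF imageI[OF F(1)] bdd] by (simp add: s_def)
    have "(\<lambda>n. s - 1 / real (Suc n)) \<longlonglongrightarrow> s - 0"
      by (intro tendsto_diff tendsto_const LIMSEQ_inverse_real_of_nat[unfolded inverse_eq_divide])
    then show "(\<lambda>n. s - 1 / real (Suc n)) \<longlonglongrightarrow> s" by simp
  qed simp
  then have "(\<lambda>n. R (F (r n))) \<longlonglongrightarrow> s"
    using LIMSEQ_subseq_LIMSEQ[OF _ r, of "\<lambda>n. R (F n)"] by (simp add: o_def)
  then have sR: "s \<le> R f"
    unfolding R_def by (rule T_usc[of "\<lambda>n. F (r n)", rotated -1]) (use FS lim fS in auto)
  have s0: "s > 0" using sth th by linarith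
  have n1: "n2 f = 1"
  proof -
    have "s * 1 \<le> s * n2 f" using sR Rle[OF fP] by linarith
    then show ?thesis using s0 fl(2) by simp
  qed
  have Rf: "R f = s" using sR Rle[OF fP] n1 by simp
  \<comment> \<open>The residual of the eigenvalue equation. By symmetry of \<open>T\<close> it is
    again orthogonal to the earlier eigenvectors, hence an admissible direction of
    variation.\<close>
  define h where "h = (\<lambda>x. T f x - of_real s * f x)"
  have h': "h = (\<lambda>x. 1 * T f x + of_real (- s) * f x)" by (auto simp: h_def)
  have hS: "h \<in> S" unfolding h' by (rule S_lin[OF T_S[OF fS] fS])
  note m = S_ell2[OF fS] S_ell2[OF hS] S_ell2[OF T_S[OF fS]]
  have hip: "ip h g = ip (T f) g - of_real s * ip f g" if "g \<in> S" for g
    unfolding h' using ip_lin_left[OF m(3,1) S_ell2[OF that], of 1 "of_real (- s)"] by simp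
  have "ip h (e l) = 0" if "l < j" for l
    using hip[OF e[OF that]] T_herm[OF fS e[OF that]] fe[OF that]
    by (simp add: eig[OF that] ip_scale_right)
  then have hP: "h \<in> P" using hS by (simp add: P_def)
  define K where "K = s * n2 h - R h"
  \<comment> \<open>Maximality of \<open>f\<close> compared with \<open>f + t h\<close>: the first
    variation in the direction of the residual is its own squared norm.\<close>
  have key: "2 * t * n2 h \<le> t\<^sup>2 * K" for t
  proof -
    have e1: "(\<lambda>x. f x + of_real t * h x) = (\<lambda>x. 1 * f x + of_real t * h x)" by simp
    have "(\<lambda>x. f x + of_real t * h x) \<in> P"
      unfolding P_def mem_Collect_eq e1
    proof (intro conjI allI impI)
      show "(\<lambda>x. 1 * f x + of_real t * h x) \<in> S" by (rule S_lin[OF fS hS])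
      fix l assume l: "l < j"
      show "ip (\<lambda>x. 1 * f x + of_real t * h x) (e l) = 0"
        using ip_lin_left[OF m(1,2) S_ell2[OF e[OF l]], of 1 "of_real t"] fe[OF l] hP l
        by (simp add: P_def)
    qed
    from Rle[OF this] have "R f + 2 * t * Re (ip (T f) h) + t\<^sup>2 * R h \<le>
        s * (n2 f + 2 * t * Re (ip f h) + t\<^sup>2 * n2 h)"
      unfolding R_def form_add[OF fS hS] n2_lin[OF m(1,2)] .
    moreover have "Re (ip (T f) h) - s * Re (ip f h) = n2 h"
      using hip[OF hS] ip_self[OF m(2)] by (simp add: complex_eq_iff)
    ultimately have "2 * t * (Re (ip (T f) h) - s * Re (ip f h)) \<le> t\<^sup>2 * K"
      unfolding Rf n1 K_def by (simp add: algebra_simps)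
    then show ?thesis using \<open>_ = n2 h\<close> by simp
  qed
  have "n2 h \<le> 0"
  proof (rule ccontr)
    assume "\<not> n2 h \<le> 0"
    then have hp: "n2 h > 0" by simp
    have K: "K > 0" using key[of 1] hp by simp
    \<comment> \<open>This \<open>t\<close> maximizes the difference of the two sides of
      \<open>key\<close>.\<close>
    have "2 * (n2 h / K) * n2 h \<le> (n2 h / K)\<^sup>2 * K" by (rule key)
    then have "2 * (n2 h)\<^sup>2 / K \<le> (n2 h)\<^sup>2 / K" using K by (simp add: power2_eq_square)
    then show False using K hp by (simp add: divide_right_mono field_simps)
  qed
  then have "h = (\<lambda>_. 0)" by (rule n2_eq_0[OF m(2)])
  then have "T f = (\<lambda>x. of_real s * f x)" by (simp add: h_def fun_eq_iff)
  then show ?thesis using fS n1 fe sth by blast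
qed

text \<open>Courant-Fischer by deflation: as long as \<open>m < card I\<close>, some nontrivial
  combination of the family is orthogonal to the \<open>m\<close> eigenvectors already found, so the
  form still exceeds \<theta> somewhere on their complement and \<open>max_vector\<close> yields
  another one.\<close>

theorem exists_eigenvectors_above:
  fixes g :: "'i \<Rightarrow> 'a \<Rightarrow> complex"
  assumes I: "finite I" and gS: "\<And>i. i \<in> I \<Longrightarrow> g i \<in> S" and th: "\<theta> \<ge> 0"
    and g: "\<And>c. \<exists>i\<in>I. c i \<noteq> 0 \<Longrightarrow> Re (ip (T (comb I c g)) (comb I c g)) > \<theta> * n2 (comb I c g)"
    and m: "m \<le> card I"
  shows "\<exists>e lam. (\<forall>l<m. e l \<in> S \<and> T (e l) = (\<lambda>x. of_real (lam l) * e l x) \<and> lam l > \<theta>) \<and>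
     (\<forall>k<m. \<forall>l<m. ip (e k) (e l) = (if k = l then 1 else 0))"
  using m
proof (induction m)
  case 0 then show ?case by simp
next
  case (Suc m)
  then obtain e lam where
    e: "\<And>l. l < m \<Longrightarrow> e l \<in> S \<and> T (e l) = (\<lambda>x. of_real (lam l) * e l x) \<and> lam l > \<theta>"
    and on: "\<And>k l. k < m \<Longrightarrow> l < m \<Longrightarrow> ip (e k) (e l) = (if k = l then 1 else 0)"
    by (metis Suc_leD)
  obtain c where c: "\<exists>i\<in>I. c i \<noteq> 0" "\<forall>l<m. (\<Sum>i\<in>I. c i * ip (g i) (e l)) = 0"
    using nontrivial_comb[OF I, of m "\<lambda>i l. ip (g i) (e l)"] Suc.prems by auto
  \<comment> \<open>The index \<open>i\<close> witnesses that \<open>S\<close> is inhabited, which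
    puts the empty combination 0 into \<open>S\<close>.\<close>
  have combS: "comb J c g \<in> S" if "finite J" "J \<subseteq> I" "i \<in> I" for J i
    using that
  proof (induction J rule: finite_induct)
    case empty
    then show ?case using S_scale[OF gS[of i], of 0] by (simp add: comb_def)
  next
    case (insert k J)
    have "comb (insert k J) c g = (\<lambda>x. c k * g k x + 1 * comb J c g x)"
      using insert by (simp add: comb_def)
    then show ?case using S_lin[OF gS[of k], of "comb J c g" "c k" 1] insert by auto
  qed
  have cS: "comb I c g \<in> S" using combS[OF I] c(1) by blast
  have ce: "ip (comb I c g) (e l) = 0" if "l < m" for l
    using ip_comb_left[OF I, of g "e l" c] gS S_ell2 e[OF that] c(2) that by simp
  obtain f s where f: "f \<in> S" "n2 f = 1" "\<forall>l<m. ip f (e l) = 0" "T f = (\<lambda>x. of_real s * f x)" "s > \<theta>"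
    using max_vector[of m e lam \<theta> "comb I c g"] e th cS ce g[OF c(1)] by blast
  have ef: "ip (e l) f = 0" if "l < m" for l
    using f(3) that ip_cnj[of "e l" f] by simp
  have ff: "ip f f = 1" using ip_self[OF S_ell2[OF f(1)]] f(2) by simp
  show ?case
    by (rule exI[of _ "e(m := f)"], rule exI[of _ "lam(m := s)"])
       (use e on f ef ff in \<open>auto simp: less_Suc_eq\<close>)
qed

end

section \<open>Counting eigenvalues by positive families\<close>

lemma sum_fun_apply: "(sum F A :: 'a \<Rightarrow> complex) y = (\<Sum>a\<in>A. F a y)"
  by (induction A rule: infinite_finite_induct) auto

lemma sum_fun_scale: "(\<Sum>b\<in>B. fun_scale (c b) (g b)) = comb B c g"
  by (auto simp: fun_eq_iff sum_fun_apply comb_def fun_scale_def)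

text \<open>Together with \<open>le_cdimE\<close> this expresses \<open>enat n \<le> cdim V\<close>
  by independent sets of size \<open>n\<close>, uniformly in finite and infinite dimension.\<close>

lemma cdim_ge:
  assumes "finite B" "cfun.independent B" "B \<subseteq> V"
  shows "enat (card B) \<le> cdim V"
proof (cases "\<exists>B. finite B \<and> V \<subseteq> cfun.span B")
  case True
  then obtain D where D: "finite D" "V \<subseteq> cfun.span D" by blast
  obtain C where C: "C \<subseteq> V" "cfun.independent C" "V \<subseteq> cfun.span C" "card C = cfun.dim V"
    using cfun.basis_exists by blast
  have "finite C" using cfun.independent_span_bound[OF D(1) C(2)] C(1) D(2) by blast
  then have "card B \<le> card C" using cfun.independent_span_bound[OF _ assms(2)] C(3) assms(3) by blast
  then show ?thesis using True C(4) by (simp add: cdim_def)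
next
  case False
  then have "cdim V = \<infinity>" unfolding cdim_def by (rule if_not_P)
  then show ?thesis by simp
qed

lemma le_cdimE:
  assumes "enat n \<le> cdim V"
  obtains B where "B \<subseteq> V" "finite B" "cfun.independent B" "card B = n"
proof (cases "\<exists>B. finite B \<and> V \<subseteq> cfun.span B")
  case True
  then obtain D where D: "finite D" "V \<subseteq> cfun.span D" by blast
  obtain C where C: "C \<subseteq> V" "cfun.independent C" "V \<subseteq> cfun.span C" "card C = cfun.dim V"
    using cfun.basis_exists by blast
  have "finite C" using cfun.independent_span_bound[OF D(1) C(2)] C(1) D(2) by blast
  have "n \<le> card C" using assms True C(4) by (simp add: cdim_def)
  then obtain B where "B \<subseteq> C" "card B = n" using obtain_subset_with_card_n by metis
  then show ?thesis
    using that[of B] C(1) cfun.independent_mono[OF C(2)] \<open>finite C\<close> finite_subset by blast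
next
  case False
  \<comment> \<open>No finite set spans \<open>V\<close>, so a finite independent set can always be
    extended by a vector of \<open>V\<close> outside its span.\<close>
  have "\<exists>B. B \<subseteq> V \<and> finite B \<and> cfun.independent B \<and> card B = n"
  proof (induction n)
    case 0 then show ?case by (intro exI[of _ "{}"]) (auto simp: cfun.independent_empty)
  next
    case (Suc n)
    then obtain B where B: "B \<subseteq> V" "finite B" "cfun.independent B" "card B = n" by blast
    then obtain x where x: "x \<in> V" "x \<notin> cfun.span B" using False by blast
    then have "x \<notin> B" using cfun.span_base by blast
    then show ?case
      using B x cfun.independent_insertI[OF x(2) B(3)] by (intro exI[of _ "insert x B"]) auto
  qed
  then show ?thesis using that by blast
qed

lemma comb_independent:
  assumes "finite B" "cfun.independent B" "comb B c (\<lambda>b. b) = (\<lambda>_. 0)" "b \<in> B"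
  shows "c b = 0"
proof -
  have "(\<Sum>b\<in>B. fun_scale (c b) b) = 0"
    unfolding sum_fun_scale assms(3) by (simp add: zero_fun_def)
  then show ?thesis
    using cfun.independentD[OF assms(2,1) subset_refl _ assms(4)] by blast
qed

lemma orthonormal_independent:
  assumes J: "finite J" "\<And>l. l \<in> J \<Longrightarrow> e l \<in> ell2"
    and on: "\<And>k l. k \<in> J \<Longrightarrow> l \<in> J \<Longrightarrow> ip (e k) (e l) = (if k = l then 1 else 0)"
  shows "inj_on e J" "cfun.independent (e ` J)"
proof -
  show inj: "inj_on e J"
    by (rule inj_onI) (metis on zero_neq_one)
  show "cfun.independent (e ` J)"
  proof (rule cfun.independent_if_scalars_zero)
    fix f x assume s: "(\<Sum>x\<in>e ` J. fun_scale (f x) x) = 0" and "x \<in> e ` J"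
    then obtain k where k: "k \<in> J" "x = e k" by blast
    have "comb J (\<lambda>l. f (e l)) e = (\<lambda>_. 0)"
      using s unfolding sum_fun_scale comb_def sum.reindex[OF inj] o_def by (simp add: zero_fun_def)
    then have "ip (comb J (\<lambda>l. f (e l)) e) (e k) = 0" by (simp add: ip_def)
    moreover have "ip (comb J (\<lambda>l. f (e l)) e) (e k) = (\<Sum>l\<in>J. f (e l) * ip (e l) (e k))"
      by (rule ip_comb_left) (use J k in auto)
    moreover have "\<dots> = (\<Sum>l\<in>J. if l = k then f (e l) else 0)"
      by (rule sum.cong) (auto simp: on k(1))
    ultimately show "f x = 0" using k J(1) by simp
  qed (use J in auto)
qed

lemma sum_enat: "(\<Sum>a\<in>A. enat (f a)) = enat (\<Sum>a\<in>A. f a)"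
  by (induction A rule: infinite_finite_induct) (auto simp: zero_enat_def)

text \<open>The sum is the supremum of the finite partial sums, and a finite lower bound is reached
  by one of them because \<open>enat\<close> is discrete: values below \<open>n + 1\<close> are at
  most \<open>n\<close>.\<close>

lemma enat_le_infsum_iff:
  fixes f :: "'a \<Rightarrow> enat"
  shows "enat m \<le> infsum f X \<longleftrightarrow> (\<exists>W. finite W \<and> W \<subseteq> X \<and> enat m \<le> sum f W)"
proof -
  have eq: "infsum f X = (SUP F\<in>{F. finite F \<and> F \<subseteq> X}. sum f F)"
    by (rule nonneg_infsum_complete) auto
  show ?thesis
  proof
    assume l: "enat m \<le> infsum f X"
    show "\<exists>W. finite W \<and> W \<subseteq> X \<and> enat m \<le> sum f W"
    proof (cases m)
      case 0 then show ?thesis by (intro exI[of _ "{}"]) (simp add: zero_enat_def)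
    next
      case (Suc n)
      show ?thesis
      proof (rule ccontr)
        assume "\<not> ?thesis"
        then have lt: "sum f W < enat (Suc n)" if "finite W" "W \<subseteq> X" for W
          using that Suc by (auto simp: not_le)
        have "sum f W \<le> enat n" if W: "finite W" "W \<subseteq> X" for W
        proof -
          obtain k where k: "sum f W = enat k"
            using lt[OF W] by (cases "sum f W") auto
          then show ?thesis using lt[OF W] by simp
        qed
        then have "infsum f X \<le> enat n" unfolding eq by (intro SUP_least) auto
        then show False using l Suc by (meson Suc_n_not_le_n enat_ord_simps(1) order.trans)
      qed
    qed
  next
    assume "\<exists>W. finite W \<and> W \<subseteq> X \<and> enat m \<le> sum f W"
    then obtain W where W: "finite W" "W \<subseteq> X" "enat m \<le> sum f W" by blast
    have "sum f W \<le> infsum f X" unfolding eq using W by (intro SUP_upper) auto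
    with W(3) show "enat m \<le> infsum f X" by (rule order.trans)
  qed
qed

lemma (in usc_form_op) T_comb:
  assumes "finite I" "\<And>i. i \<in> I \<Longrightarrow> g i \<in> S" "(\<lambda>_. 0) \<in> S"
  shows "comb I c g \<in> S \<and> T (comb I c g) = comb I c (\<lambda>i. T (g i))"
  using assms
proof (induction I rule: finite_induct)
  case empty
  then show ?case using T_scale[of "\<lambda>_. 0" 0] by (simp add: comb_def)
next
  case (insert k J)
  have e: "comb (insert k J) c g = (\<lambda>x. c k * g k x + 1 * comb J c g x)"
    using insert by (simp add: comb_def)
  have IH: "comb J c g \<in> S \<and> T (comb J c g) = comb J c (\<lambda>i. T (g i))" using insert by auto
  have "T (comb (insert k J) c g) = (\<lambda>x. c k * T (g k) x + 1 * T (comb J c g) x)"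
    unfolding e by (rule T_lin) (use IH insert in auto)
  moreover have "comb (insert k J) c g \<in> S"
    unfolding e by (rule S_lin) (use IH insert in auto)
  ultimately show ?case using IH insert by (simp add: comb_def)
qed

text \<open>
  The largest such \<open>m\<close> is the number of positive eigenvalues of the operator of \<open>Q\<close>
  (Courant-Fischer); the strict inequality makes the family linearly independent.
\<close>

definition positive_family :: "((int ^ 'd \<Rightarrow> complex) \<Rightarrow> real) \<Rightarrow> nat \<Rightarrow> bool"
  where "positive_family Q m \<longleftrightarrow> (\<exists>g :: nat \<Rightarrow> int ^ 'd \<Rightarrow> complex. (\<forall>i<m. g i \<in> l2e) \<and>
    (\<forall>c. (\<exists>i<m. c i \<noteq> 0) \<longrightarrow> Q (comb {..<m} c g) > 0))"

lemma l2e_zero: "(\<lambda>_. 0) \<in> l2e"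
  by (simp add: l2e_def)

text \<open>Brings a family over any finite index set, such as pairs of an eigenvalue and a basis
  vector, to an initial segment of the naturals; coefficients of discarded members are set to
  0.\<close>

lemma positive_family_reindex:
  assumes I: "finite I" "m \<le> card I" and g: "\<And>i. i \<in> I \<Longrightarrow> g i \<in> l2e"
    and Q: "\<And>c. \<exists>i\<in>I. c i \<noteq> 0 \<Longrightarrow> Q (comb I c g) > 0"
  shows "positive_family Q m"
proof -
  obtain h where h: "bij_betw h {..<card I} I"
    using ex_bij_betw_nat_finite[OF I(1)] by (auto simp: atLeast0LessThan)
  have inj: "inj_on h {..<m}" using h I(2) by (auto simp: bij_betw_def intro: inj_on_subset)
  have sub: "h ` {..<m} \<subseteq> I" using h I(2) by (auto simp: bij_betw_def)
  have "Q (comb {..<m} c (\<lambda>i. g (h i))) > 0" if c: "\<exists>i<m. c i \<noteq> 0" for c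
  proof -
    define c' where "c' = (\<lambda>p. if p \<in> h ` {..<m} then c (inv_into {..<m} h p) else 0)"
    have c'h: "c' (h i) = c i" if "i < m" for i using that inj by (auto simp: c'_def)
    have "comb {..<m} c (\<lambda>i. g (h i)) = comb (h ` {..<m}) c' g"
      unfolding comb_def sum.reindex[OF inj] using c'h by simp
    also have "\<dots> = comb I c' g"
      unfolding comb_def
      by (rule ext, rule sum.mono_neutral_left) (use I sub in \<open>auto simp: c'_def\<close>)
    finally show ?thesis using Q[of c'] c c'h sub by fastforce
  qed
  then show ?thesis unfolding positive_family_def
    by (intro exI[of _ "\<lambda>i. g (h i)"]) (use g sub in auto)
qed

text \<open>Eigenvectors of \<open>T\<close> for \<open>lam > 0\<close> are those of
  \<open>Hop\<close> for \<open>z - lam\<close>. A positive family gives orthonormal eigenvectors,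
  grouped by eigenvalue; conversely, bases of the eigenspaces form a positive family because
  distinct eigenspaces are orthogonal and \<open>T\<close> is positive on each.\<close>

lemma eigenvalues_below_iff:
  fixes T Hop :: "(int ^ 'd \<Rightarrow> complex) \<Rightarrow> int ^ 'd \<Rightarrow> complex" and z :: real
  assumes fo: "usc_form_op l2e T"
    and TH: "\<And>f. f \<in> l2e \<Longrightarrow> T f = (\<lambda>x. of_real z * f x - Hop f x)"
  shows "enat m \<le> eigenvalues_below Hop z \<longleftrightarrow> positive_family (\<lambda>f. Re (ip (T f) f)) m"
proof -
  interpret usc_form_op l2e T by (rule fo)
  have eigT: "f \<in> eigenspace Hop w \<longleftrightarrow> f \<in> l2e \<and> T f = (\<lambda>x. of_real (z - w) * f x)" for f w
    by (auto simp: eigenspace_def fun_scale_def TH fun_eq_iff algebra_simps)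
  define X where "X = {w. w < z \<and> is_eigenvalue Hop w}"
  show ?thesis
  proof
    assume "positive_family (\<lambda>f. Re (ip (T f) f)) m"
    then obtain g where g: "\<And>i. i < m \<Longrightarrow> g i \<in> l2e"
      "\<And>c. \<exists>i<m. c i \<noteq> 0 \<Longrightarrow> Re (ip (T (comb {..<m} c g)) (comb {..<m} c g)) > 0"
      unfolding positive_family_def by blast
    have "\<exists>e lam. (\<forall>l<m. e l \<in> l2e \<and> T (e l) = (\<lambda>x. of_real (lam l) * e l x) \<and> lam l > 0) \<and>
        (\<forall>k<m. \<forall>l<m. ip (e k) (e l) = (if k = l then 1 else 0))"
      by (rule exists_eigenvectors_above[of "{..<m}" g 0 m]) (use g in auto)
    then obtain e lam where e: "\<And>l. l < m \<Longrightarrow> e l \<in> l2e \<and> T (e l) = (\<lambda>x. of_real (lam l) * e l x) \<and> lam l > 0"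
      and on: "\<And>k l. k < m \<Longrightarrow> l < m \<Longrightarrow> ip (e k) (e l) = (if k = l then 1 else 0)"
      by blast
    define W where "W = (\<lambda>l. z - lam l) ` {..<m}"
    define J where "J = (\<lambda>w. {l \<in> {..<m}. z - lam l = w})"
    have sub: "e ` J w \<subseteq> eigenspace Hop w" for w
      using e by (auto simp: J_def eigT)
    have ind: "inj_on e (J w)" "cfun.independent (e ` J w)" for w
      by (rule orthonormal_independent; use e on S_ell2 in \<open>auto simp: J_def\<close>)+
    have WX: "W \<subseteq> X"
    proof
      fix w assume "w \<in> W"
      then obtain l where l: "l < m" "w = z - lam l" by (auto simp: W_def)
      have "e l \<noteq> (\<lambda>_. 0)"
      proof
        assume "e l = (\<lambda>_. 0)"
        then have "ip (e l) (e l) = 0" by (simp add: ip_def)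
        then show False using on[OF l(1) l(1)] by simp
      qed
      moreover have "e l \<in> eigenspace Hop w" using sub[of w] l by (auto simp: J_def)
      ultimately show "w \<in> X" using e[OF l(1)] l by (auto simp: X_def is_eigenvalue_def)
    qed
    have "m = (\<Sum>w\<in>W. card (J w))"
      using sum.image_gen[of "{..<m}" "\<lambda>_. 1::nat" "\<lambda>l. z - lam l"] by (simp add: W_def J_def)
    then have "enat m = (\<Sum>w\<in>W. enat (card (e ` J w)))"
      by (simp add: sum_enat card_image[OF ind(1)])
    also have "\<dots> \<le> (\<Sum>w\<in>W. cdim (eigenspace Hop w))"
      by (intro sum_mono cdim_ge ind(2) sub) (simp add: J_def)
    finally show "enat m \<le> eigenvalues_below Hop z"
      unfolding eigenvalues_below_def enat_le_infsum_iff X_def[symmetric]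
      by (intro exI[of _ W]) (use WX in \<open>auto simp: W_def\<close>)
  next
    assume "enat m \<le> eigenvalues_below Hop z"
    then obtain W where W: "finite W" "W \<subseteq> X" "enat m \<le> (\<Sum>w\<in>W. cdim (eigenspace Hop w))"
      unfolding eigenvalues_below_def enat_le_infsum_iff X_def[symmetric] by blast
    \<comment> \<open>An infinite-dimensional eigenspace alone supplies \<open>m\<close> vectors, so
      an infinite dimension is cut down to \<open>m\<close>.\<close>
    define n where "n = (\<lambda>w. case cdim (eigenspace Hop w) of enat k \<Rightarrow> k | \<infinity> \<Rightarrow> m)"
    have n: "enat (n w) \<le> cdim (eigenspace Hop w)" for w
      by (simp add: n_def split: enat.split)
    have mn: "m \<le> (\<Sum>w\<in>W. n w)"
    proof (cases "\<exists>w\<in>W. cdim (eigenspace Hop w) = \<infinity>")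
      case True
      then obtain w where "w \<in> W" "n w = m" by (auto simp: n_def)
      then show ?thesis using member_le_sum[of w W n] W(1) by simp
    next
      case False
      then have "cdim (eigenspace Hop w) = enat (n w)" if "w \<in> W" for w
        using that by (auto simp: n_def split: enat.split)
      then show ?thesis using W(3) by (simp add: sum_enat)
    qed
    have "\<forall>w. \<exists>B. B \<subseteq> eigenspace Hop w \<and> finite B \<and> cfun.independent B \<and> card B = n w"
      using le_cdimE[OF n] by metis
    then obtain B where B: "\<And>w. B w \<subseteq> eigenspace Hop w" "\<And>w. finite (B w)"
      "\<And>w. cfun.independent (B w)" "\<And>w. card (B w) = n w" by metis
    show "positive_family (\<lambda>f. Re (ip (T f) f)) m"
    proof (rule positive_family_reindex[where I="Sigma W B" and g=snd])
      show "finite (Sigma W B)" using W(1) B(2) by auto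
      show "m \<le> card (Sigma W B)" using mn W(1) B(2,4) by simp
      show "snd i \<in> l2e" if "i \<in> Sigma W B" for i
        using that B(1)[of "fst i"] by (auto simp: eigenspace_def)
    next
      fix c :: "real \<times> (int ^ 'd \<Rightarrow> complex) \<Rightarrow> complex"
      assume c: "\<exists>i\<in>Sigma W B. c i \<noteq> 0"
      \<comment> \<open>The component of the combination in the eigenspace of \<open>w\<close>; in
        these components the form of \<open>T\<close> is diagonal.\<close>
      define f where "f = (\<lambda>w. comb (B w) (\<lambda>b. c (w, b)) (\<lambda>b. b))"
      define F where "F = comb (Sigma W B) c snd"
      have Feq: "F = comb W (\<lambda>_. 1) f"
        unfolding F_def f_def comb_def using W(1) B(2)
        by (auto simp: fun_eq_iff sum.Sigma split_def)
      have f: "f w \<in> l2e \<and> T (f w) = (\<lambda>x. of_real (z - w) * f w x)" for w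
      proof -
        have "f w \<in> l2e \<and> T (f w) = comb (B w) (\<lambda>b. c (w, b)) T"
          unfolding f_def
          by (rule T_comb[OF B(2)[of w], of "\<lambda>b. b" "\<lambda>b. c (w, b)"])
             (use l2e_zero B(1)[of w] eigT in auto)
        moreover have "comb (B w) (\<lambda>b. c (w, b)) T = (\<lambda>x. of_real (z - w) * f w x)"
        proof
          fix x
          have "comb (B w) (\<lambda>b. c (w, b)) T x = (\<Sum>b\<in>B w. c (w, b) * (of_real (z - w) * b x))"
            unfolding comb_def by (rule sum.cong) (use B(1)[of w] eigT in auto)
          then show "comb (B w) (\<lambda>b. c (w, b)) T x = of_real (z - w) * f w x"
            by (simp add: f_def comb_def sum_distrib_left mult_ac)
        qed
        ultimately show ?thesis by simp
      qed
      have f2: "f w \<in> ell2" for w using f S_ell2 by blast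
      have orth: "ip (f w) (f w') = 0" if "w \<noteq> w'" for w w'
      proof -
        have "ip (T (f w)) (f w') = ip (f w) (T (f w'))" using T_herm f by blast
        then have "of_real (z - w) * ip (f w) (f w') = of_real (z - w') * ip (f w) (f w')"
          by (simp add: f ip_scale_left ip_scale_right)
        then show ?thesis using that by auto
      qed
      have TF: "T F = comb W (\<lambda>_. 1) (\<lambda>w x. of_real (z - w) * f w x)"
        unfolding Feq using T_comb[OF W(1), of f "\<lambda>_. 1"] f l2e_zero by auto
      have F2: "F \<in> ell2" unfolding Feq by (rule ell2_comb[OF W(1)]) (rule f2)
      have "ip (T F) F = (\<Sum>w\<in>W. 1 * ip (\<lambda>x. of_real (z - w) * f w x) F)"
        unfolding TF by (rule ip_comb_left[OF W(1) _ F2]) (rule ell2_scale[OF f2])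
      also have "\<dots> = (\<Sum>w\<in>W. of_real (z - w) * of_real (n2 (f w)))"
      proof (rule sum.cong[OF refl])
        fix w assume w: "w \<in> W"
        have "ip (f w) F = (\<Sum>w'\<in>W. cnj 1 * ip (f w) (f w'))"
          unfolding Feq by (rule ip_comb_right[OF W(1) f2 f2])
        also have "\<dots> = (\<Sum>w'\<in>W. if w = w' then ip (f w) (f w') else 0)"
          by (rule sum.cong) (auto simp: orth)
        also have "\<dots> = of_real (n2 (f w))" using w W(1) by (simp add: ip_self f2)
        finally show "1 * ip (\<lambda>x. of_real (z - w) * f w x) F = of_real (z - w) * of_real (n2 (f w))"
          by (simp add: ip_scale_left)
      qed
      finally have eq: "Re (ip (T F) F) = (\<Sum>w\<in>W. (z - w) * n2 (f w))"
        by simp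
      obtain w b where wb: "w \<in> W" "b \<in> B w" "c (w, b) \<noteq> 0" using c by auto
      have "f w \<noteq> (\<lambda>_. 0)"
        using comb_independent[OF B(2,3), of w "\<lambda>b. c (w, b)" b] wb by (auto simp: f_def)
      then have "n2 (f w) > 0" using n2_eq_0[OF f2[of w]] by force
      moreover have wz: "w' < z" if "w' \<in> W" for w' using that W(2) by (auto simp: X_def)
      ultimately have "0 < (\<Sum>w\<in>W. (z - w) * n2 (f w))"
        using wb(1) W(1) by (intro sum_pos2[of W w]) (auto intro!: mult_nonneg_nonneg n2_nonneg simp: less_imp_le)
      then show "0 < Re (ip (T (comb (Sigma W B) c snd)) (comb (Sigma W B) c snd))"
        using eq by (simp add: F_def)
    qed
  qed
qed

section \<open>Fourier series on the torus\<close>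

lemma torus_borel[measurable]: "(torus :: (real ^ 'd) set) \<in> sets borel"
proof -
  have eq: "torus = (\<Inter>i. {k :: real ^ 'd. - pi \<le> k $ i} \<inter> {k. k $ i < pi})"
    by (auto simp: torus_def)
  moreover have "{k :: real ^ 'd. - pi \<le> k $ i} \<inter> {k. k $ i < pi} \<in> sets borel" for i
    by (intro sets.Int borel_closed borel_open closed_Collect_le open_Collect_less continuous_intros)
  ultimately show ?thesis unfolding eq by (intro sets.finite_INT) auto
qed

lemma haar_density:
  "haar = density (restrict_space lborel (torus :: (real ^ 'd) set)) (\<lambda>_. ennreal (1 / (2 * pi) ^ CARD('d)))"
  unfolding haar_def by (rule measure_eqI) (auto simp: emeasure_density_const)

lemma sets_haar: "sets haar = sets (restrict_space borel (torus :: (real ^ 'd) set))"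
  unfolding haar_def by (simp add: sets_restrict_space_cong[OF sets_lborel])

lemma space_haar: "space haar = torus"
  by (simp add: haar_def space_scale_measure space_restrict_space)

lemma haar_measurable: "f \<in> borel_measurable borel \<Longrightarrow> f \<in> borel_measurable haar"
  using measurable_restrict_space1[of f borel borel torus] measurable_cong_sets[OF sets_haar refl] by blast

lemma nn_integral_haar:
  fixes f :: "real ^ 'd \<Rightarrow> ennreal"
  assumes "f \<in> borel_measurable borel"
  shows "(\<integral>\<^sup>+p. f p \<partial>haar) = ennreal (1 / (2 * pi) ^ CARD('d)) * (\<integral>\<^sup>+p. f p * indicator torus p \<partial>lborel)"
  unfolding haar_def using assms
  by (subst nn_integral_scale_measure) (auto simp: nn_integral_restrict_space measurable_restrict_space1)

lemma
  fixes f :: "real ^ 'd \<Rightarrow> 'b::{banach, second_countable_topology}"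
  assumes [measurable]: "f \<in> borel_measurable borel"
  shows haar_integrable_iff: "integrable haar f \<longleftrightarrow> integrable lborel (\<lambda>p. indicator torus p *\<^sub>R f p)"
    and haar_integral: "(LINT p|haar. f p) = (1 / (2 * pi) ^ CARD('d)) *\<^sub>R (LINT p|lborel. indicator torus p *\<^sub>R f p)"
proof -
  have m: "f \<in> borel_measurable (restrict_space lborel torus)"
    by (rule measurable_restrict_space1) simp
  have "integrable haar f \<longleftrightarrow> integrable (restrict_space lborel torus) (\<lambda>x. (1 / (2 * pi) ^ CARD('d)) *\<^sub>R f x)"
    unfolding haar_density by (rule integrable_density[OF m]) auto
  also have "\<dots> \<longleftrightarrow> integrable (restrict_space lborel torus) f"
  proof
    define c where "c = 1 / (2 * pi) ^ CARD('d)"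
    have c: "c \<noteq> 0" by (simp add: c_def)
    assume "integrable (restrict_space lborel torus) (\<lambda>x. (1 / (2 * pi) ^ CARD('d)) *\<^sub>R f x)"
    then have "integrable (restrict_space lborel torus) (\<lambda>x. (1 / c) *\<^sub>R (c *\<^sub>R f x))"
      unfolding c_def by (rule integrable_scaleR_right)
    then show "integrable (restrict_space lborel torus) f" using c by simp
  qed (rule integrable_scaleR_right)
  also have "\<dots> \<longleftrightarrow> integrable lborel (\<lambda>p. indicator torus p *\<^sub>R f p)"
    by (rule integrable_restrict_space) simp
  finally show "integrable haar f \<longleftrightarrow> integrable lborel (\<lambda>p. indicator torus p *\<^sub>R f p)" .
  have "(LINT p|haar. f p) = integral\<^sup>L (restrict_space lborel torus) (\<lambda>x. (1 / (2 * pi) ^ CARD('d)) *\<^sub>R f x)"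
    unfolding haar_density by (rule integral_density[OF m]) auto
  also have "\<dots> = (1 / (2 * pi) ^ CARD('d)) *\<^sub>R integral\<^sup>L (restrict_space lborel torus) f" by simp
  also have "integral\<^sup>L (restrict_space lborel torus) f = (LINT p|lborel. indicator torus p *\<^sub>R f p)"
    by (rule integral_restrict_space) simp
  finally show "(LINT p|haar. f p) = (1 / (2 * pi) ^ CARD('d)) *\<^sub>R (LINT p|lborel. indicator torus p *\<^sub>R f p)" .
qed

lemma lborel_prod_vec:
  fixes f :: "'d::finite \<Rightarrow> real \<Rightarrow> complex"
  assumes f: "\<And>i. integrable lborel (f i)"
  shows "integrable lborel (\<lambda>p :: real ^ 'd. \<Prod>i\<in>UNIV. f i (p $ i))"
    and "(LINT p|lborel. (\<Prod>i\<in>UNIV. f i ((p :: real ^ 'd) $ i))) = (\<Prod>i\<in>UNIV. integral\<^sup>L lborel (f i))"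
proof -
  \<comment> \<open>\<open>lborel\<close> is the image of a product measure indexed by
    \<open>Basis\<close>; the description operator recovers the coordinate that belongs to a basis
    vector.\<close>
  define F where "F = (\<lambda>b :: real ^ 'd. f (THE i. b = axis i 1))"
  have Fa: "F (axis i 1) = f i" for i
  proof -
    have "(THE j. axis i (1::real) = axis j 1) = i"
      by (rule the_equality) (auto simp: axis_eq_axis)
    then show ?thesis by (simp add: F_def)
  qed
  have B: "(Basis :: (real ^ 'd) set) = (\<lambda>i. axis i 1) ` UNIV"
    by (auto simp: Basis_vec_def)
  have inj: "inj_on (\<lambda>i :: 'd. axis i (1::real)) UNIV"
    by (auto simp: inj_on_def axis_eq_axis)
  interpret product_sigma_finite "\<lambda>b :: real ^ 'd. lborel :: real measure" ..
  have Fi: "integrable lborel (F b)" if "b \<in> Basis" for b using that f by (auto simp: B Fa)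
  have eq: "(\<Prod>i\<in>UNIV. f i ((p :: real ^ 'd) $ i)) = (\<Prod>b\<in>Basis. F b (p \<bullet> b))" for p
    unfolding B prod.reindex[OF inj] by (simp add: Fa cart_eq_inner_axis)
  have m: "(\<lambda>p :: real ^ 'd. \<Prod>b\<in>Basis. F b (p \<bullet> b)) \<in> borel_measurable borel"
  proof (rule borel_measurable_prod)
    fix b :: "real ^ 'd" assume "b \<in> Basis"
    then have "F b \<in> borel_measurable borel"
      using borel_measurable_integrable[OF Fi] by simp
    then show "(\<lambda>p. F b (p \<bullet> b)) \<in> borel_measurable borel"
      by (rule measurable_compose[rotated]) simp
  qed
  have p: "(\<Prod>b\<in>Basis. F b ((\<Sum>c\<in>Basis. x c *\<^sub>R c) \<bullet> b)) = (\<Prod>b\<in>Basis. F b (x b))" for x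
    by (rule prod.cong) auto
  have meas: "(\<lambda>x. \<Sum>c\<in>Basis. x c *\<^sub>R c) \<in> measurable (\<Pi>\<^sub>M b\<in>(Basis :: (real ^ 'd) set). lborel) (borel :: (real ^ 'd) measure)"
    by measurable
  show "integrable lborel (\<lambda>p :: real ^ 'd. \<Prod>i\<in>UNIV. f i (p $ i))"
    unfolding eq lborel_eq[where 'a="real ^ 'd"]
    by (subst integrable_distr_eq[OF meas m]) (simp add: p product_integrable_prod Fi)
  have "(LINT p|lborel. (\<Prod>b\<in>Basis. F b ((p :: real ^ 'd) \<bullet> b))) = (\<Prod>b\<in>Basis. integral\<^sup>L lborel (F b))"
    unfolding lborel_eq[where 'a="real ^ 'd"]
    by (subst integral_distr[OF meas m]) (simp add: p product_integral_prod Fi)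
  then show "(LINT p|lborel. (\<Prod>i\<in>UNIV. f i ((p :: real ^ 'd) $ i))) = (\<Prod>i\<in>UNIV. integral\<^sup>L lborel (f i))"
    unfolding eq B prod.reindex[OF inj] by (simp add: Fa)
qed

lemma cis_int_integral:
  fixes n :: int
  shows "has_bochner_integral lborel (\<lambda>t. indicator {-pi..<pi} t *\<^sub>R cis (t * of_int n)) (if n = 0 then 2 * pi else 0)"
proof -
  have "has_bochner_integral lborel (\<lambda>t. indicator {-pi..pi} t *\<^sub>R cis (t * of_int n)) (if n = 0 then 2 * pi else 0)"
  proof (cases "n = 0")
    case True
    have "has_bochner_integral lborel (\<lambda>x. indicator {-pi..pi} x *\<^sub>R (1::complex))
        (complex_of_real pi - complex_of_real (- pi))"
      by (rule has_bochner_integral_FTC_Icc) (auto intro!: derivative_eq_intros)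
    then show ?thesis using True by simp
  next
    case False
    define F where "F = (\<lambda>t::real. cis (t * of_int n) / (\<i> * of_int n))"
    have "has_bochner_integral lborel (\<lambda>x. indicator {-pi..pi} x *\<^sub>R cis (x * of_int n)) (F pi - F (- pi))"
    proof (rule has_bochner_integral_FTC_Icc)
      show "(F has_vector_derivative cis (x * of_int n)) (at x within {- pi..pi})" for x
      proof -
        have "((\<lambda>z. exp (\<i> * of_int n * z) / (\<i> * of_int n)) has_field_derivative exp (\<i> * of_int n * of_real x)) (at (of_real x))"
          by (rule derivative_eq_intros refl | use False in simp)+
        from has_vector_derivative_real_field[OF this, of "{-pi..pi}"] show ?thesis
          unfolding F_def cis_conv_exp by (simp add: mult_ac)
      qed
    qed (auto intro!: continuous_intros)
    moreover have "F pi - F (- pi) = 0"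
    proof -
      have "cis (pi * of_int n) = cis (- pi * of_int n)"
        using sin_times_pi_eq_0[of "of_int n"] by (simp add: cis.ctr mult.commute)
      then show ?thesis by (simp add: F_def)
    qed
    ultimately show ?thesis using False by simp
  qed
  moreover have [measurable]: "(\<lambda>t::real. cis (t * of_int n)) \<in> borel_measurable borel"
    by (intro borel_measurable_continuous_onI continuous_intros)
  \<comment> \<open>The fundamental theorem of calculus was applied on the closed interval; the
    half-open one differs by a null set.\<close>
  moreover have "AE t in lborel. t \<noteq> pi" using AE_lborel_singleton[of pi] by simp
  then have "AE t in lborel. indicator {-pi..pi} t *\<^sub>R cis (t * of_int n) = indicator {-pi..<pi} t *\<^sub>R cis (t * of_int n)"
    by eventually_elim (auto simp: indicator_def)
  ultimately show ?thesis by (subst (asm) has_bochner_integral_cong_AE) auto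
qed

lemma lattice_pair_simps:
  "lattice_pair p (x + y) = lattice_pair p x + lattice_pair p y"
  "lattice_pair p (x - y) = lattice_pair p x - lattice_pair p y"
  "lattice_pair p (- x) = - lattice_pair p x"
  "lattice_pair (- p) x = - lattice_pair p x"
  "lattice_pair (p + q) x = lattice_pair p x + lattice_pair q x"
  "lattice_pair (p - q) x = lattice_pair p x - lattice_pair q x"
  "lattice_pair (r *\<^sub>R p) x = r * lattice_pair p x"
  "lattice_pair p 0 = 0"
  by (simp_all add: lattice_pair_def algebra_simps sum.distrib sum_subtractf sum_negf sum_distrib_left)

lemma continuous_lattice_pair[continuous_intros]:
  "continuous_on A f \<Longrightarrow> continuous_on A (\<lambda>q. lattice_pair (f q) x)"
  unfolding lattice_pair_def by (intro continuous_intros)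

lemma cis_lattice_measurable[measurable]: "(\<lambda>q. cis (lattice_pair q x)) \<in> borel_measurable borel"
  by (intro borel_measurable_continuous_onI continuous_intros)

lemma cis_sum: "finite A \<Longrightarrow> cis (\<Sum>a\<in>A. f a) = (\<Prod>a\<in>A. cis (f a))"
  by (induction A rule: finite_induct) (auto simp: cis_mult[symmetric])

lemma haar_character:
  fixes n :: "int ^ 'd"
  shows "integrable haar (\<lambda>p :: real ^ 'd. cis (lattice_pair p n))"
    and "(LINT p|haar. cis (lattice_pair (p :: real ^ 'd) n)) = (if n = 0 then 1 else 0)"
proof -
  define f where "f = (\<lambda>i t. indicator {-pi..<pi} t *\<^sub>R cis (t * of_int (n $ i)))"
  have f: "integrable lborel (f i)" "integral\<^sup>L lborel (f i) = (if n $ i = 0 then 2 * pi else 0)" for i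
    unfolding f_def using cis_int_integral[of "n $ i"]
    by (auto simp: has_bochner_integral_iff)
  have eq: "indicator torus p *\<^sub>R cis (lattice_pair p n) = (\<Prod>i\<in>UNIV. f i (p $ i))" for p :: "real ^ 'd"
  proof -
    have "(indicator torus p :: real) = (\<Prod>i\<in>UNIV. indicator {-pi..<pi} (p $ i))"
    proof (cases "p \<in> torus")
      case False
      then obtain i where "p $ i \<notin> {-pi..<pi}" by (auto simp: torus_def)
      then have "(\<Prod>i\<in>UNIV. indicator {-pi..<pi} (p $ i) :: real) = 0"
        by (intro prod_zero bexI[of _ i]) auto
      with False show ?thesis by simp
    qed (auto simp: torus_def indicator_def)
    then show ?thesis
      unfolding f_def lattice_pair_def cis_sum[OF finite]
      by (simp add: scaleR_conv_of_real prod.distrib)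
  qed
  show "integrable haar (\<lambda>p :: real ^ 'd. cis (lattice_pair p n))"
    unfolding haar_integrable_iff[OF cis_lattice_measurable] eq by (rule lborel_prod_vec(1)) (rule f)
  have "(LINT p|haar. cis (lattice_pair (p :: real ^ 'd) n)) =
     (1 / (2 * pi) ^ CARD('d)) *\<^sub>R (\<Prod>i\<in>UNIV. integral\<^sup>L lborel (f i))"
    unfolding haar_integral[OF cis_lattice_measurable] eq by (subst lborel_prod_vec(2)) (simp_all add: f)
  also have "\<dots> = (if n = 0 then 1 else 0)"
  proof (cases "n = 0")
    case True
    then show ?thesis by (simp add: f scaleR_conv_of_real)
  next
    case False
    then obtain i where "n $ i \<noteq> 0" by (auto simp: vec_eq_iff)
    then have "(\<Prod>i\<in>UNIV. integral\<^sup>L lborel (f i)) = 0"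
      by (intro prod_zero) (auto simp: f)
    with False show ?thesis by simp
  qed
  finally show "(LINT p|haar. cis (lattice_pair (p :: real ^ 'd) n)) = (if n = 0 then 1 else 0)" .
qed

text \<open>The total mass is the integral of the character of frequency 0. Finiteness comes first,
  from integrability, because \<open>measure\<close> alone does not tell infinite mass from
  0.\<close>

lemma haar_emeasure: "emeasure (haar :: (real ^ 'd) measure) torus = 1"
proof -
  have i: "integrable haar (\<lambda>p :: real ^ 'd. 1 :: complex)" and v: "(LINT p|(haar :: (real ^ 'd) measure). 1 :: complex) = 1"
    using haar_character[of "0 :: int ^ 'd"] by (simp_all add: lattice_pair_simps)
  then have fin: "emeasure (haar :: (real ^ 'd) measure) torus \<noteq> \<infinity>"
    by (auto simp: integrable_iff_bounded space_haar[symmetric])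
  have "measure (haar :: (real ^ 'd) measure) torus = 1"
    using v by (simp add: space_haar scaleR_conv_of_real)
  then show ?thesis using fin by (metis emeasure_eq_ennreal_measure ennreal_1 infinity_ennreal_def)
qed

lemma haar_finite: "finite_measure (haar :: (real ^ 'd) measure)"
  by standard (simp add: space_haar haar_emeasure)

lemma haar_integrable_bounded:
  fixes f :: "real ^ 'd \<Rightarrow> 'b::{banach, second_countable_topology}"
  assumes "f \<in> borel_measurable borel" "\<And>p. norm (f p) \<le> C"
  shows "integrable haar f"
  by (rule finite_measure.integrable_const_bound[OF haar_finite, where B=C])
     (use assms haar_measurable in auto)

text \<open>The half-open box is not symmetric about 0, but the open box is, and the two differ by a
  null set of faces.\<close>

lemma haar_uminus:
  fixes f :: "real ^ 'd \<Rightarrow> 'b::{banach, second_countable_topology}"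
  assumes f[measurable]: "f \<in> borel_measurable borel"
  shows "(LINT p|haar. f (- p)) = (LINT p|haar. f p)"
proof -
  define C where "C = {p :: real ^ 'd. \<forall>i. - pi < p $ i \<and> p $ i < pi}"
  have Cm: "- p \<in> C \<longleftrightarrow> p \<in> C" for p by (auto simp: C_def) (metis neg_less_iff_less minus_minus)+
  have "\<forall>b\<in>Basis. AE p :: real ^ 'd in lborel. p \<bullet> b \<noteq> - pi"
    using AE_lborel_inner_neq by blast
  then have "AE p :: real ^ 'd in lborel. \<forall>b\<in>Basis. p \<bullet> b \<noteq> - pi"
    by (simp add: AE_finite_all)
  then have ae: "AE p :: real ^ 'd in lborel. (indicator torus p :: real) = indicator C p"
  proof eventually_elim
    case (elim p)
    have "p $ i \<noteq> - pi" for i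
      using elim by (auto simp: cart_eq_inner_axis axis_in_Basis_iff)
    then show ?case by (auto simp: indicator_def torus_def C_def le_less) (metis)+
  qed
  have C_meas[measurable]: "C \<in> sets borel"
  proof -
    have eq: "C = (\<Inter>i. {k :: real ^ 'd. - pi < k $ i} \<inter> {k. k $ i < pi})" by (auto simp: C_def)
    moreover have "{k :: real ^ 'd. - pi < k $ i} \<inter> {k. k $ i < pi} \<in> sets borel" for i
      by (intro sets.Int borel_open open_Collect_less continuous_intros)
    ultimately show ?thesis unfolding eq by (intro sets.finite_INT) auto
  qed
  have lb: "lborel = distr lborel borel (uminus :: real ^ 'd \<Rightarrow> _)"
    using lborel_affine[of "-1" "0 :: real ^ 'd"] by (simp add: density_1)
  have "(LINT p|lborel. indicator torus p *\<^sub>R f (- p)) = (LINT p|lborel. indicator C (- p) *\<^sub>R f (- p))"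
  proof (rule integral_cong_AE)
    show "AE x in lborel. indicator torus x *\<^sub>R f (- x) = indicator C (- x) *\<^sub>R f (- x)"
      using ae by eventually_elim (simp add: indicator_def Cm)
  qed auto
  also have "\<dots> = (LINT p|distr lborel borel uminus. indicator C p *\<^sub>R f p)"
    by (subst integral_distr) auto
  also have "\<dots> = (LINT p|lborel. indicator C p *\<^sub>R f p)" by (subst lb[symmetric]) simp
  also have "\<dots> = (LINT p|lborel. indicator torus p *\<^sub>R f p)"
  proof (rule integral_cong_AE)
    show "AE x in lborel. indicator C x *\<^sub>R f x = indicator torus x *\<^sub>R f x"
      using ae by eventually_elim simp
  qed auto
  finally show ?thesis by (simp add: haar_integral)
qed

section \<open>Fourier series and Fourier coefficients\<close>

definition ft :: "(int ^ 'd \<Rightarrow> complex) \<Rightarrow> real ^ 'd \<Rightarrow> complex"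
  where "ft u q = (\<Sum>\<^sub>\<infinity>y. u y * cis (- lattice_pair q y))"

text \<open>The sign is opposite to that of \<open>ft\<close>, so that the two are inverse, and
  agrees with the integral in \<open>BS_kernel\<close>. The series of \<epsilon> and
  \<open>disp_hat\<close> carry the reversed signs, which evenness absorbs.\<close>

definition fc :: "(real ^ 'd \<Rightarrow> complex) \<Rightarrow> int ^ 'd \<Rightarrow> complex"
  where "fc F x = (LINT q|haar. cis (lattice_pair q x) * F q)"

lemma ft_uniform:
  fixes u :: "int ^ 'd \<Rightarrow> complex"
  assumes "(\<lambda>y. cmod (u y)) summable_on UNIV"
  shows "uniform_limit UNIV (\<lambda>S q. \<Sum>y\<in>S. u y * cis (- lattice_pair q y)) (ft u) (finite_subsets_at_top UNIV)"
  unfolding ft_def[abs_def]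
  by (rule Weierstrass_m_test_general[where M="\<lambda>y. cmod (u y)"]) (auto simp: norm_mult assms)

lemma ft_has_sum:
  assumes "(\<lambda>y. cmod (u y)) summable_on UNIV"
  shows "((\<lambda>y. u y * cis (- lattice_pair q y)) has_sum ft u q) UNIV"
  unfolding ft_def
  by (rule has_sum_infsum, rule abs_summable_summable) (simp add: norm_mult assms)

lemma ft_continuous:
  assumes "(\<lambda>y. cmod (u y)) summable_on UNIV"
  shows "continuous_on UNIV (ft u)"
  by (rule uniform_limit_theorem[OF _ ft_uniform[OF assms]])
     (auto intro!: always_eventually continuous_intros)

lemma ft_measurable:
  assumes "(\<lambda>y. cmod (u y)) summable_on UNIV"
  shows "ft u \<in> borel_measurable borel"
  by (rule borel_measurable_continuous_onI[OF ft_continuous[OF assms]])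

lemma ft_bound:
  assumes "(\<lambda>y. cmod (u y)) summable_on UNIV"
  shows "cmod (ft u q) \<le> (\<Sum>\<^sub>\<infinity>y. cmod (u y))"
  unfolding ft_def
  by (rule order.trans[OF norm_infsum_bound]) (auto simp: norm_mult assms)

lemma ft_lin:
  assumes "(\<lambda>y. cmod (u y)) summable_on UNIV" "(\<lambda>y. cmod (v y)) summable_on UNIV"
  shows "ft (\<lambda>y. a * u y + b * v y) q = a * ft u q + b * ft v q"
proof -
  have "((\<lambda>y. a * (u y * cis (- lattice_pair q y)) + b * (v y * cis (- lattice_pair q y))) has_sum
      a * ft u q + b * ft v q) UNIV"
    by (intro has_sum_add has_sum_cmult_right ft_has_sum assms)
  then show ?thesis unfolding ft_def by (simp add: infsumI algebra_simps)
qed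

lemma cis_mult_integrable:
  assumes "integrable haar F"
  shows "integrable haar (\<lambda>q. cis (lattice_pair q x) * F q)"
  by (rule Bochner_Integration.integrable_bound[OF assms])
     (use assms haar_measurable[OF cis_lattice_measurable[of x]] in \<open>auto simp: norm_mult\<close>)

lemma bounded_mult_integrable:
  fixes F G :: "real ^ 'd \<Rightarrow> complex"
  assumes "integrable haar F" "G \<in> borel_measurable borel" "\<And>q. cmod (G q) \<le> C"
  shows "integrable haar (\<lambda>q. G q * F q)"
proof (rule Bochner_Integration.integrable_bound)
  show "integrable haar (\<lambda>q. complex_of_real C * F q)" using assms(1) by simp
  show "(\<lambda>q. G q * F q) \<in> borel_measurable haar"
    using assms haar_measurable by (intro borel_measurable_times) auto
  have "0 \<le> C" using assms(3)[of undefined] norm_ge_zero order.trans by blast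
  then show "AE q in haar. norm (G q * F q) \<le> norm (complex_of_real C * F q)"
    using assms(3) by (auto simp: norm_mult intro!: mult_right_mono)
qed

text \<open>The partial sums of \<open>ft u\<close> converge uniformly, which is enough against a
  merely integrable \<open>F\<close>; its coefficients need not be square-summable.\<close>

lemma sum_integral_exchange:
  fixes u :: "int ^ 'd \<Rightarrow> complex"
  assumes u: "(\<lambda>y. cmod (u y)) summable_on UNIV" and F: "integrable haar F"
  shows "((\<lambda>y. u y * fc F (- y)) has_sum (LINT q|haar. ft u q * F q)) UNIV"
  unfolding has_sum_def
proof (rule tendstoI)
  fix e :: real assume e: "e > 0"
  define M where "M = (LINT q|haar. cmod (F q))"
  have M: "M \<ge> 0" by (simp add: M_def)
  define r where "r = e / (M + 1)"
  have r: "r > 0" using e M by (simp add: r_def)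
  have i1: "integrable haar (\<lambda>q. ft u q * F q)"
    by (rule bounded_mult_integrable[OF F ft_measurable[OF u] ft_bound[OF u]])
  have i2: "integrable haar (\<lambda>q. cis (- lattice_pair q y) * F q)" for y
    using cis_mult_integrable[OF F, of "- y"] by (simp add: lattice_pair_simps)
  from uniform_limitD[OF ft_uniform[OF u] r]
  show "\<forall>\<^sub>F S in finite_subsets_at_top UNIV. dist (\<Sum>y\<in>S. u y * fc F (- y)) (LINT q|haar. ft u q * F q) < e"
  proof eventually_elim
    case (elim S)
    have "(\<Sum>y\<in>S. u y * fc F (- y)) = (LINT q|haar. (\<Sum>y\<in>S. u y * (cis (- lattice_pair q y) * F q)))"
      unfolding fc_def by (subst Bochner_Integration.integral_sum) (auto simp: i2 lattice_pair_simps)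
    then have "(\<Sum>y\<in>S. u y * fc F (- y)) - (LINT q|haar. ft u q * F q)
        = (LINT q|haar. ((\<Sum>y\<in>S. u y * (cis (- lattice_pair q y) * F q)) - ft u q * F q))"
      by (subst Bochner_Integration.integral_diff) (auto intro!: Bochner_Integration.integrable_sum i1 i2)
    also have "cmod \<dots> \<le> (LINT q|haar. r * cmod (F q))"
    proof (rule order.trans[OF Bochner_Integration.integral_norm_bound])
      have eq: "(\<Sum>y\<in>S. u y * (cis (- lattice_pair q y) * F q)) - ft u q * F q =
        ((\<Sum>y\<in>S. u y * cis (- lattice_pair q y)) - ft u q) * F q" for q
        by (simp add: algebra_simps sum_distrib_left)
      show "(LINT q|haar. cmod ((\<Sum>y\<in>S. u y * (cis (- lattice_pair q y) * F q)) - ft u q * F q))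
         \<le> (LINT q|haar. r * cmod (F q))"
      proof (rule Bochner_Integration.integral_mono)
        show "integrable haar (\<lambda>q. cmod ((\<Sum>y\<in>S. u y * (cis (- lattice_pair q y) * F q)) - ft u q * F q))"
          by (intro integrable_norm Bochner_Integration.integrable_diff Bochner_Integration.integrable_sum i1)
             (simp add: i2)
        show "integrable haar (\<lambda>q. r * cmod (F q))" using F by simp
        show "cmod ((\<Sum>y\<in>S. u y * (cis (- lattice_pair q y) * F q)) - ft u q * F q) \<le> r * cmod (F q)" for q
          unfolding eq norm_mult using elim by (intro mult_right_mono) (auto simp: dist_norm less_imp_le)
      qed
    qed
    also have "\<dots> = r * M" by (simp add: M_def)
    also have "\<dots> < e" using e M by (simp add: r_def field_simps)
    finally show ?case by (simp add: dist_norm)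
  qed
qed

text \<open>\<open>sum_integral_exchange\<close> with a character for \<open>F\<close>, whose
  coefficients form a unit vector by orthogonality.\<close>

lemma fc_ft:
  assumes u: "(\<lambda>y. cmod (u y)) summable_on UNIV"
  shows "fc (ft u) x = u x"
proof -
  define F where "F = (\<lambda>q. cis (lattice_pair q x))"
  have F: "integrable haar F" unfolding F_def by (rule haar_character)
  have c: "fc F (- y) = (if y = x then 1 else 0)" for y
    using haar_character(2)[of "x - y"] by (auto simp: fc_def F_def cis_mult lattice_pair_simps)
  have "((\<lambda>y. u y * fc F (- y)) has_sum (LINT q|haar. ft u q * F q)) UNIV"
    by (rule sum_integral_exchange[OF u F])
  moreover have "((\<lambda>y. u y * fc F (- y)) has_sum (u x)) UNIV"
    by (rule has_sum_finite_neutralI[of "{x}"]) (auto simp: c)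
  ultimately have "(LINT q|haar. ft u q * F q) = u x" using has_sum_unique by blast
  then show ?thesis by (simp add: fc_def F_def mult.commute)
qed

text \<open>Multiplication by \<open>ft u\<close> on the torus corresponds to convolution with
  \<open>u\<close>: the exchange is applied to \<open>F\<close> modulated by the character of
  \<open>x\<close>, and the sum is then reflected at \<open>x\<close>.\<close>

lemma convolution_fc:
  fixes u :: "int ^ 'd \<Rightarrow> complex"
  assumes u: "(\<lambda>y. cmod (u y)) summable_on UNIV" and F: "integrable haar F"
  shows "((\<lambda>s. u (x - s) * fc F s) has_sum fc (\<lambda>q. ft u q * F q) x) UNIV"
proof -
  define G where "G = (\<lambda>q. cis (lattice_pair q x) * F q)"
  have G: "integrable haar G" unfolding G_def by (rule cis_mult_integrable[OF F])
  have "fc G (- y) = fc F (x - y)" for y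
    by (simp add: fc_def G_def lattice_pair_simps cis_mult flip: mult.assoc)
  then have "((\<lambda>y. u y * fc F (x - y)) has_sum (LINT q|haar. ft u q * G q)) UNIV"
    using sum_integral_exchange[OF u G] by simp
  also have "(LINT q|haar. ft u q * G q) = fc (\<lambda>q. ft u q * F q) x"
    by (simp add: fc_def G_def mult_ac)
  finally have "((\<lambda>y. u y * fc F (x - y)) has_sum fc (\<lambda>q. ft u q * F q) x) UNIV" .
  moreover have "bij_betw (\<lambda>s. x - s) UNIV UNIV"
    by (rule bij_betw_byWitness[of _ "\<lambda>s. x - s"]) auto
  ultimately show ?thesis
    using has_sum_reindex_bij_betw[of "\<lambda>s. x - s" UNIV UNIV "\<lambda>y. u y * fc F (x - y)"] by simp
qed

text \<open>Bessel's inequality without Hilbert space theory on the torus. The partial sum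
  \<open>X\<close> of squares equals both the integral of \<open>G * F\<close> and that of the
  square of \<open>cmod G\<close>, so the arithmetic-geometric inequality gives
  \<open>X \<le> (1/2) * (M^2 + X)\<close>.\<close>

lemma bessel:
  fixes F :: "real ^ 'd \<Rightarrow> complex"
  assumes F: "F \<in> borel_measurable borel" and M: "\<And>q. cmod (F q) \<le> M"
  shows "fc F \<in> ell2"
proof -
  have "(\<Sum>x\<in>S. (cmod (fc F x))\<^sup>2) \<le> M\<^sup>2" if S: "finite S" for S
  proof -
    define X where "X = (\<Sum>x\<in>S. (cmod (fc F x))\<^sup>2)"
    \<comment> \<open>The conjugate of the partial Fourier sum of \<open>F\<close>.\<close>
    define G where "G = (\<lambda>q. \<Sum>x\<in>S. cnj (fc F x) * cis (lattice_pair q x))"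
    have Fi: "integrable haar F" by (rule haar_integrable_bounded[OF F M])
    have Gm: "G \<in> borel_measurable borel"
      unfolding G_def by (intro borel_measurable_continuous_onI continuous_intros)
    have Gb: "cmod (G q) \<le> (\<Sum>x\<in>S. cmod (fc F x))" for q
      unfolding G_def by (rule order.trans[OF norm_sum]) (simp add: norm_mult)
    have "complex_of_real X = (\<Sum>x\<in>S. cnj (fc F x) * fc F x)"
      by (simp add: X_def complex_norm_square mult.commute flip: of_real_power)
    also have "\<dots> = (LINT q|haar. G q * F q)"
      unfolding fc_def[of F] G_def sum_distrib_right
      by (subst Bochner_Integration.integral_sum)
         (auto simp: mult.assoc fc_def[symmetric] intro!: cis_mult_integrable[OF Fi])
    finally have e: "complex_of_real X = (LINT q|haar. G q * F q)" .
    have "X \<ge> 0" by (simp add: X_def sum_nonneg)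
    then have X1: "X = cmod (LINT q|haar. G q * F q)" unfolding e[symmetric] by simp
    have "complex_of_real X = (\<Sum>x\<in>S. \<Sum>y\<in>S. cnj (fc F x) * fc F y * (if x = y then 1 else 0))"
    proof -
      have "(\<Sum>y\<in>S. cnj (fc F x) * fc F y * (if x = y then 1 else 0)) = of_real ((cmod (fc F x))\<^sup>2)" if "x \<in> S" for x
      proof -
        have "(\<Sum>y\<in>S. cnj (fc F x) * fc F y * (if x = y then 1 else 0)) = (\<Sum>y\<in>S. if x = y then cnj (fc F x) * fc F y else 0)"
          by (rule sum.cong) auto
        also have "\<dots> = cnj (fc F x) * fc F x" using S that by simp
        finally show ?thesis by (simp only: complex_norm_square mult.commute)
      qed
      then show ?thesis by (simp add: X_def)
    qed
    also have "\<dots> = (\<Sum>x\<in>S. \<Sum>y\<in>S. cnj (fc F x) * fc F y * (LINT q|haar. cis (lattice_pair q (x - y))))"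
      by (intro sum.cong refl arg_cong2[where f=times]) (auto simp: haar_character)
    also have "\<dots> = (LINT q|haar. (\<Sum>x\<in>S. \<Sum>y\<in>S. cnj (fc F x) * fc F y * cis (lattice_pair q (x - y))))"
      by (subst Bochner_Integration.integral_sum, simp add: haar_character)
         (subst Bochner_Integration.integral_sum, auto simp: haar_character)
    also have "\<dots> = (LINT q|haar. complex_of_real ((cmod (G q))\<^sup>2))"
    proof (intro arg_cong[where f="integral\<^sup>L haar"] ext)
      fix q
      have "complex_of_real ((cmod (G q))\<^sup>2) = G q * cnj (G q)" by (simp only: complex_norm_square)
      also have "\<dots> = (\<Sum>x\<in>S. \<Sum>y\<in>S. cnj (fc F x) * fc F y * cis (lattice_pair q (x - y)))"
      proof -
        have t: "(cnj (fc F x) * cis (lattice_pair q x)) * cnj (cnj (fc F y) * cis (lattice_pair q y)) =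
            cnj (fc F x) * fc F y * cis (lattice_pair q (x - y))" for x y
        proof -
          have "cis (lattice_pair q (x - y)) = cis (lattice_pair q x) * cis (- lattice_pair q y)"
            by (simp add: cis_mult lattice_pair_simps)
          then show ?thesis by (simp add: cis_cnj)
        qed
        show ?thesis unfolding G_def cnj_sum sum_product t ..
      qed
      finally show "(\<Sum>x\<in>S. \<Sum>y\<in>S. cnj (fc F x) * fc F y * cis (lattice_pair q (x - y))) = complex_of_real ((cmod (G q))\<^sup>2)" ..
    qed
    also have "\<dots> = of_real (LINT q|haar. (cmod (G q))\<^sup>2)" by (rule integral_complex_of_real)
    finally have X2: "X = (LINT q|haar. (cmod (G q))\<^sup>2)" using of_real_eq_iff by blast
    have gi: "integrable haar (\<lambda>q. (cmod (G q))\<^sup>2)"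
    proof (rule haar_integrable_bounded)
      show "(\<lambda>q. (cmod (G q))\<^sup>2) \<in> borel_measurable borel" using Gm by simp
      show "norm ((cmod (G q))\<^sup>2) \<le> (\<Sum>x\<in>S. cmod (fc F x))\<^sup>2" for q
        using Gb[of q] by (simp add: power_mono)
    qed
    interpret finite_measure "haar :: (real ^ 'd) measure" by (rule haar_finite)
    have "X \<le> (LINT q|haar. cmod (G q * F q))" unfolding X1 by (rule Bochner_Integration.integral_norm_bound)
    also have "\<dots> \<le> (LINT q|haar. (1/2) * (M\<^sup>2 + (cmod (G q))\<^sup>2))"
    proof (rule Bochner_Integration.integral_mono)
      show "integrable haar (\<lambda>q. cmod (G q * F q))"
        by (intro integrable_norm bounded_mult_integrable[OF Fi Gm Gb])
      show "integrable haar (\<lambda>q. (1/2) * (M\<^sup>2 + (cmod (G q))\<^sup>2))" using gi by simp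
      show "cmod (G q * F q) \<le> (1/2) * (M\<^sup>2 + (cmod (G q))\<^sup>2)" for q
      proof -
        have "cmod (G q * F q) \<le> cmod (G q) * M" unfolding norm_mult by (intro mult_left_mono M) simp
        then show ?thesis using sum_squares_bound[of "cmod (G q)" M] by simp
      qed
    qed
    also have "\<dots> = (1/2) * (M\<^sup>2 + X)"
      using gi haar_emeasure[where 'd='d] by (simp add: X2 space_haar measure_def)
    finally show ?thesis by (simp add: X_def)
  qed
  then show ?thesis using ell2_bound(1) by blast
qed

text \<open>\<open>F\<close> is only integrable, as a bounded function divided by \<open>a\<close>
  is at the threshold; summability of \<open>u\<close> compensates for this. The conjugate of
  \<open>ft u\<close> is itself the transform of \<open>v\<close>, which reduces the claim to
  \<open>sum_integral_exchange\<close>.\<close>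

lemma parseval_exchange:
  fixes u :: "int ^ 'd \<Rightarrow> complex"
  assumes u: "(\<lambda>y. cmod (u y)) summable_on UNIV" and F: "integrable haar F"
  shows "ip (fc F) u = (LINT q|haar. F q * cnj (ft u q))"
proof -
  define v where "v = (\<lambda>y. cnj (u (- y)))"
  have bij: "bij_betw uminus (UNIV :: (int ^ 'd) set) UNIV"
    by (rule bij_betw_byWitness[of _ uminus]) auto
  have v: "(\<lambda>y. cmod (v y)) summable_on UNIV"
    using u summable_on_reindex_bij_betw[OF bij, of "\<lambda>y. cmod (u y)"] by (simp add: v_def)
  have "ft v q = cnj (ft u q)" for q
  proof -
    have "((\<lambda>y. cnj (u y * cis (- lattice_pair q y))) has_sum cnj (ft u q)) UNIV"
      using ft_has_sum[OF u] by (simp only: has_sum_cnj_iff)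
    then have "((\<lambda>y. cnj (u (- y) * cis (- lattice_pair q (- y)))) has_sum cnj (ft u q)) UNIV"
      using has_sum_reindex_bij_betw[OF bij, of "\<lambda>y. cnj (u y * cis (- lattice_pair q y))"] by simp
    then show ?thesis unfolding v_def ft_def[of "\<lambda>y. cnj (u (- y))"]
      by (intro infsumI) (simp add: lattice_pair_simps cis_cnj)
  qed
  then have "((\<lambda>y. v y * fc F (- y)) has_sum (LINT q|haar. cnj (ft u q) * F q)) UNIV"
    using sum_integral_exchange[OF v F] by simp
  then have "((\<lambda>y. fc F y * cnj (u y)) has_sum (LINT q|haar. cnj (ft u q) * F q)) UNIV"
    using has_sum_reindex_bij_betw[OF bij, of "\<lambda>y. fc F y * cnj (u y)"] by (simp add: v_def mult.commute)
  then show ?thesis unfolding ip_def by (simp add: infsumI mult.commute)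
qed

section \<open>Convolution operators on the lattice\<close>

definition convol :: "(int ^ 'd \<Rightarrow> real) \<Rightarrow> (int ^ 'd \<Rightarrow> complex) \<Rightarrow> int ^ 'd \<Rightarrow> complex"
  where "convol K f x = (\<Sum>\<^sub>\<infinity>s. of_real (K (x - s)) * f s)"

lemma bij_diff: "bij_betw (\<lambda>s :: int ^ 'd. x - s) UNIV UNIV"
  by (rule bij_betw_byWitness[of _ "\<lambda>s. x - s"]) auto

lemma bij_diff2: "bij_betw (\<lambda>s :: int ^ 'd. s - x) UNIV UNIV"
  by (rule bij_betw_byWitness[of _ "\<lambda>s. s + x"]) auto

lemma has_sum_finite_sum:
  fixes f :: "'i \<Rightarrow> 'a \<Rightarrow> real"
  assumes "finite S" "\<And>i. i \<in> S \<Longrightarrow> (f i has_sum a i) A"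
  shows "((\<lambda>x. \<Sum>i\<in>S. f i x) has_sum (\<Sum>i\<in>S. a i)) A"
  using assms by (induction S rule: finite_induct) (auto intro!: has_sum_add)

text \<open>Young's inequality by Schur's test: the kernel is split into two factors sqrt
  \<bar>K\<bar>, one of them kept with \<open>f\<close>, and Cauchy-Schwarz is applied. The estimate
  concerns the absolute kernel because \<open>convol_herm\<close> needs it to interchange
  sums.\<close>

lemma
  fixes K :: "int ^ 'd \<Rightarrow> real"
  assumes K: "(\<lambda>x. \<bar>K x\<bar>) summable_on UNIV" and f: "f \<in> ell2"
  defines "\<kappa> \<equiv> (\<Sum>\<^sub>\<infinity>x. \<bar>K x\<bar>)"
  shows convol_terms: "(\<lambda>s. \<bar>K (x - s)\<bar> * cmod (f s)) summable_on UNIV"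
    and convol_abs_ell2: "(\<lambda>x. complex_of_real (\<Sum>\<^sub>\<infinity>s. \<bar>K (x - s)\<bar> * cmod (f s))) \<in> ell2"
    and convol_abs_bound: "n2 (\<lambda>x. complex_of_real (\<Sum>\<^sub>\<infinity>s. \<bar>K (x - s)\<bar> * cmod (f s))) \<le> \<kappa>\<^sup>2 * n2 f"
proof -
  have k0: "\<kappa> \<ge> 0" unfolding \<kappa>_def by (rule infsum_nonneg) simp
  have K1: "(\<lambda>s. \<bar>K (x - s)\<bar>) summable_on UNIV" "(\<Sum>\<^sub>\<infinity>s. \<bar>K (x - s)\<bar>) = \<kappa>" for x
    using K summable_on_reindex_bij_betw[OF bij_diff[of x], of "\<lambda>y. \<bar>K y\<bar>"]
      infsum_reindex_bij_betw[OF bij_diff[of x], of "\<lambda>y. \<bar>K y\<bar>"] by (simp_all add: \<kappa>_def)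
  have K2: "(\<lambda>x. \<bar>K (x - s)\<bar>) summable_on UNIV" "(\<Sum>\<^sub>\<infinity>x. \<bar>K (x - s)\<bar>) = \<kappa>" for s
    using K summable_on_reindex_bij_betw[OF bij_diff2[of s], of "\<lambda>y. \<bar>K y\<bar>"]
      infsum_reindex_bij_betw[OF bij_diff2[of s], of "\<lambda>y. \<bar>K y\<bar>"] by (simp_all add: \<kappa>_def)
  define u where "u = (\<lambda>x s. complex_of_real (sqrt \<bar>K (x - s)\<bar>))"
  define v where "v = (\<lambda>x s. complex_of_real (sqrt \<bar>K (x - s)\<bar>) * f s)"
  have u: "u x \<in> ell2" "n2 (u x) = \<kappa>" for x
    using K1[of x] by (simp_all add: u_def ell2_def n2_def)
  have s2: "(\<lambda>s. \<bar>K (x - s)\<bar> * (cmod (f s))\<^sup>2) summable_on UNIV" for x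
  proof (rule summable_on_comparison_test)
    show "(\<lambda>s. \<bar>K (x - s)\<bar> * n2 f) summable_on UNIV"
      by (intro summable_on_cmult_left K1)
    show "\<bar>K (x - s)\<bar> * (cmod (f s))\<^sup>2 \<le> \<bar>K (x - s)\<bar> * n2 f" for s
      by (intro mult_left_mono ell2_point f) simp
  qed simp
  have v: "v x \<in> ell2" "n2 (v x) = (\<Sum>\<^sub>\<infinity>s. \<bar>K (x - s)\<bar> * (cmod (f s))\<^sup>2)" for x
    using s2[of x] by (simp_all add: v_def ell2_def n2_def norm_mult power_mult_distrib)
  have uv: "cmod (u x s) * cmod (v x s) = \<bar>K (x - s)\<bar> * cmod (f s)" for x s
    by (simp add: u_def v_def norm_mult flip: mult.assoc)
  show "(\<lambda>s. \<bar>K (x - s)\<bar> * cmod (f s)) summable_on UNIV" for x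
    using ell2_prod[OF u(1)[of x] v(1)[of x]] by (simp add: uv)
  define h where "h = (\<lambda>x. complex_of_real (\<Sum>\<^sub>\<infinity>s. \<bar>K (x - s)\<bar> * cmod (f s)))"
  have hb: "(cmod (h x))\<^sup>2 \<le> \<kappa> * n2 (v x)" for x
  proof -
    have "(\<Sum>\<^sub>\<infinity>s. \<bar>K (x - s)\<bar> * cmod (f s)) \<le> sqrt (\<kappa> * n2 (v x))"
      using ell2_CS[OF u(1)[of x] v(1)[of x]] by (simp add: uv u(2))
    moreover have "0 \<le> (\<Sum>\<^sub>\<infinity>s. \<bar>K (x - s)\<bar> * cmod (f s))" by (rule infsum_nonneg) simp
    ultimately have "(\<Sum>\<^sub>\<infinity>s. \<bar>K (x - s)\<bar> * cmod (f s))\<^sup>2 \<le> (sqrt (\<kappa> * n2 (v x)))\<^sup>2"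
      by (rule power_mono)
    then show ?thesis using k0 n2_nonneg[of "v x"] by (simp add: h_def)
  qed
  have "(\<Sum>x\<in>S. (cmod (h x))\<^sup>2) \<le> \<kappa>\<^sup>2 * n2 f" if S: "finite S" for S
  proof -
    have "(\<Sum>x\<in>S. (cmod (h x))\<^sup>2) \<le> \<kappa> * (\<Sum>x\<in>S. n2 (v x))"
      unfolding sum_distrib_left by (intro sum_mono hb)
    also have "(\<Sum>x\<in>S. n2 (v x)) = (\<Sum>\<^sub>\<infinity>s. \<Sum>x\<in>S. \<bar>K (x - s)\<bar> * (cmod (f s))\<^sup>2)"
      unfolding v(2) by (rule infsumI[symmetric], rule has_sum_finite_sum[OF S]) (rule has_sum_infsum[OF s2])
    also have "\<dots> \<le> (\<Sum>\<^sub>\<infinity>s. \<kappa> * (cmod (f s))\<^sup>2)"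
    proof (rule infsum_mono)
      show "(\<lambda>s. \<Sum>x\<in>S. \<bar>K (x - s)\<bar> * (cmod (f s))\<^sup>2) summable_on UNIV"
        by (rule has_sum_imp_summable, rule has_sum_finite_sum[OF S]) (rule has_sum_infsum[OF s2])
      show "(\<lambda>s. \<kappa> * (cmod (f s))\<^sup>2) summable_on UNIV"
        by (intro summable_on_cmult_right ell2_sum f)
      fix s
      have "(\<Sum>x\<in>S. \<bar>K (x - s)\<bar>) \<le> \<kappa>"
        using finite_sum_le_infsum[OF K2(1)[of s] S] K2(2)[of s] by simp
      then show "(\<Sum>x\<in>S. \<bar>K (x - s)\<bar> * (cmod (f s))\<^sup>2) \<le> \<kappa> * (cmod (f s))\<^sup>2"
        by (simp add: sum_distrib_right[symmetric] mult_right_mono)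
    qed
    also have "\<dots> = \<kappa> * n2 f" by (simp add: n2_def infsum_cmult_right')
    finally show ?thesis using k0 by (simp add: power2_eq_square mult_left_mono mult.assoc)
  qed
  from ell2_bound[OF this] show "h \<in> ell2" "n2 h \<le> \<kappa>\<^sup>2 * n2 f" by auto
qed

lemma
  fixes K :: "int ^ 'd \<Rightarrow> real"
  assumes K: "(\<lambda>x. \<bar>K x\<bar>) summable_on UNIV" and f: "f \<in> ell2"
  shows convol_has_sum: "((\<lambda>s. of_real (K (x - s)) * f s) has_sum convol K f x) UNIV"
    and convol_ell2: "convol K f \<in> ell2"
    and convol_bound: "n2 (convol K f) \<le> (\<Sum>\<^sub>\<infinity>x. \<bar>K x\<bar>)\<^sup>2 * n2 f"
proof -
  have s: "(\<lambda>s. cmod (of_real (K (x - s)) * f s)) summable_on UNIV" for x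
    using convol_terms[OF K f, of x] by (simp add: norm_mult)
  show "((\<lambda>s. of_real (K (x - s)) * f s) has_sum convol K f x) UNIV"
    unfolding convol_def by (rule has_sum_infsum) (rule abs_summable_summable[OF s])
  have b: "cmod (convol K f x) \<le> 1 * cmod (complex_of_real (\<Sum>\<^sub>\<infinity>s. \<bar>K (x - s)\<bar> * cmod (f s)))" for x
  proof -
    have "cmod (convol K f x) \<le> (\<Sum>\<^sub>\<infinity>s. cmod (of_real (K (x - s)) * f s))"
      unfolding convol_def by (rule norm_infsum_bound[OF s])
    also have "\<dots> = (\<Sum>\<^sub>\<infinity>s. \<bar>K (x - s)\<bar> * cmod (f s))" by (simp add: norm_mult)
    finally show ?thesis by (simp add: order.trans[OF _ abs_ge_self])
  qed
  note l = ell2_le[OF convol_abs_ell2[OF K f] b]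
  show "convol K f \<in> ell2" by (rule l(1))
  show "n2 (convol K f) \<le> (\<Sum>\<^sub>\<infinity>x. \<bar>K x\<bar>)\<^sup>2 * n2 f"
    using l(2) convol_abs_bound[OF K f] by simp
qed

lemma convol_lin:
  assumes K: "(\<lambda>x. \<bar>K x\<bar>) summable_on UNIV" and f: "f \<in> ell2" "g \<in> ell2"
  shows "convol K (\<lambda>x. a * f x + b * g x) = (\<lambda>x. a * convol K f x + b * convol K g x)"
proof
  fix x
  have "((\<lambda>s. a * (of_real (K (x - s)) * f s) + b * (of_real (K (x - s)) * g s)) has_sum
      a * convol K f x + b * convol K g x) UNIV"
    by (intro has_sum_add has_sum_cmult_right convol_has_sum K f)
  then show "convol K (\<lambda>x. a * f x + b * g x) x = a * convol K f x + b * convol K g x"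
    unfolding convol_def[of K "\<lambda>x. a * f x + b * g x"] by (intro infsumI) (simp add: algebra_simps)
qed

lemma convol_herm:
  assumes K: "(\<lambda>x. \<bar>K x\<bar>) summable_on UNIV" and ev: "\<And>x. K (- x) = K x"
    and f: "f \<in> ell2" and g: "g \<in> ell2"
  shows "ip (convol K f) g = ip f (convol K g)"
proof -
  define F where "F = (\<lambda>x s. of_real (K (x - s)) * f s * cnj (g x))"
  have nF: "cmod (F x s) = \<bar>K (x - s)\<bar> * cmod (f s) * cmod (g x)" for x s
    by (simp add: F_def norm_mult)
  have i: "(\<Sum>\<^sub>\<infinity>s. cmod (F x s)) = (\<Sum>\<^sub>\<infinity>s. \<bar>K (x - s)\<bar> * cmod (f s)) * cmod (g x)" for x
    unfolding nF by (rule infsum_cmult_left')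
  have nn: "0 \<le> (\<Sum>\<^sub>\<infinity>s. \<bar>K (x - s)\<bar> * cmod (f s))" for x by (rule infsum_nonneg) simp
  have "(\<lambda>p. norm (case p of (x, s) \<Rightarrow> F x s)) summable_on Sigma UNIV (\<lambda>_. UNIV)"
    unfolding Infinite_Sum.abs_summable_on_Sigma_iff
  proof (intro conjI ballI)
    show "(\<lambda>s. norm (case (x, s) of (x, s) \<Rightarrow> F x s)) summable_on UNIV" for x
      using convol_terms[OF K f, of x] by (simp add: nF summable_on_cmult_left)
    show "(\<lambda>x. norm (\<Sum>\<^sub>\<infinity>s. norm (case (x, s) of (x, s) \<Rightarrow> F x s))) summable_on UNIV"
      using ell2_prod[OF convol_abs_ell2[OF K f] g] nn by (simp add: i abs_mult)
  qed
  then have "(\<lambda>(x, s). F x s) summable_on UNIV \<times> UNIV" by (rule abs_summable_summable)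
  then have "(\<Sum>\<^sub>\<infinity>x. \<Sum>\<^sub>\<infinity>s. F x s) = (\<Sum>\<^sub>\<infinity>s. \<Sum>\<^sub>\<infinity>x. F x s)" by (rule infsum_swap_banach)
  moreover have "(\<Sum>\<^sub>\<infinity>s. F x s) = convol K f x * cnj (g x)" for x
    unfolding F_def convol_def by (rule infsum_cmult_left')
  moreover have "(\<Sum>\<^sub>\<infinity>x. F x s) = f s * cnj (convol K g s)" for s
  proof -
    have "F x s = f s * cnj (of_real (K (s - x)) * g x)" for x
      using ev[of "x - s"] by (simp add: F_def)
    then show ?thesis by (simp only: infsum_cmult_right' infsum_cnj convol_def)
  qed
  ultimately show ?thesis by (simp add: ip_def)
qed

lemma convol_fc:
  assumes K: "(\<lambda>x. \<bar>K x\<bar>) summable_on UNIV" and F: "integrable haar F"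
  shows "convol K (fc F) x = fc (\<lambda>q. ft (\<lambda>x. of_real (K x)) q * F q) x"
  unfolding convol_def by (rule infsumI, rule convolution_fc) (use K F in auto)

lemma fc_even:
  fixes F :: "real ^ 'd \<Rightarrow> complex"
  assumes "F \<in> borel_measurable borel" "\<And>q. F (- q) = F q"
  shows "fc F (- x) = fc F x"
proof -
  have m: "(\<lambda>q. cis (lattice_pair q (- x)) * F q) \<in> borel_measurable borel"
    using assms(1) by simp
  show ?thesis
    unfolding fc_def using haar_uminus[OF m] by (simp add: lattice_pair_simps assms(2))
qed

lemma ft_even:
  fixes u :: "int ^ 'd \<Rightarrow> complex"
  assumes "\<And>x. u (- x) = u x"
  shows "ft u (- q) = ft u q"
proof -
  have bij: "bij_betw uminus (UNIV :: (int ^ 'd) set) UNIV"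
    by (rule bij_betw_byWitness[of _ uminus]) auto
  show ?thesis
    unfolding ft_def
    using infsum_reindex_bij_betw[OF bij, of "\<lambda>y. u y * cis (- lattice_pair (- q) y)"]
    by (simp add: lattice_pair_simps assms)
qed

lemma convol_even:
  fixes K :: "int ^ 'd \<Rightarrow> real"
  assumes "\<And>x. K (- x) = K x" "\<And>x. f (- x) = f x"
  shows "convol K f (- x) = convol K f x"
proof -
  have bij: "bij_betw uminus (UNIV :: (int ^ 'd) set) UNIV"
    by (rule bij_betw_byWitness[of _ uminus]) auto
  have "K (- x - - s) = K (x - s)" for s using assms(1)[of "x - s"] by simp
  then show ?thesis
    unfolding convol_def
    using infsum_reindex_bij_betw[OF bij, of "\<lambda>s. of_real (K (- x - s)) * f s"]
    by (simp only: assms(2))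
qed

lemma l2e_ell2: "f \<in> l2e \<Longrightarrow> f \<in> ell2"
  by (simp add: l2e_def ell2_def)

lemma l2eI: "f \<in> ell2 \<Longrightarrow> (\<And>x. f (- x) = f x) \<Longrightarrow> f \<in> l2e"
  by (simp add: l2e_def ell2_def)

lemma l2e_even: "f \<in> l2e \<Longrightarrow> f (- x) = f x"
  by (simp add: l2e_def)

lemma l2e_lin: "f \<in> l2e \<Longrightarrow> g \<in> l2e \<Longrightarrow> (\<lambda>x. a * f x + b * g x) \<in> l2e"
  by (intro l2eI ell2_lin) (auto simp: l2e_ell2 l2e_even)

lemma l2e_lim:
  assumes "\<And>n. F n \<in> l2e" "\<And>x. (\<lambda>n. F n x) \<longlonglongrightarrow> f x" "f \<in> ell2"
  shows "f \<in> l2e"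
proof (rule l2eI[OF assms(3)])
  fix x
  have "(\<lambda>n. F n (- x)) \<longlonglongrightarrow> f (- x)" by (rule assms(2))
  then have "(\<lambda>n. F n x) \<longlonglongrightarrow> f (- x)" using l2e_even[OF assms(1)] by simp
  then show "f (- x) = f x" using assms(2) LIMSEQ_unique by blast
qed

section \<open>The Birman-Schwinger form\<close>

definition wmul :: "(int ^ 'd \<Rightarrow> real) \<Rightarrow> (int ^ 'd \<Rightarrow> complex) \<Rightarrow> int ^ 'd \<Rightarrow> complex"
  where "wmul w f = (\<lambda>x. of_real (w x) * f x)"

text \<open>Where \<open>a\<close> vanishes the quotient has the default value 0; in
  \<open>threshold\<close> these points form a null set.\<close>

definition bs_form :: "(int ^ 'd \<Rightarrow> real) \<Rightarrow> (real ^ 'd \<Rightarrow> real) \<Rightarrow> real \<Rightarrow> (int ^ 'd \<Rightarrow> complex) \<Rightarrow> real"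
  where "bs_form w a \<mu> g = \<mu> * (LINT q|haar. (cmod (ft (wmul w g) q))\<^sup>2 / a q)"

text \<open>Instantiated with the square root of \<bar>v\<bar>, so that the constant
  \<open>W\<close> is the l1 norm of the potential.\<close>

locale weight =
  fixes w :: "int ^ 'd \<Rightarrow> real"
  assumes w_l2: "(\<lambda>x. (w x)\<^sup>2) summable_on UNIV" and w_even: "\<And>x. w (- x) = w x"
begin

definition W where "W = (\<Sum>\<^sub>\<infinity>x. (w x)\<^sup>2)"

definition wc where "wc = (\<lambda>x. complex_of_real (w x))"

lemma wc_ell2: "wc \<in> ell2" and wc_n2: "n2 wc = W"
  using w_l2 by (simp_all add: wc_def ell2_def n2_def W_def)

lemma W_nonneg: "W \<ge> 0"
  using n2_nonneg[of wc] by (simp add: wc_n2)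

lemma wmul_summable: "g \<in> ell2 \<Longrightarrow> (\<lambda>x. cmod (wmul w g x)) summable_on UNIV"
  using ell2_prod[OF wc_ell2] by (simp add: wmul_def wc_def norm_mult)

lemma wmul_l1: "g \<in> ell2 \<Longrightarrow> (\<Sum>\<^sub>\<infinity>x. cmod (wmul w g x)) \<le> sqrt (W * n2 g)"
  using ell2_CS[OF wc_ell2] by (simp add: wmul_def wc_def[abs_def] norm_mult wc_n2[unfolded wc_def])

lemma w_bound: "\<bar>w x\<bar> \<le> sqrt W"
proof -
  have "(w x)\<^sup>2 \<le> W" using ell2_point[OF wc_ell2, of x] by (simp add: wc_n2) (simp add: wc_def)
  then show ?thesis using real_le_rsqrt[of "\<bar>w x\<bar>"] by simp
qed

lemma wmul_ell2: "g \<in> ell2 \<Longrightarrow> wmul w g \<in> ell2"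
  by (rule ell2_le(1)[of g _ "sqrt W"]) (auto simp: wmul_def norm_mult w_bound intro!: mult_right_mono)

lemma wmul_even: "g \<in> l2e \<Longrightarrow> wmul w g (- x) = wmul w g x"
  by (simp add: wmul_def w_even l2e_even)

lemma wmul_l2e: "g \<in> l2e \<Longrightarrow> wmul w g \<in> l2e"
  by (rule l2eI) (simp_all add: wmul_ell2 l2e_ell2 wmul_even)

lemma wmul_lin: "wmul w (\<lambda>x. a * f x + b * g x) = (\<lambda>x. a * wmul w f x + b * wmul w g x)"
  by (simp add: wmul_def algebra_simps)

lemma wmul_comb: "wmul w (comb I c g) = comb I c (\<lambda>i. wmul w (g i))"
  by (simp add: wmul_def comb_def sum_distrib_left mult_ac)

lemma ip_wmul: "ip (wmul w f) g = ip f (wmul w g)"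
  unfolding ip_def wmul_def by (simp add: mult_ac)

lemma ft_wmul_bound: "g \<in> ell2 \<Longrightarrow> cmod (ft (wmul w g) q) \<le> sqrt (W * n2 g)"
  using ft_bound[OF wmul_summable, of g q] wmul_l1[of g] by linarith

lemma ft_wmul_sq: "g \<in> ell2 \<Longrightarrow> (cmod (ft (wmul w g) q))\<^sup>2 \<le> W * n2 g"
  using power_mono[OF ft_wmul_bound[of g q], of 2] W_nonneg n2_nonneg[of g] by simp

lemma ft_wmul_measurable: "g \<in> ell2 \<Longrightarrow> ft (wmul w g) \<in> borel_measurable borel"
  by (intro ft_measurable wmul_summable)

lemma bs_integrable:
  assumes g: "g \<in> ell2" and a: "a \<in> borel_measurable borel" and i: "integrable haar (\<lambda>q. 1 / a q)"
  shows "integrable haar (\<lambda>q. (cmod (ft (wmul w g) q))\<^sup>2 / a q)"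
proof (rule Bochner_Integration.integrable_bound)
  show "integrable haar (\<lambda>q. (W * n2 g) * (1 / a q))" using i by (rule integrable_mult_right)
  show "(\<lambda>q. (cmod (ft (wmul w g) q))\<^sup>2 / a q) \<in> borel_measurable haar"
    using ft_wmul_measurable[OF g] a by (intro haar_measurable) simp
  show "AE q in haar. norm ((cmod (ft (wmul w g) q))\<^sup>2 / a q) \<le> norm (W * n2 g * (1 / a q))"
    using ft_wmul_sq[OF g] W_nonneg n2_nonneg[of g]
    by (auto simp: abs_mult intro!: divide_right_mono)
qed

text \<open>\<open>ft (wmul w g)\<close> is bounded on the torus by \<open>sqrt (W * n2 g)\<close>,
  so nothing finer than the L1 norm of the difference of the inverse symbols enters.\<close>

lemma bs_form_diff:
  assumes g: "g \<in> ell2" and a: "a \<in> borel_measurable borel" "integrable haar (\<lambda>q. 1 / a q)"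
    and b: "b \<in> borel_measurable borel" "integrable haar (\<lambda>q. 1 / b q)" and \<mu>: "\<mu> \<ge> 0"
  shows "\<bar>bs_form w a \<mu> g - bs_form w b \<mu> g\<bar> \<le> \<mu> * W * (LINT q|haar. \<bar>1 / a q - 1 / b q\<bar>) * n2 g"
proof -
  note i = bs_integrable[OF g a] bs_integrable[OF g b]
  have "\<bar>(LINT q|haar. (cmod (ft (wmul w g) q))\<^sup>2 / a q) - (LINT q|haar. (cmod (ft (wmul w g) q))\<^sup>2 / b q)\<bar>
      = \<bar>LINT q|haar. (cmod (ft (wmul w g) q))\<^sup>2 / a q - (cmod (ft (wmul w g) q))\<^sup>2 / b q\<bar>"
    using i by simp
  also have "\<dots> \<le> (LINT q|haar. norm ((cmod (ft (wmul w g) q))\<^sup>2 / a q - (cmod (ft (wmul w g) q))\<^sup>2 / b q))"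
    using Bochner_Integration.integral_norm_bound[of haar "\<lambda>q. (cmod (ft (wmul w g) q))\<^sup>2 / a q - (cmod (ft (wmul w g) q))\<^sup>2 / b q"]
    by simp
  also have "\<dots> \<le> (LINT q|haar. (W * n2 g) * \<bar>1 / a q - 1 / b q\<bar>)"
  proof (rule Bochner_Integration.integral_mono)
    show "integrable haar (\<lambda>q. norm ((cmod (ft (wmul w g) q))\<^sup>2 / a q - (cmod (ft (wmul w g) q))\<^sup>2 / b q))"
      using i by simp
    show "integrable haar (\<lambda>q. (W * n2 g) * \<bar>1 / a q - 1 / b q\<bar>)" using a(2) b(2) by simp
    fix q
    have "(cmod (ft (wmul w g) q))\<^sup>2 / a q - (cmod (ft (wmul w g) q))\<^sup>2 / b q
        = (cmod (ft (wmul w g) q))\<^sup>2 * (1 / a q - 1 / b q)" by (simp add: algebra_simps)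
    then show "norm ((cmod (ft (wmul w g) q))\<^sup>2 / a q - (cmod (ft (wmul w g) q))\<^sup>2 / b q) \<le> (W * n2 g) * \<bar>1 / a q - 1 / b q\<bar>"
      using ft_wmul_sq[OF g, of q] by (simp add: abs_mult mult_right_mono)
  qed
  also have "\<dots> = W * n2 g * (LINT q|haar. \<bar>1 / a q - 1 / b q\<bar>)" by simp
  finally have "\<mu> * \<bar>(LINT q|haar. (cmod (ft (wmul w g) q))\<^sup>2 / a q) - (LINT q|haar. (cmod (ft (wmul w g) q))\<^sup>2 / b q)\<bar>
      \<le> \<mu> * (W * n2 g * (LINT q|haar. \<bar>1 / a q - 1 / b q\<bar>))" using \<mu> by (rule mult_left_mono)
  moreover have "\<bar>bs_form w a \<mu> g - bs_form w b \<mu> g\<bar> =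
      \<mu> * \<bar>(LINT q|haar. (cmod (ft (wmul w g) q))\<^sup>2 / a q) - (LINT q|haar. (cmod (ft (wmul w g) q))\<^sup>2 / b q)\<bar>"
    unfolding bs_form_def right_diff_distrib[symmetric] abs_mult using \<mu> by simp
  ultimately show ?thesis by (simp add: mult_ac)
qed

end

text \<open>Keeps of the dispersion relation only an even symbol with an integrable inverse;
  evenness of \<open>a\<close> and \<open>w\<close> is what keeps \<open>B\<close> on
  \<open>l2e\<close>.\<close>

locale threshold = weight w for w :: "int ^ 'd \<Rightarrow> real" +
  fixes a :: "real ^ 'd \<Rightarrow> real" and \<mu> :: real
  assumes a_meas: "a \<in> borel_measurable borel"
    and a_nonneg: "\<And>p. a p \<ge> 0" and a_even: "\<And>p. a (- p) = a p"
    and a_pos: "AE p in haar. a p > 0" and a_inv: "integrable haar (\<lambda>p. 1 / a p)"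
    and \<mu>: "\<mu> > 0"
begin

definition J where "J = (LINT q|haar. 1 / a q)"

lemma J_nonneg: "J \<ge> 0"
  unfolding J_def by (rule Bochner_Integration.integral_nonneg) (simp add: a_nonneg)

definition res where "res g = (\<lambda>q. ft (wmul w g) q / of_real (a q))"

text \<open>The Birman-Schwinger operator, with the inverse of the free operator acting as division
  on the torus; \<open>BS_eq\<close> identifies it with the kernel operator.
  \<open>fc (res g)\<close> is in general merely bounded, and the outer factor \<open>w\<close>
  brings it back to \<open>ell2\<close>.\<close>

definition B where "B g = (\<lambda>x. of_real (\<mu> * w x) * fc (res g) x)"

lemma res_integrable: "g \<in> ell2 \<Longrightarrow> integrable haar (res g)"
proof -
  assume g: "g \<in> ell2"
  have "integrable haar (\<lambda>q. complex_of_real (1 / a q))" by (rule integrable_of_real[OF a_inv])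
  from bounded_mult_integrable[OF this ft_wmul_measurable[OF g] ft_wmul_bound[OF g]]
  show ?thesis by (simp add: res_def[abs_def])
qed

lemma fc_res_bound: "g \<in> ell2 \<Longrightarrow> cmod (fc (res g) x) \<le> sqrt (W * n2 g) * J"
proof -
  assume g: "g \<in> ell2"
  have "cmod (fc (res g) x) \<le> (LINT q|haar. cmod (cis (lattice_pair q x) * res g q))"
    unfolding fc_def by (rule Bochner_Integration.integral_norm_bound)
  also have "\<dots> \<le> (LINT q|haar. sqrt (W * n2 g) * (1 / a q))"
  proof (rule Bochner_Integration.integral_mono)
    show "integrable haar (\<lambda>q. cmod (cis (lattice_pair q x) * res g q))"
      by (intro integrable_norm cis_mult_integrable res_integrable g)
    show "integrable haar (\<lambda>q. sqrt (W * n2 g) * (1 / a q))" using a_inv by (rule integrable_mult_right)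
    show "cmod (cis (lattice_pair q x) * res g q) \<le> sqrt (W * n2 g) * (1 / a q)" for q
      using ft_wmul_bound[OF g, of q] a_nonneg[of q]
      by (simp add: res_def norm_mult norm_divide divide_right_mono)
  qed
  also have "\<dots> = sqrt (W * n2 g) * J" unfolding J_def by (rule integral_mult_right_zero)
  finally show ?thesis .
qed

lemma B_ell2: "g \<in> ell2 \<Longrightarrow> B g \<in> ell2"
proof -
  assume g: "g \<in> ell2"
  have "cmod (B g x) \<le> (\<mu> * (sqrt (W * n2 g) * J)) * cmod (wc x)" for x
  proof -
    have "cmod (B g x) = \<mu> * cmod (fc (res g) x) * \<bar>w x\<bar>"
      using \<mu> by (simp add: B_def norm_mult abs_mult)
    also have "\<dots> \<le> \<mu> * (sqrt (W * n2 g) * J) * \<bar>w x\<bar>"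
      using \<mu> fc_res_bound[OF g] by (intro mult_right_mono mult_left_mono) auto
    finally show ?thesis by (simp add: wc_def)
  qed
  then show ?thesis by (rule ell2_le(1)[OF wc_ell2])
qed

lemma res_measurable: "g \<in> ell2 \<Longrightarrow> res g \<in> borel_measurable borel"
  unfolding res_def[abs_def] using ft_wmul_measurable[of g] a_meas by simp

lemma B_l2e: "g \<in> l2e \<Longrightarrow> B g \<in> l2e"
proof (rule l2eI)
  assume g: "g \<in> l2e"
  show "B g \<in> ell2" using B_ell2 l2e_ell2[OF g] .
  have "res g (- q) = res g q" for q
    by (simp add: res_def a_even ft_even wmul_even[OF g])
  then show "B g (- x) = B g x" for x
    unfolding B_def using fc_even[OF res_measurable[OF l2e_ell2[OF g]], of x] by (simp add: w_even)
qed

lemma fc_lin: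
  assumes "integrable haar F" "integrable haar G"
  shows "fc (\<lambda>q. c * F q + d * G q) x = c * fc F x + d * fc G x"
proof -
  have "fc (\<lambda>q. c * F q + d * G q) x =
      (LINT q|haar. c * (cis (lattice_pair q x) * F q) + d * (cis (lattice_pair q x) * G q))"
    unfolding fc_def by (simp add: algebra_simps)
  then show ?thesis
    by (simp add: fc_def cis_mult_integrable[OF assms(1)] cis_mult_integrable[OF assms(2)])
qed

lemma B_lin:
  assumes "f \<in> ell2" "g \<in> ell2"
  shows "B (\<lambda>x. c * f x + d * g x) = (\<lambda>x. c * B f x + d * B g x)"
proof -
  have "res (\<lambda>x. c * f x + d * g x) = (\<lambda>q. c * res f q + d * res g q)"
    unfolding res_def wmul_lin using ft_lin[OF wmul_summable[OF assms(1)] wmul_summable[OF assms(2)]]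
    by (simp add: add_divide_distrib)
  then show ?thesis
    using fc_lin[OF res_integrable[OF assms(1)] res_integrable[OF assms(2)], of c d]
    by (simp add: B_def algebra_simps)
qed

lemma ip_B:
  assumes "f \<in> ell2" "g \<in> ell2"
  shows "ip (B f) g = of_real \<mu> * (LINT q|haar. res f q * cnj (ft (wmul w g) q))"
proof -
  have "ip (B f) g = of_real \<mu> * ip (fc (res f)) (wmul w g)"
    unfolding B_def ip_def wmul_def by (simp add: mult_ac flip: infsum_cmult_right')
  then show ?thesis
    using parseval_exchange[OF wmul_summable[OF assms(2)] res_integrable[OF assms(1)]] by simp
qed

lemma B_herm:
  assumes "f \<in> ell2" "g \<in> ell2"
  shows "ip (B f) g = ip f (B g)"
proof -
  have "ip f (B g) = cnj (ip (B g) f)" by (rule ip_cnj)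
  also have "\<dots> = of_real \<mu> * (LINT q|haar. cnj (res g q * cnj (ft (wmul w f) q)))"
    unfolding ip_B[OF assms(2,1)] complex_cnj_mult[of "of_real \<mu>"] by (simp only: Bochner_Integration.integral_cnj complex_cnj_complex_of_real)
  also have "\<dots> = ip (B f) g"
    unfolding ip_B[OF assms] by (simp add: res_def mult.commute)
  finally show ?thesis ..
qed

lemma bs_form_eq: "f \<in> ell2 \<Longrightarrow> ip (B f) f = of_real (bs_form w a \<mu> f)"
proof -
  assume f: "f \<in> ell2"
  have "res f q * cnj (ft (wmul w f) q) = of_real ((cmod (ft (wmul w f) q))\<^sup>2 / a q)" for q
    unfolding of_real_divide complex_norm_square by (simp add: res_def)
  then show ?thesis
    unfolding ip_B[OF f f] bs_form_def by (simp only: integral_complex_of_real of_real_mult)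
qed

lemma bs_form_bound: "g \<in> ell2 \<Longrightarrow> bs_form w a \<mu> g \<le> \<mu> * W * J * n2 g"
proof -
  assume g: "g \<in> ell2"
  have "(LINT q|haar. (cmod (ft (wmul w g) q))\<^sup>2 / a q) \<le> (LINT q|haar. (W * n2 g) * (1 / a q))"
  proof (rule Bochner_Integration.integral_mono)
    show "integrable haar (\<lambda>q. (cmod (ft (wmul w g) q))\<^sup>2 / a q)" by (rule bs_integrable[OF g a_meas a_inv])
    show "integrable haar (\<lambda>q. (W * n2 g) * (1 / a q))" using a_inv by (rule integrable_mult_right)
    show "(cmod (ft (wmul w g) q))\<^sup>2 / a q \<le> (W * n2 g) * (1 / a q)" for q
      using ft_wmul_sq[OF g, of q] a_nonneg[of q] by (simp add: divide_right_mono)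
  qed
  also have "\<dots> = W * n2 g * J" unfolding J_def by (rule integral_mult_right_zero)
  finally have "\<mu> * (LINT q|haar. (cmod (ft (wmul w g) q))\<^sup>2 / a q) \<le> \<mu> * (W * n2 g * J)"
    using \<mu> by (intro mult_left_mono) auto
  then show ?thesis by (simp add: bs_form_def mult_ac)
qed

text \<open>The source of compactness: the fixed square-summable \<open>w\<close> turns weak
  convergence of \<open>F n\<close> into uniform convergence of the transforms on the torus.\<close>

lemma ft_wmul_lim:
  assumes F: "\<And>n. F n \<in> ell2" "\<And>n. n2 (F n) \<le> 1" and lim: "\<And>x. (\<lambda>n. F n x) \<longlonglongrightarrow> f x"
  shows "\<exists>d. d \<longlonglongrightarrow> 0 \<and> (\<forall>n q. cmod (ft (wmul w (F n)) q - ft (wmul w f) q) \<le> d n)"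
proof (intro exI conjI allI)
  note f = weak_limit_ell2[OF F lim]
  show "(\<lambda>n. \<Sum>\<^sub>\<infinity>x. cmod (wc x) * cmod (F n x - f x)) \<longlonglongrightarrow> 0"
    by (rule weak_abs_diff[OF wc_ell2 F lim])
  fix n q
  have d: "(\<lambda>x. F n x - f x) \<in> ell2" by (rule ell2_diff[OF F(1) f(1)])
  have e: "wmul w (\<lambda>x. F n x - f x) = (\<lambda>x. 1 * wmul w (F n) x + (- 1) * wmul w f x)"
    by (simp add: wmul_def algebra_simps)
  have "ft (wmul w (F n)) q - ft (wmul w f) q = ft (wmul w (\<lambda>x. F n x - f x)) q"
    unfolding e ft_lin[OF wmul_summable[OF F(1)] wmul_summable[OF f(1)]] by simp
  then show "cmod (ft (wmul w (F n)) q - ft (wmul w f) q) \<le> (\<Sum>\<^sub>\<infinity>x. cmod (wc x) * cmod (F n x - f x))"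
    using ft_bound[OF wmul_summable[OF d], of q] by (simp add: wmul_def wc_def norm_mult)
qed

lemma B_pointwise_lim:
  assumes F: "\<And>n. F n \<in> ell2" "\<And>n. n2 (F n) \<le> 1" and lim: "\<And>x. (\<lambda>n. F n x) \<longlonglongrightarrow> f x"
  shows "(\<lambda>n. B (F n) x) \<longlonglongrightarrow> B f x"
proof -
  note f = weak_limit_ell2[OF F lim]
  obtain d where d: "d \<longlonglongrightarrow> 0" "\<And>n q. cmod (ft (wmul w (F n)) q - ft (wmul w f) q) \<le> d n"
    using ft_wmul_lim[OF F lim] by blast
  have "cmod (fc (res (F n)) x - fc (res f) x) \<le> d n * J" for n
  proof -
    have i: "integrable haar (\<lambda>q. cis (lattice_pair q x) * res (F n) q)" "integrable haar (\<lambda>q. cis (lattice_pair q x) * res f q)"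
      by (intro cis_mult_integrable res_integrable F f(1))+
    have "fc (res (F n)) x - fc (res f) x = (LINT q|haar. cis (lattice_pair q x) * res (F n) q - cis (lattice_pair q x) * res f q)"
      unfolding fc_def using i by simp
    also have "cmod \<dots> \<le> (LINT q|haar. cmod (cis (lattice_pair q x) * res (F n) q - cis (lattice_pair q x) * res f q))"
      by (rule Bochner_Integration.integral_norm_bound)
    also have "\<dots> \<le> (LINT q|haar. d n * (1 / a q))"
    proof (rule Bochner_Integration.integral_mono)
      show "integrable haar (\<lambda>q. cmod (cis (lattice_pair q x) * res (F n) q - cis (lattice_pair q x) * res f q))"
        using i by simp
      show "integrable haar (\<lambda>q. d n * (1 / a q))" using a_inv by (rule integrable_mult_right)
      fix q
      have "cis (lattice_pair q x) * res (F n) q - cis (lattice_pair q x) * res f q =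
          cis (lattice_pair q x) * ((ft (wmul w (F n)) q - ft (wmul w f) q) / of_real (a q))"
        by (simp add: res_def algebra_simps diff_divide_distrib)
      then have "cmod (cis (lattice_pair q x) * res (F n) q - cis (lattice_pair q x) * res f q) =
          cmod (ft (wmul w (F n)) q - ft (wmul w f) q) / a q"
        using a_nonneg[of q] by (simp add: norm_mult norm_divide)
      then show "cmod (cis (lattice_pair q x) * res (F n) q - cis (lattice_pair q x) * res f q) \<le> d n * (1 / a q)"
        using d(2)[of n q] a_nonneg[of q] by (simp add: divide_right_mono)
    qed
    also have "\<dots> = d n * J" unfolding J_def by (rule integral_mult_right_zero)
    finally show ?thesis .
  qed
  then have ev: "\<forall>\<^sub>F n in sequentially. norm (fc (res (F n)) x - fc (res f) x) \<le> d n * J"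
    by (intro always_eventually allI)
  have "(\<lambda>n. d n * J) \<longlonglongrightarrow> 0 * J" by (intro tendsto_mult d(1) tendsto_const)
  then have "(\<lambda>n. d n * J) \<longlonglongrightarrow> 0" by simp
  with ev have "(\<lambda>n. fc (res (F n)) x - fc (res f) x) \<longlonglongrightarrow> 0"
    by (rule Lim_null_comparison)
  then have "(\<lambda>n. fc (res (F n)) x) \<longlonglongrightarrow> fc (res f) x" by (simp add: LIM_zero_iff)
  then show ?thesis unfolding B_def by (intro tendsto_mult tendsto_const)
qed

lemma bs_form_lim:
  assumes F: "\<And>n. F n \<in> ell2" "\<And>n. n2 (F n) \<le> 1" and lim: "\<And>x. (\<lambda>n. F n x) \<longlonglongrightarrow> f x"
  shows "(\<lambda>n. bs_form w a \<mu> (F n)) \<longlonglongrightarrow> bs_form w a \<mu> f"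
proof -
  note f = weak_limit_ell2[OF F lim]
  obtain d where d: "d \<longlonglongrightarrow> 0" "\<And>n q. cmod (ft (wmul w (F n)) q - ft (wmul w f) q) \<le> d n"
    using ft_wmul_lim[OF F lim] by blast
  have d0: "d n \<ge> 0" for n using d(2)[of n undefined] norm_ge_zero order.trans by blast
  have "\<bar>(LINT q|haar. (cmod (ft (wmul w (F n)) q))\<^sup>2 / a q) - (LINT q|haar. (cmod (ft (wmul w f) q))\<^sup>2 / a q)\<bar>
      \<le> (d n * (2 * sqrt W)) * J" for n
  proof -
    note i = bs_integrable[OF F(1)[of n] a_meas a_inv] bs_integrable[OF f(1) a_meas a_inv]
    have "\<bar>(LINT q|haar. (cmod (ft (wmul w (F n)) q))\<^sup>2 / a q) - (LINT q|haar. (cmod (ft (wmul w f) q))\<^sup>2 / a q)\<bar>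
      = norm (LINT q|haar. (cmod (ft (wmul w (F n)) q))\<^sup>2 / a q - (cmod (ft (wmul w f) q))\<^sup>2 / a q)"
      using i by simp
    also have "\<dots> \<le> (LINT q|haar. norm ((cmod (ft (wmul w (F n)) q))\<^sup>2 / a q - (cmod (ft (wmul w f) q))\<^sup>2 / a q))"
      by (rule Bochner_Integration.integral_norm_bound)
    also have "\<dots> \<le> (LINT q|haar. (d n * (2 * sqrt W)) * (1 / a q))"
    proof (rule Bochner_Integration.integral_mono)
      show "integrable haar (\<lambda>q. norm ((cmod (ft (wmul w (F n)) q))\<^sup>2 / a q - (cmod (ft (wmul w f) q))\<^sup>2 / a q))"
        using i by simp
      show "integrable haar (\<lambda>q. d n * (2 * sqrt W) * (1 / a q))" using a_inv by (rule integrable_mult_right)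
      fix q
      define u v where "u = cmod (ft (wmul w (F n)) q)" and "v = cmod (ft (wmul w f) q)"
      have b: "sqrt (W * n2 g) \<le> sqrt W" if "n2 g \<le> 1" for g :: "int ^ 'd \<Rightarrow> complex"
        using that W_nonneg mult_left_mono[OF that, of W] by simp
      have uv: "u \<le> sqrt W" "v \<le> sqrt W" "0 \<le> u" "0 \<le> v"
        using ft_wmul_bound[OF F(1), of n q] ft_wmul_bound[OF f(1), of q] b[OF F(2)[of n]] b[OF f(2)]
        unfolding u_def v_def by (auto intro: order.trans)
      have "\<bar>u - v\<bar> \<le> d n" unfolding u_def v_def using norm_triangle_ineq3 d(2) order.trans by blast
      then have "\<bar>u - v\<bar> * (u + v) \<le> d n * (2 * sqrt W)"
        using uv d0[of n] by (intro mult_mono) auto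
      then have "\<bar>u\<^sup>2 - v\<^sup>2\<bar> \<le> d n * (2 * sqrt W)"
        using uv by (simp add: power2_eq_square square_diff_square_factored abs_mult mult.commute)
      then have "\<bar>u\<^sup>2 - v\<^sup>2\<bar> / a q \<le> d n * (2 * sqrt W) / a q" using a_nonneg[of q] by (rule divide_right_mono)
      moreover have "norm (u\<^sup>2 / a q - v\<^sup>2 / a q) = \<bar>u\<^sup>2 - v\<^sup>2\<bar> / a q"
        using a_nonneg[of q] by (simp flip: diff_divide_distrib)
      ultimately show "norm ((cmod (ft (wmul w (F n)) q))\<^sup>2 / a q - (cmod (ft (wmul w f) q))\<^sup>2 / a q) \<le> d n * (2 * sqrt W) * (1 / a q)"
        unfolding u_def v_def by simp
    qed
    also have "\<dots> = (d n * (2 * sqrt W)) * J" unfolding J_def by (rule integral_mult_right_zero)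
    finally show ?thesis .
  qed
  then have ev: "\<forall>\<^sub>F n in sequentially. norm ((LINT q|haar. (cmod (ft (wmul w (F n)) q))\<^sup>2 / a q) -
      (LINT q|haar. (cmod (ft (wmul w f) q))\<^sup>2 / a q)) \<le> (d n * (2 * sqrt W)) * J"
    unfolding real_norm_def by (intro always_eventually allI)
  have "(\<lambda>n. (d n * (2 * sqrt W)) * J) \<longlonglongrightarrow> (0 * (2 * sqrt W)) * J" by (intro tendsto_mult d(1) tendsto_const)
  then have "(\<lambda>n. (d n * (2 * sqrt W)) * J) \<longlonglongrightarrow> 0" by simp
  with ev have "(\<lambda>n. (LINT q|haar. (cmod (ft (wmul w (F n)) q))\<^sup>2 / a q) - (LINT q|haar. (cmod (ft (wmul w f) q))\<^sup>2 / a q)) \<longlonglongrightarrow> 0"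
    by (rule Lim_null_comparison)
  then have "(\<lambda>n. (LINT q|haar. (cmod (ft (wmul w (F n)) q))\<^sup>2 / a q)) \<longlonglongrightarrow> (LINT q|haar. (cmod (ft (wmul w f) q))\<^sup>2 / a q)"
    by (simp add: LIM_zero_iff)
  then show ?thesis unfolding bs_form_def by (intro tendsto_mult tendsto_const)
qed

lemma usc_form_op_B: "usc_form_op l2e B"
proof
  show "\<exists>C. \<forall>f\<in>l2e. Re (ip (B f) f) \<le> C * n2 f"
  proof (intro exI ballI)
    fix f :: "int ^ 'd \<Rightarrow> complex" assume "f \<in> l2e"
    then have f: "f \<in> ell2" by (rule l2e_ell2)
    show "Re (ip (B f) f) \<le> (\<mu> * W * J) * n2 f"
      unfolding bs_form_eq[OF f] using bs_form_bound[OF f] by simp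
  qed
next
  fix F f l
  assume F: "\<And>n. F n \<in> l2e" "\<And>n. n2 (F n) \<le> 1" "\<And>x. (\<lambda>n. F n x) \<longlonglongrightarrow> f x" "f \<in> l2e"
    and l: "(\<lambda>n. Re (ip (B (F n)) (F n))) \<longlonglongrightarrow> l"
  have "(\<lambda>n. Re (ip (B (F n)) (F n))) \<longlonglongrightarrow> Re (ip (B f) f)"
    using bs_form_lim[of F f] F by (simp add: bs_form_eq l2e_ell2)
  then show "l \<le> Re (ip (B f) f)" using LIMSEQ_unique[OF l] by simp
qed (auto simp: l2e_ell2 l2e_lin B_l2e B_lin B_herm intro: l2e_lim)

text \<open>Unit eigenvectors with eigenvalues tending to 1 would have a weak limit fixed by
  \<open>B\<close>, hence 0, while the weakly continuous form would take the value 1 there. The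
  implication is shaped to lift a bound \<open>1 - \<eta> < s\<close> across 1.\<close>

lemma B_spectral_gap:
  assumes no: "\<And>f. f \<in> l2e \<Longrightarrow> B f = f \<Longrightarrow> f = (\<lambda>_. 0)"
  shows "\<exists>\<eta>>0. \<eta> < 1 \<and> (\<forall>f s. f \<in> l2e \<longrightarrow> n2 f = 1 \<longrightarrow> B f = (\<lambda>x. of_real s * f x) \<longrightarrow> 1 - \<eta> < s \<longrightarrow> 1 + \<eta> < s)"
proof (rule ccontr)
  assume neg: "\<not> ?thesis"
  have "\<exists>f s. f \<in> l2e \<and> n2 f = 1 \<and> B f = (\<lambda>x. of_real s * f x) \<and> \<bar>s - 1\<bar> \<le> 1 / real (Suc (Suc n))" for n
  proof -
    \<comment> \<open>\<open>Suc (Suc n)\<close> instead of \<open>Suc n\<close> keeps the trial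
      value of \<eta> below 1 for every \<open>n\<close>.\<close>
    have "(0::real) < 1 / real (Suc (Suc n))" "1 / real (Suc (Suc n)) < 1" by auto
    then obtain f s where "f \<in> l2e" "n2 f = 1" "B f = (\<lambda>x. of_real s * f x)"
      "1 - 1 / real (Suc (Suc n)) < s" "\<not> 1 + 1 / real (Suc (Suc n)) < s"
      using neg by blast
    then show ?thesis by (intro exI[of _ f] exI[of _ s]) auto
  qed
  then obtain F lam where F: "\<And>n. F n \<in> l2e" "\<And>n. n2 (F n) = 1"
    "\<And>n. B (F n) = (\<lambda>x. complex_of_real (lam n) * F n x)" "\<And>n. \<bar>lam n - 1\<bar> \<le> 1 / real (Suc (Suc n))"
    by metis
  have "(\<lambda>n. 1 / real (Suc (Suc n))) \<longlonglongrightarrow> 0"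
    using LIMSEQ_Suc[OF LIMSEQ_inverse_real_of_nat] by (simp add: inverse_eq_divide)
  then have "(\<lambda>n. lam n - 1) \<longlonglongrightarrow> 0"
    by (rule Lim_null_comparison[rotated]) (use F(4) in auto)
  then have lam1: "lam \<longlonglongrightarrow> 1" by (simp add: LIM_zero_iff)
  have Fb: "cmod (F n x) \<le> 1" for n x
  proof -
    have "(cmod (F n x))\<^sup>2 \<le> 1" using ell2_point[OF l2e_ell2[OF F(1)[of n]], of x] F(2)[of n] by linarith
    then show ?thesis by (simp add: abs_square_le_1)
  qed
  obtain r f where r: "strict_mono r" and lim: "\<And>x. (\<lambda>n. F (r n) x) \<longlonglongrightarrow> f x"
    using pointwise_subseq[of F 1] Fb by blast
  have Fr: "F (r n) \<in> ell2" "n2 (F (r n)) \<le> 1" for n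
    using l2e_ell2[OF F(1)] F(2) by (simp_all only: order_refl)
  note f = weak_limit_ell2[OF Fr lim]
  have fl: "f \<in> l2e" by (rule l2e_lim[OF F(1) lim f(1)])
  have lr: "(\<lambda>n. lam (r n)) \<longlonglongrightarrow> 1"
    using LIMSEQ_subseq_LIMSEQ[OF lam1 r] by (simp add: o_def)
  have "B f x = f x" for x
  proof -
    have "(\<lambda>n. B (F (r n)) x) \<longlonglongrightarrow> B f x" by (rule B_pointwise_lim[OF Fr lim])
    moreover have "(\<lambda>n. B (F (r n)) x) \<longlonglongrightarrow> of_real 1 * f x"
      unfolding F(3) by (intro tendsto_mult tendsto_of_real lr lim)
    ultimately show ?thesis using LIMSEQ_unique by fastforce
  qed
  then have f0: "f = (\<lambda>_. 0)" using no[OF fl] by blast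
  have "bs_form w a \<mu> (F (r n)) = lam (r n)" for n
  proof -
    have "complex_of_real (bs_form w a \<mu> (F (r n))) = ip (B (F (r n))) (F (r n))"
      by (rule bs_form_eq[symmetric]) (rule Fr)
    also have "\<dots> = of_real (lam (r n))"
      unfolding F(3) ip_scale_left ip_self[OF Fr(1)] F(2) by simp
    finally show ?thesis using of_real_eq_iff by blast
  qed
  then have "(\<lambda>n. lam (r n)) \<longlonglongrightarrow> bs_form w a \<mu> f" using bs_form_lim[OF Fr lim] by simp
  then have "bs_form w a \<mu> f = 1" using LIMSEQ_unique lr by blast
  moreover have "bs_form w a \<mu> f \<le> 0" using bs_form_bound[OF f(1)] by (simp add: f0 n2_zero)
  ultimately show False by simp
qed

end

lemma lin_comb:
  assumes lin: "\<And>f g a b. f \<in> ell2 \<Longrightarrow> g \<in> ell2 \<Longrightarrow> L (\<lambda>x. a * f x + b * g x) = (\<lambda>x. a * L f x + b * L g x)"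
    and I: "finite I" "\<And>i. i \<in> I \<Longrightarrow> g i \<in> ell2"
  shows "L (comb I c g) = comb I c (\<lambda>i. L (g i))"
  using I
proof (induction I rule: finite_induct)
  case empty
  show ?case using lin[OF ell2_zero ell2_zero, of 0 0] by (simp add: comb_def)
next
  case (insert k J)
  have e: "comb (insert k J) c g = (\<lambda>x. c k * g k x + 1 * comb J c g x)"
    using insert by (simp add: comb_def)
  have "comb J c g \<in> ell2" by (rule ell2_comb) (use insert in auto)
  then have "L (comb (insert k J) c g) = (\<lambda>x. c k * L (g k) x + 1 * L (comb J c g) x)"
    unfolding e by (intro lin) (use insert in auto)
  then show ?case using insert by (simp add: comb_def)
qed

section \<open>The Birman-Schwinger principle\<close>

text \<open>\<open>K\<close> holds the Fourier coefficients of the symbol \<open>a + e\<close>: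
  convolution with \<open>K\<close> is the free operator, \<open>e\<close> its threshold, and
  \<open>a\<close> the height of the symbol above the threshold.\<close>

locale lattice_ham = threshold w a \<mu> for w :: "int ^ 'd \<Rightarrow> real" and a :: "real ^ 'd \<Rightarrow> real" and \<mu> :: real +
  fixes K :: "int ^ 'd \<Rightarrow> real" and e :: real
  assumes K_l1: "(\<lambda>x. \<bar>K x\<bar>) summable_on UNIV" and K_even: "\<And>x. K (- x) = K x"
    and ft_K: "\<And>q. ft (\<lambda>x. of_real (K x)) q = of_real (a q + e)"
begin

text \<open>The free operator minus the threshold, with symbol \<open>a\<close>. The coefficients
  are written out so that the linearity lemmas match.\<close>

definition A where "A f = (\<lambda>x. 1 * convol K f x + of_real (- e) * f x)"

definition CA where "CA = 2 * (\<Sum>\<^sub>\<infinity>x. \<bar>K x\<bar>)\<^sup>2 + 2 * e\<^sup>2"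

lemma CA_nonneg: "CA \<ge> 0"
  by (simp add: CA_def)

lemma A_ell2: "f \<in> ell2 \<Longrightarrow> A f \<in> ell2"
  unfolding A_def by (intro ell2_lin convol_ell2 K_l1)

lemma A_bound: "f \<in> ell2 \<Longrightarrow> n2 (A f) \<le> CA * n2 f"
proof -
  assume f: "f \<in> ell2"
  have "A f = (\<lambda>x. convol K f x - of_real e * f x)" by (simp add: A_def)
  then have "n2 (A f) \<le> 2 * n2 (convol K f) + 2 * n2 (\<lambda>x. of_real e * f x)"
    using n2_diff_le[OF convol_ell2[OF K_l1 f] ell2_scale[OF f]] by simp
  also have "\<dots> \<le> 2 * ((\<Sum>\<^sub>\<infinity>x. \<bar>K x\<bar>)\<^sup>2 * n2 f) + 2 * (e\<^sup>2 * n2 f)"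
    using convol_bound[OF K_l1 f] by (simp add: n2_scale)
  finally show ?thesis by (simp add: CA_def algebra_simps)
qed

lemma A_lin:
  assumes "f \<in> ell2" "g \<in> ell2"
  shows "A (\<lambda>x. c * f x + d * g x) = (\<lambda>x. c * A f x + d * A g x)"
  unfolding A_def convol_lin[OF K_l1 assms] by (simp add: algebra_simps)

lemma A_herm: "f \<in> ell2 \<Longrightarrow> g \<in> ell2 \<Longrightarrow> ip (A f) g = ip f (A g)"
  unfolding A_def
  by (simp only: ip_lin_left[OF convol_ell2[OF K_l1]] ip_lin_right[OF convol_ell2[OF K_l1]] convol_herm[OF K_l1 K_even])
     simp

lemma A_even: "f \<in> l2e \<Longrightarrow> A f (- x) = A f x"
  by (simp add: A_def convol_even K_even l2e_even)

sublocale A: herm_op ell2 A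
  by unfold_locales (auto intro: ell2_lin A_ell2 A_herm simp: A_lin)

lemma a_bound: "a q \<le> (\<Sum>\<^sub>\<infinity>x. \<bar>K x\<bar>) + \<bar>e\<bar>"
proof -
  have "cmod (ft (\<lambda>x. of_real (K x)) q) \<le> (\<Sum>\<^sub>\<infinity>x. \<bar>K x\<bar>)"
    using ft_bound[of "\<lambda>x. complex_of_real (K x)" q] K_l1 by simp
  then have "\<bar>a q + e\<bar> \<le> (\<Sum>\<^sub>\<infinity>x. \<bar>K x\<bar>)" unfolding ft_K by (simp only: norm_of_real)
  then show ?thesis by linarith
qed

lemma A_fc:
  assumes F: "integrable haar F"
  shows "A (fc F) x = fc (\<lambda>q. of_real (a q) * F q) x"
proof -
  have K: "(\<lambda>x. cmod (complex_of_real (K x))) summable_on UNIV" using K_l1 by simp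
  have i: "integrable haar (\<lambda>q. ft (\<lambda>x. of_real (K x)) q * F q)"
    by (rule bounded_mult_integrable[OF F ft_measurable[OF K] ft_bound[OF K]])
  have "fc (\<lambda>q. of_real (a q) * F q) x = fc (\<lambda>q. 1 * (ft (\<lambda>x. of_real (K x)) q * F q) + of_real (- e) * F q) x"
    unfolding ft_K by (simp add: algebra_simps)
  also have "\<dots> = 1 * fc (\<lambda>q. ft (\<lambda>x. of_real (K x)) q * F q) x + of_real (- e) * fc F x"
    by (rule fc_lin[OF i F])
  finally show ?thesis by (simp add: A_def convol_fc[OF K_l1 F])
qed

lemma ft_int:
  assumes "(\<lambda>y. cmod (u y)) summable_on UNIV"
  shows "integrable haar (ft u)"
  by (rule haar_integrable_bounded[OF ft_measurable[OF assms] ft_bound[OF assms]])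

lemma ip_A_l1:
  assumes f: "(\<lambda>y. cmod (f y)) summable_on UNIV"
  shows "ip (A f) f = of_real (LINT q|haar. a q * (cmod (ft f q))\<^sup>2)"
proof -
  have ff: "fc (ft f) = f" using fc_ft[OF f] by blast
  have i: "integrable haar (\<lambda>q. of_real (a q) * ft f q)"
    by (rule bounded_mult_integrable[OF ft_int[OF f], where C="(\<Sum>\<^sub>\<infinity>x. \<bar>K x\<bar>) + \<bar>e\<bar>"])
       (use a_meas a_bound a_nonneg in \<open>auto simp: norm_of_real\<close>)
  have "A f = fc (\<lambda>q. of_real (a q) * ft f q)"
    using A_fc[OF ft_int[OF f]] unfolding ff by blast
  then have "ip (A f) f = (LINT q|haar. of_real (a q) * ft f q * cnj (ft f q))"
    using parseval_exchange[OF f i] by simp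
  also have "\<dots> = (LINT q|haar. of_real (a q * (cmod (ft f q))\<^sup>2))"
    by (simp only: mult.assoc of_real_mult complex_norm_square)
  finally show ?thesis by (simp only: integral_complex_of_real)
qed

text \<open>
  This is \<open>2 Re \<langle>A\<^bsup>-1/2\<^esup> w h, A\<^bsup>1/2\<^esup> f\<rangle> \<le> \<parallel>A\<^bsup>1/2\<^esup> f\<parallel>\<^sup>2 / \<mu> + \<mu> \<parallel>A\<^bsup>-1/2\<^esup> w h\<parallel>\<^sup>2\<close>, where \<open>A\<^bsup>-1/2\<^esup> w h\<close> makes
  sense only as a function on the torus.
\<close>

lemma weighted_duality_l1:
  assumes f: "(\<lambda>y. cmod (f y)) summable_on UNIV" and h: "h \<in> ell2"
  shows "2 * Re (ip (wmul w h) f) \<le> Re (ip (A f) f) / \<mu> + bs_form w a \<mu> h"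
proof -
  define X where "X = ft (wmul w h)"
  define Y where "Y = ft f"
  note wh = wmul_summable[OF h]
  have m[measurable]: "X \<in> borel_measurable borel" "Y \<in> borel_measurable borel" "a \<in> borel_measurable borel"
    unfolding X_def Y_def using ft_measurable[OF wh] ft_measurable[OF f] a_meas by auto
  have Yb: "cmod (Y q) \<le> (\<Sum>\<^sub>\<infinity>y. cmod (f y))" for q unfolding Y_def by (rule ft_bound[OF f])
  have i1: "integrable haar (\<lambda>q. a q * (cmod (Y q))\<^sup>2)"
  proof (rule haar_integrable_bounded)
    show "(\<lambda>q. a q * (cmod (Y q))\<^sup>2) \<in> borel_measurable borel" by measurable
    show "norm (a q * (cmod (Y q))\<^sup>2) \<le> ((\<Sum>\<^sub>\<infinity>x. \<bar>K x\<bar>) + \<bar>e\<bar>) * (\<Sum>\<^sub>\<infinity>y. cmod (f y))\<^sup>2" for q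
    proof -
      have "0 \<le> (\<Sum>\<^sub>\<infinity>x. \<bar>K x\<bar>)" by (rule infsum_nonneg) simp
      then show ?thesis using a_nonneg[of q] a_bound[of q] Yb[of q]
        by (simp add: abs_mult mult_mono power_mono)
    qed
  qed
  have i2: "integrable haar (\<lambda>q. (cmod (X q))\<^sup>2 / a q)"
    unfolding X_def by (rule bs_integrable[OF h a_meas a_inv])
  have Xi: "integrable haar X" unfolding X_def by (rule ft_int[OF wh])
  have i3: "integrable haar (\<lambda>q. X q * cnj (Y q))"
  proof -
    have "integrable haar (\<lambda>q. cnj (Y q) * X q)"
    proof (rule bounded_mult_integrable[OF Xi])
      have "cnj \<in> borel_measurable borel"
        by (intro borel_measurable_continuous_onI continuous_intros)
      then show "(\<lambda>q. cnj (Y q)) \<in> borel_measurable borel" by (rule measurable_compose[OF m(2)])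
    qed (use Yb in auto)
    then show ?thesis by (simp add: mult.commute)
  qed
  have "ip (wmul w h) f = ip (fc X) f" unfolding X_def using fc_ft[OF wh] by (metis ext)
  also have "\<dots> = (LINT q|haar. X q * cnj (Y q))"
    unfolding Y_def by (rule parseval_exchange[OF f Xi])
  finally have "Re (ip (wmul w h) f) = (LINT q|haar. Re (X q * cnj (Y q)))"
    using integral_Re[OF i3] by simp
  also have "\<dots> \<le> (LINT q|haar. (1/2) * ((1 / \<mu>) * (a q * (cmod (Y q))\<^sup>2) + \<mu> * ((cmod (X q))\<^sup>2 / a q)))"
  proof (rule integral_mono_AE)
    show "integrable haar (\<lambda>q. Re (X q * cnj (Y q)))" using i3 by (rule integrable_Re)
    show "integrable haar (\<lambda>q. (1/2) * ((1 / \<mu>) * (a q * (cmod (Y q))\<^sup>2) + \<mu> * ((cmod (X q))\<^sup>2 / a q)))"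
      by (intro integrable_mult_right Bochner_Integration.integrable_add i1 i2)
    show "AE q in haar. Re (X q * cnj (Y q)) \<le> (1/2) * ((1 / \<mu>) * (a q * (cmod (Y q))\<^sup>2) + \<mu> * ((cmod (X q))\<^sup>2 / a q))"
      using a_pos
    proof eventually_elim
      case (elim q)
      \<comment> \<open>Young's inequality with the weight \<open>a q / \<mu>\<close> distributed
        over the two factors; almost everywhere positivity of \<open>a\<close> is used here.\<close>
      define s t where "s = sqrt (a q / \<mu>) * cmod (Y q)" and "t = cmod (X q) / sqrt (a q / \<mu>)"
      have p: "a q / \<mu> > 0" using elim \<mu> by simp
      have "Re (X q * cnj (Y q)) \<le> cmod (X q) * cmod (Y q)"
        using complex_Re_le_cmod[of "X q * cnj (Y q)"] by (simp add: norm_mult)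
      also have "\<dots> = s * t" using p elim \<mu> by (simp add: s_def t_def)
      also have "2 * (s * t) \<le> s\<^sup>2 + t\<^sup>2" using sum_squares_bound[of s t] by simp
      then have "s * t \<le> (1/2) * (s\<^sup>2 + t\<^sup>2)" by simp
      also have "s\<^sup>2 = (1 / \<mu>) * (a q * (cmod (Y q))\<^sup>2)" using p by (simp add: s_def power_mult_distrib)
      also have "t\<^sup>2 = \<mu> * ((cmod (X q))\<^sup>2 / a q)" using p by (simp add: t_def power_divide)
      finally show ?case .
    qed
  qed
  also have "\<dots> = (1/2) * ((1 / \<mu>) * (LINT q|haar. a q * (cmod (Y q))\<^sup>2) + \<mu> * (LINT q|haar. (cmod (X q))\<^sup>2 / a q))"
    unfolding integral_mult_right_zero
      Bochner_Integration.integral_add[OF integrable_mult_right[OF i1] integrable_mult_right[OF i2]] ..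
  finally show ?thesis by (simp add: ip_A_l1[OF f] bs_form_def X_def Y_def)
qed

lemma finite_support_approx:
  assumes f: "f \<in> ell2" and t: "t > 0"
  shows "\<exists>d\<in>ell2. n2 d \<le> t\<^sup>2 \<and> (\<lambda>y. cmod (f y - d y)) summable_on UNIV"
proof -
  obtain S where S: "finite S" "n2 (\<lambda>x. if x \<in> S then 0 else f x) < t\<^sup>2"
    using tail_ell2[OF f, of "t\<^sup>2"] t by auto
  have "(\<lambda>y. cmod (f y - (if y \<in> S then 0 else f y))) summable_on UNIV"
    by (rule finite_nonzero_values_imp_summable_on) (rule finite_subset[OF _ S(1)], auto)
  moreover have "(\<lambda>x. if x \<in> S then 0 else f x) \<in> ell2"
    by (rule ell2_le(1)[OF f, of _ 1]) auto
  ultimately show ?thesis using S(2) by (intro bexI[of _ "\<lambda>x. if x \<in> S then 0 else f x"]) auto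
qed

text \<open>Density: finitely supported truncations of \<open>f\<close> are summable, and every term
  depends continuously on \<open>f\<close>. A remainder \<open>d\<close> of norm at most
  \<open>t\<close> costs at most \<open>C * t\<close> in total.\<close>

lemma weighted_duality:
  assumes f: "f \<in> ell2" and h: "h \<in> ell2"
  shows "2 * Re (ip (wmul w h) f) \<le> Re (ip (A f) f) / \<mu> + bs_form w a \<mu> h"
proof -
  define R where "R = Re (ip (A f) f) / \<mu> + bs_form w a \<mu> h"
  define C where "C = 2 * sqrt (n2 (wmul w h)) + (2 * sqrt (n2 (A f)) + sqrt CA) / \<mu>"
  have C: "C \<ge> 0" unfolding C_def using \<mu> n2_nonneg CA_nonneg
    by (intro add_nonneg_nonneg divide_nonneg_nonneg mult_nonneg_nonneg) auto
  note wh = wmul_ell2[OF h]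
  have st: "2 * Re (ip (wmul w h) f) \<le> R + C * t" if t: "0 < t" "t \<le> 1" for t
  proof -
    obtain d where d: "d \<in> ell2" "n2 d \<le> t\<^sup>2" "(\<lambda>y. cmod (f y - d y)) summable_on UNIV"
      using finite_support_approx[OF f t(1)] by blast
    have fd: "(\<lambda>x. f x + of_real (-1) * d x) = (\<lambda>x. f x - d x)" by simp
    have sd: "sqrt (n2 g * n2 d) \<le> sqrt (n2 g) * t" for g :: "int ^ 'd \<Rightarrow> complex"
    proof -
      have "sqrt (n2 d) \<le> t" using d(2) t by (intro real_le_lsqrt) auto
      then show ?thesis unfolding real_sqrt_mult using n2_nonneg by (intro mult_left_mono) auto
    qed
    have "Re (ip (A (\<lambda>x. f x - d x)) (\<lambda>x. f x - d x)) = Re (ip (A f) f) - 2 * Re (ip (A f) d) + Re (ip (A d) d)"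
      using A.form_add[OF f d(1), of "-1"] by (simp add: fd)
    moreover have "\<bar>Re (ip (A f) d)\<bar> \<le> sqrt (n2 (A f)) * t"
      using abs_Re_le_cmod ip_CS[OF A_ell2[OF f] d(1)] sd[of "A f"] by (meson order.trans)
    moreover have "\<bar>Re (ip (A d) d)\<bar> \<le> sqrt CA * t"
    proof -
      have "\<bar>Re (ip (A d) d)\<bar> \<le> sqrt (n2 (A d)) * t"
        using abs_Re_le_cmod ip_CS[OF A_ell2[OF d(1)] d(1)] sd[of "A d"] by (meson order.trans)
      also have "\<dots> \<le> sqrt CA * t"
      proof (intro mult_right_mono real_sqrt_le_mono)
        have "n2 (A d) \<le> CA * t\<^sup>2"
          using A_bound[OF d(1)] mult_left_mono[OF d(2) CA_nonneg] by linarith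
        also have "\<dots> \<le> CA * 1" using t CA_nonneg by (intro mult_left_mono) (auto simp: power_le_one)
        finally show "n2 (A d) \<le> CA" by simp
      qed (use t in auto)
      finally show ?thesis .
    qed
    ultimately have 1: "Re (ip (A (\<lambda>x. f x - d x)) (\<lambda>x. f x - d x)) \<le> Re (ip (A f) f) + (2 * sqrt (n2 (A f)) + sqrt CA) * t"
      by (simp add: algebra_simps)
    have "Re (ip (wmul w h) f) - Re (ip (wmul w h) d) = Re (ip (wmul w h) (\<lambda>x. f x - d x))"
      using ip_diff_right[OF f d(1) wh] by simp
    moreover have "\<bar>Re (ip (wmul w h) d)\<bar> \<le> sqrt (n2 (wmul w h)) * t"
      using abs_Re_le_cmod ip_CS[OF wh d(1)] sd[of "wmul w h"] by (meson order.trans)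
    moreover have "2 * Re (ip (wmul w h) (\<lambda>x. f x - d x)) \<le>
        Re (ip (A (\<lambda>x. f x - d x)) (\<lambda>x. f x - d x)) / \<mu> + bs_form w a \<mu> h"
      by (rule weighted_duality_l1[OF d(3) h])
    moreover have "Re (ip (A (\<lambda>x. f x - d x)) (\<lambda>x. f x - d x)) / \<mu> \<le>
        (Re (ip (A f) f) + (2 * sqrt (n2 (A f)) + sqrt CA) * t) / \<mu>"
      using 1 \<mu> by (intro divide_right_mono) auto
    ultimately show ?thesis unfolding R_def C_def
      by (simp add: algebra_simps add_divide_distrib)
  qed
  have "2 * Re (ip (wmul w h) f) \<le> R"
  proof (rule field_le_epsilon)
    fix r :: real assume r: "r > 0"
    define t where "t = min 1 (r / (C + 1))"
    have "0 < t" "t \<le> 1" using r C by (auto simp: t_def)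
    then have "2 * Re (ip (wmul w h) f) \<le> R + C * t" by (rule st)
    also have "C * t \<le> C * (r / (C + 1))" using C by (intro mult_left_mono) (auto simp: t_def)
    also have "\<dots> \<le> r" using C r by (simp add: field_simps)
    finally show "2 * Re (ip (wmul w h) f) \<le> R + r" by simp
  qed
  then show ?thesis by (simp add: R_def)
qed

text \<open>The duality at \<open>h = 0\<close>, which avoids Plancherel's theorem on all of
  \<open>ell2\<close>.\<close>

lemma A_nonneg: "f \<in> ell2 \<Longrightarrow> Re (ip (A f) f) \<ge> 0"
proof -
  assume f: "f \<in> ell2"
  have "bs_form w a \<mu> (\<lambda>_. 0) \<le> 0" using bs_form_bound[OF ell2_zero] by (simp add: n2_zero)
  moreover have "ip (wmul w (\<lambda>_. 0)) f = 0" by (simp add: ip_def wmul_def)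
  ultimately have "0 \<le> Re (ip (A f) f) / \<mu>" using weighted_duality[OF f ell2_zero] by simp
  then show ?thesis using \<mu> by (simp add: zero_le_divide_iff)
qed

text \<open>For the potential \<open>- w^2\<close> this is the threshold minus the Hamiltonian, so
  its positive directions are the energies below the threshold.\<close>

definition T where "T f = (\<lambda>x. of_real \<mu> * wmul w (wmul w f) x + (- 1) * A f x)"

lemma ww_ell2: "f \<in> ell2 \<Longrightarrow> wmul w (wmul w f) \<in> ell2"
  by (intro wmul_ell2)

lemma T_form: "f \<in> ell2 \<Longrightarrow> Re (ip (T f) f) = \<mu> * n2 (wmul w f) - Re (ip (A f) f)"
  unfolding T_def
  by (simp add: ip_lin_left ww_ell2 A_ell2 ip_wmul[of "wmul w f"] ip_self wmul_ell2 ip_lin_left[where b="- 1", simplified])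

lemma T_ell2: "f \<in> ell2 \<Longrightarrow> T f \<in> ell2"
  unfolding T_def by (intro ell2_lin ww_ell2 A_ell2)

lemma wmul_bound: "f \<in> ell2 \<Longrightarrow> n2 (wmul w f) \<le> W * n2 f"
  using ell2_le(2)[of f "wmul w f" "sqrt W"] W_nonneg
  by (auto simp: wmul_def norm_mult w_bound mult_right_mono)

text \<open>Compactness of multiplication by \<open>w\<close>. Since \<bar>F n x - f x\<bar> is at
  most 2, its square is at most twice itself, and the linear estimate \<open>weak_abs_diff\<close>
  applies with \<open>w^2\<close> as the fixed vector; the norm is then expanded around
  \<open>f\<close>.\<close>

lemma wmul_n2_lim:
  assumes F: "\<And>n. F n \<in> ell2" "\<And>n. n2 (F n) \<le> 1" and lim: "\<And>x. (\<lambda>n. F n x) \<longlonglongrightarrow> f x"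
  shows "(\<lambda>n. n2 (wmul w (F n))) \<longlonglongrightarrow> n2 (wmul w f)"
proof -
  note f = weak_limit_ell2[OF F lim]
  have F1: "cmod (F n x) \<le> 1" for n x
  proof -
    have "(cmod (F n x))\<^sup>2 \<le> 1" using ell2_point[OF F(1)[of n], of x] F(2)[of n] by linarith
    then show ?thesis by (simp add: abs_square_le_1)
  qed
  have f1: "cmod (f x) \<le> 1" for x
  proof -
    have "(cmod (f x))\<^sup>2 \<le> 1" using ell2_point[OF f(1), of x] f(2) by linarith
    then show ?thesis by (simp add: abs_square_le_1)
  qed
  define d where "d = (\<lambda>n x. F n x - f x)"
  have d: "d n \<in> ell2" for n unfolding d_def by (rule ell2_diff[OF F(1) f(1)])
  have ww: "(\<lambda>x. of_real ((w x)\<^sup>2)) \<in> ell2"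
    using wmul_ell2[OF wc_ell2] by (simp add: wmul_def wc_def power2_eq_square)
  have dn: "n2 (wmul w (d n)) \<le> 2 * (\<Sum>\<^sub>\<infinity>x. cmod (of_real ((w x)\<^sup>2)) * cmod (F n x - f x))" for n
  proof -
    have "n2 (wmul w (d n)) \<le> (\<Sum>\<^sub>\<infinity>x. 2 * (cmod (of_real ((w x)\<^sup>2)) * cmod (d n x)))"
      unfolding n2_def
    proof (rule infsum_mono)
      show "(\<lambda>x. (cmod (wmul w (d n) x))\<^sup>2) summable_on UNIV" by (rule ell2_sum[OF wmul_ell2[OF d]])
      show "(\<lambda>x. 2 * (cmod (of_real ((w x)\<^sup>2)) * cmod (d n x))) summable_on UNIV"
        by (intro summable_on_cmult_right ell2_prod[OF ww d])
      fix x
      have "cmod (d n x) \<le> 2" using norm_triangle_ineq4[of "F n x" "f x"] F1[of n x] f1[of x] by (simp add: d_def)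
      then have "(cmod (d n x))\<^sup>2 \<le> 2 * cmod (d n x)" unfolding power2_eq_square by (rule mult_right_mono) simp
      then have "(w x)\<^sup>2 * (cmod (d n x))\<^sup>2 \<le> (w x)\<^sup>2 * (2 * cmod (d n x))" by (rule mult_left_mono) simp
      then show "(cmod (wmul w (d n) x))\<^sup>2 \<le> 2 * (cmod (of_real ((w x)\<^sup>2)) * cmod (d n x))"
        by (simp add: wmul_def norm_mult power_mult_distrib norm_power)
    qed
    then show ?thesis by (simp add: infsum_cmult_right' d_def)
  qed
  have "(\<lambda>n. 2 * (\<Sum>\<^sub>\<infinity>x. cmod (of_real ((w x)\<^sup>2)) * cmod (F n x - f x))) \<longlonglongrightarrow> 2 * 0"
    by (intro tendsto_mult tendsto_const weak_abs_diff[OF ww F lim])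
  then have l0: "(\<lambda>n. 2 * (\<Sum>\<^sub>\<infinity>x. cmod (of_real ((w x)\<^sup>2)) * cmod (F n x - f x))) \<longlonglongrightarrow> 0" by simp
  have ev: "\<forall>\<^sub>F n in sequentially. norm (n2 (wmul w (d n))) \<le> 2 * (\<Sum>\<^sub>\<infinity>x. cmod (of_real ((w x)\<^sup>2)) * cmod (F n x - f x))"
    unfolding real_norm_def abs_of_nonneg[OF n2_nonneg] by (intro always_eventually allI dn)
  have l1: "(\<lambda>n. n2 (wmul w (d n))) \<longlonglongrightarrow> 0" by (rule Lim_null_comparison[OF ev l0])
  have eq: "n2 (wmul w (F n)) = 2 * Re (ip (F n) (wmul w (wmul w f))) - n2 (wmul w f) + n2 (wmul w (d n))" for n
  proof -
    have "n2 (wmul w (d n)) = n2 (wmul w (F n)) - 2 * Re (ip (wmul w (F n)) (wmul w f)) + n2 (wmul w f)"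
      using n2_lin[OF wmul_ell2[OF F(1)] wmul_ell2[OF f(1)], of n "-1"]
      by (simp add: d_def wmul_def right_diff_distrib)
    then show ?thesis by (simp add: ip_wmul)
  qed
  have "(\<lambda>n. 2 * Re (ip (F n) (wmul w (wmul w f))) - n2 (wmul w f) + n2 (wmul w (d n))) \<longlonglongrightarrow>
     2 * Re (ip f (wmul w (wmul w f))) - n2 (wmul w f) + 0"
    by (intro tendsto_add tendsto_diff tendsto_mult tendsto_const tendsto_Re weak_ip[OF ww_ell2[OF f(1)] F lim] l1)
  also have "2 * Re (ip f (wmul w (wmul w f))) - n2 (wmul w f) + 0 = n2 (wmul w f)"
    using arg_cong[OF ip_self[OF wmul_ell2[OF f(1)]], of Re] by (simp add: ip_wmul[of f "wmul w f"])
  finally show ?thesis unfolding eq .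
qed

lemma usc_form_op_T: "usc_form_op l2e T"
proof
  fix f :: "int ^ 'd \<Rightarrow> complex" assume f: "f \<in> l2e"
  then show "f \<in> ell2" by (rule l2e_ell2)
  show "T f \<in> l2e"
  proof (rule l2eI)
    show "T f \<in> ell2" by (rule T_ell2[OF l2e_ell2[OF f]])
    show "T f (- x) = T f x" for x
      by (simp add: T_def A_even[OF f] wmul_even[OF wmul_l2e[OF f]])
  qed
next
  fix f g :: "int ^ 'd \<Rightarrow> complex" and c d assume fg: "f \<in> l2e" "g \<in> l2e"
  then show "(\<lambda>x. c * f x + d * g x) \<in> l2e" by (rule l2e_lin)
  note m = l2e_ell2[OF fg(1)] l2e_ell2[OF fg(2)]
  show "T (\<lambda>x. c * f x + d * g x) = (\<lambda>x. c * T f x + d * T g x)"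
    unfolding T_def wmul_lin A_lin[OF m] by (simp add: algebra_simps)
  have "ip (T f) g = of_real \<mu> * ip (wmul w (wmul w f)) g + (- 1) * ip (A f) g"
    unfolding T_def by (rule ip_lin_left[OF ww_ell2[OF m(1)] A_ell2[OF m(1)] m(2)])
  moreover have "ip f (T g) = cnj (of_real \<mu>) * ip f (wmul w (wmul w g)) + cnj (- 1) * ip f (A g)"
    unfolding T_def by (rule ip_lin_right[OF ww_ell2[OF m(2)] A_ell2[OF m(2)] m(1)])
  ultimately show "ip (T f) g = ip f (T g)"
    using A_herm[OF m] ip_wmul by simp
next
  show "\<exists>C. \<forall>f\<in>l2e. Re (ip (T f) f) \<le> C * n2 f"
  proof (intro exI ballI)
    fix f :: "int ^ 'd \<Rightarrow> complex" assume "f \<in> l2e"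
    then have f: "f \<in> ell2" by (rule l2e_ell2)
    show "Re (ip (T f) f) \<le> (\<mu> * W) * n2 f"
    proof -
      have "\<mu> * n2 (wmul w f) \<le> \<mu> * (W * n2 f)"
        using \<mu> by (intro mult_left_mono wmul_bound f) auto
      then show ?thesis using T_form[OF f] A_nonneg[OF f] unfolding mult.assoc by linarith
    qed
  qed
next
  fix F and f :: "int ^ 'd \<Rightarrow> complex"
  assume "\<And>n. F n \<in> l2e" "\<And>x. (\<lambda>n. F n x) \<longlonglongrightarrow> f x" "f \<in> ell2"
  then show "f \<in> l2e" by (rule l2e_lim)
next
  fix F and f :: "int ^ 'd \<Rightarrow> complex" and l
  assume F: "\<And>n. F n \<in> l2e" "\<And>n. n2 (F n) \<le> 1" "\<And>x. (\<lambda>n. F n x) \<longlonglongrightarrow> f x" "f \<in> l2e"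
    and l: "(\<lambda>n. Re (ip (T (F n)) (F n))) \<longlonglongrightarrow> l"
  note F2 = l2e_ell2[OF F(1)] and f = l2e_ell2[OF F(4)]
  \<comment> \<open>Nonnegativity of the form of \<open>A\<close> at \<open>f - F n\<close> bounds
    minus that form at \<open>F n\<close> by an expression affine in \<open>F n\<close>, which
    passes to weak limits.\<close>
  have le: "Re (ip (T (F n)) (F n)) \<le> \<mu> * n2 (wmul w (F n)) - 2 * Re (cnj (ip (F n) (A f))) + Re (ip (A f) f)" for n
  proof -
    have d: "(\<lambda>x. f x + of_real (-1) * F n x) \<in> ell2" using ell2_lin[OF f F2, of 1 "-1" n] by simp
    have "0 \<le> Re (ip (A f) f) + 2 * (-1) * Re (ip (A f) (F n)) + (-1)\<^sup>2 * Re (ip (A (F n)) (F n))"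
      using A_nonneg[OF d] A.form_add[OF f F2, of "-1" n] by simp
    moreover have "ip (A f) (F n) = cnj (ip (F n) (A f))" by (rule ip_cnj)
    ultimately show ?thesis using T_form[OF F2, of n] by simp
  qed
  have "(\<lambda>n. \<mu> * n2 (wmul w (F n)) - 2 * Re (cnj (ip (F n) (A f))) + Re (ip (A f) f)) \<longlonglongrightarrow>
      \<mu> * n2 (wmul w f) - 2 * Re (cnj (ip f (A f))) + Re (ip (A f) f)"
    by (intro tendsto_add tendsto_diff tendsto_mult tendsto_const tendsto_Re tendsto_cnj
        wmul_n2_lim[OF F2 F(2,3)] weak_ip[OF A_ell2[OF f] F2 F(2,3)])
  from LIMSEQ_le[OF l this] le
  have "l \<le> \<mu> * n2 (wmul w f) - 2 * Re (cnj (ip f (A f))) + Re (ip (A f) f)" by blast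
  moreover have "cnj (ip f (A f)) = ip (A f) f" by (rule ip_cnj[symmetric])
  ultimately show "l \<le> Re (ip (T f) f)" using T_form[OF f] by simp
qed

end

context threshold
begin

text \<open>Form and norm are both diagonal in orthonormal eigenvectors, so a bound on the
  eigenvalues becomes a margin common to all combinations.\<close>

lemma bs_orthonormal:
  fixes m :: nat
  assumes u: "\<And>l. l < m \<Longrightarrow> u l \<in> l2e \<and> B (u l) = (\<lambda>x. of_real (lam l) * u l x) \<and> lam l \<ge> \<theta>"
    and on: "\<And>k l. k < m \<Longrightarrow> l < m \<Longrightarrow> ip (u k) (u l) = (if k = l then 1 else 0)"
  shows "bs_form w a \<mu> (comb {..<m} c u) \<ge> \<theta> * n2 (comb {..<m} c u)"
proof -
  define G where "G = comb {..<m} c u"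
  have e2: "\<And>i. i \<in> {..<m} \<Longrightarrow> u i \<in> ell2" using u l2e_ell2 by auto
  have G: "G \<in> ell2" unfolding G_def by (rule ell2_comb) (use e2 in auto)
  have "B G = comb {..<m} c (\<lambda>i. B (u i))"
    unfolding G_def by (rule lin_comb[of B]) (use e2 B_lin in auto)
  also have "\<dots> = comb {..<m} c (\<lambda>i x. of_real (lam i) * u i x)"
    unfolding comb_def by (intro ext sum.cong refl) (use u in auto)
  finally have BG: "B G = comb {..<m} c (\<lambda>i x. of_real (lam i) * u i x)" .
  have "of_real (bs_form w a \<mu> G) = ip (B G) G" using bs_form_eq[OF G] by simp
  also have "\<dots> = (\<Sum>i<m. c i * ip (\<lambda>x. of_real (lam i) * u i x) G)"
    unfolding BG by (rule ip_comb_left) (use e2 ell2_scale G in auto)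
  also have "\<dots> = (\<Sum>i<m. of_real (lam i * (cmod (c i))\<^sup>2))"
  proof (rule sum.cong[OF refl])
    fix i assume i: "i \<in> {..<m}"
    have "ip (u i) G = (\<Sum>j<m. cnj (c j) * ip (u i) (u j))"
      unfolding G_def by (rule ip_comb_right) (use e2 i in auto)
    also have "\<dots> = (\<Sum>j<m. if i = j then cnj (c j) else 0)" by (rule sum.cong) (use on i in auto)
    also have "\<dots> = cnj (c i)" using i by simp
    finally show "c i * ip (\<lambda>x. of_real (lam i) * u i x) G = of_real (lam i * (cmod (c i))\<^sup>2)"
      unfolding ip_scale_left of_real_mult complex_norm_square by simp
  qed
  also have "\<dots> = of_real (\<Sum>i<m. lam i * (cmod (c i))\<^sup>2)" by simp
  finally have 1: "bs_form w a \<mu> G = (\<Sum>i<m. lam i * (cmod (c i))\<^sup>2)" using of_real_eq_iff by blast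
  have "n2 G = (\<Sum>i<m. (cmod (c i))\<^sup>2)"
    unfolding G_def by (rule n2_comb_orthonormal) (use e2 on in auto)
  then have "\<theta> * n2 G \<le> bs_form w a \<mu> G"
    unfolding 1 by (simp add: sum_distrib_left) (intro sum_mono mult_right_mono, use u in auto)
  then show ?thesis by (simp add: G_def)
qed

lemma bs_eigenvectors_above:
  fixes m :: nat
  assumes g: "\<And>i. i < m \<Longrightarrow> g i \<in> l2e" and \<theta>: "\<theta> \<ge> 0"
    and p: "\<And>c. \<exists>i<m. c i \<noteq> 0 \<Longrightarrow> bs_form w a \<mu> (comb {..<m} c g) > \<theta> * n2 (comb {..<m} c g)"
  shows "\<exists>u lam. (\<forall>l<m. u l \<in> l2e \<and> B (u l) = (\<lambda>x. of_real (lam l) * u l x) \<and> lam l > \<theta>) \<and>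
     (\<forall>k<m. \<forall>l<m. ip (u k) (u l) = (if k = l then 1 else 0))"
proof -
  interpret usc_form_op l2e B by (rule usc_form_op_B)
  show ?thesis
  proof (rule exists_eigenvectors_above[of "{..<m}" g \<theta> m])
    fix c :: "nat \<Rightarrow> complex" assume c: "\<exists>i\<in>{..<m}. c i \<noteq> 0"
    have "comb {..<m} c g \<in> ell2" by (rule ell2_comb) (use g l2e_ell2 in auto)
    then show "\<theta> * n2 (comb {..<m} c g) < Re (ip (B (comb {..<m} c g)) (comb {..<m} c g))"
      using p[of c] c by (auto simp: bs_form_eq)
  qed (use g \<theta> in auto)
qed

end

context lattice_ham
begin

text \<open>
  At the threshold \<open>A\<^bsup>-1\<^esup> w g\<close> need not be square-summable; \<open>reg \<delta> g\<close> is \<open>(A + \<delta>)\<^bsup>-1\<^esup> w g\<close>.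
\<close>

definition reg where "reg \<delta> g = fc (\<lambda>q. ft (wmul w g) q / of_real (a q + \<delta>))"

lemma reg_integrand:
  assumes "\<delta> > 0" "g \<in> ell2"
  shows "(\<lambda>q. ft (wmul w g) q / of_real (a q + \<delta>)) \<in> borel_measurable borel"
    and "cmod (ft (wmul w g) q / of_real (a q + \<delta>)) \<le> sqrt (W * n2 g) / \<delta>"
    and "integrable haar (\<lambda>q. ft (wmul w g) q / of_real (a q + \<delta>))"
proof -
  show m: "(\<lambda>q. ft (wmul w g) q / of_real (a q + \<delta>)) \<in> borel_measurable borel"
    using ft_wmul_measurable[OF assms(2)] a_meas by simp
  have b: "cmod (ft (wmul w g) q / of_real (a q + \<delta>)) \<le> sqrt (W * n2 g) / \<delta>" for q
    unfolding norm_divide norm_of_real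
    using ft_wmul_bound[OF assms(2), of q] a_nonneg[of q] assms(1) W_nonneg n2_nonneg[of g]
    by (intro frac_le) auto
  then show "cmod (ft (wmul w g) q / of_real (a q + \<delta>)) \<le> sqrt (W * n2 g) / \<delta>" .
  show "integrable haar (\<lambda>q. ft (wmul w g) q / of_real (a q + \<delta>))"
    by (rule haar_integrable_bounded[OF m b])
qed

lemma reg_ell2: "\<delta> > 0 \<Longrightarrow> g \<in> ell2 \<Longrightarrow> reg \<delta> g \<in> ell2"
  unfolding reg_def by (rule bessel) (rule reg_integrand; assumption)+

lemma reg_l2e: "\<delta> > 0 \<Longrightarrow> g \<in> l2e \<Longrightarrow> reg \<delta> g \<in> l2e"
proof (rule l2eI)
  assume d: "\<delta> > 0" and g: "g \<in> l2e"
  show "reg \<delta> g \<in> ell2" by (rule reg_ell2[OF d l2e_ell2[OF g]])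
  show "reg \<delta> g (- x) = reg \<delta> g x" for x
    unfolding reg_def
    by (rule fc_even[OF reg_integrand(1)[OF d l2e_ell2[OF g]]])
       (simp add: a_even ft_even wmul_even[OF g])
qed

lemma reg_lin:
  assumes "\<delta> > 0" "f \<in> ell2" "g \<in> ell2"
  shows "reg \<delta> (\<lambda>x. c * f x + d * g x) = (\<lambda>x. c * reg \<delta> f x + d * reg \<delta> g x)"
proof -
  have "(\<lambda>q. ft (wmul w (\<lambda>x. c * f x + d * g x)) q / of_real (a q + \<delta>)) =
     (\<lambda>q. c * (ft (wmul w f) q / of_real (a q + \<delta>)) + d * (ft (wmul w g) q / of_real (a q + \<delta>)))"
    unfolding wmul_lin using ft_lin[OF wmul_summable[OF assms(2)] wmul_summable[OF assms(3)]]
    by (simp add: add_divide_distrib)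
  then show ?thesis unfolding reg_def
    using fc_lin[OF reg_integrand(3)[OF assms(1,2)] reg_integrand(3)[OF assms(1,3)]] by auto
qed

lemma A_reg:
  assumes d: "\<delta> > 0" and g: "g \<in> ell2"
  shows "A (reg \<delta> g) = (\<lambda>x. wmul w g x - of_real \<delta> * reg \<delta> g x)"
proof
  fix x
  define F where "F = (\<lambda>q. ft (wmul w g) q / of_real (a q + \<delta>))"
  have F: "integrable haar F" unfolding F_def by (rule reg_integrand(3)[OF d g])
  have eq: "of_real (a q) * F q = 1 * ft (wmul w g) q + of_real (- \<delta>) * F q" for q
  proof -
    have "a q + \<delta> \<noteq> 0" using a_nonneg[of q] d by linarith
    then have "complex_of_real (a q + \<delta>) \<noteq> 0" by (simp only: of_real_eq_0_iff not_False_eq_True)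
    then have "of_real (a q + \<delta>) * F q = ft (wmul w g) q" by (simp add: F_def)
    then show ?thesis by (simp add: algebra_simps)
  qed
  have "A (reg \<delta> g) x = fc (\<lambda>q. of_real (a q) * F q) x"
    unfolding reg_def F_def[symmetric] by (rule A_fc[OF F])
  also have "\<dots> = 1 * fc (ft (wmul w g)) x + of_real (- \<delta>) * fc F x"
    unfolding eq by (rule fc_lin[OF ft_int[OF wmul_summable[OF g]] F])
  finally show "A (reg \<delta> g) x = wmul w g x - of_real \<delta> * reg \<delta> g x"
    by (simp add: fc_ft[OF wmul_summable[OF g]] reg_def F_def)
qed

lemma ip_reg:
  assumes d: "\<delta> > 0" and g: "g \<in> ell2"
  shows "ip (reg \<delta> g) (wmul w g) = of_real (bs_form w (\<lambda>q. a q + \<delta>) \<mu> g / \<mu>)"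
proof -
  have "ip (reg \<delta> g) (wmul w g) = (LINT q|haar. ft (wmul w g) q / of_real (a q + \<delta>) * cnj (ft (wmul w g) q))"
    unfolding reg_def by (rule parseval_exchange[OF wmul_summable[OF g] reg_integrand(3)[OF d g]])
  also have "\<dots> = (LINT q|haar. of_real ((cmod (ft (wmul w g) q))\<^sup>2 / (a q + \<delta>)))"
    unfolding of_real_divide complex_norm_square by simp
  finally show ?thesis using \<mu> by (simp only: integral_complex_of_real bs_form_def) simp
qed

text \<open>Let \<open>f = reg \<delta> g\<close> and let \<open>y\<close> be the pairing of
  \<open>w g\<close> with \<open>f\<close>. The equation for \<open>f\<close> gives
  \<open>Re (ip (A f) f) \<le> y\<close>, and Cauchy-Schwarz gives
  \<open>y^2 \<le> n2 g * n2 (wmul w f)\<close>. As \<open>y > n2 g / \<mu>\<close> by hypothesis,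
  the potential term exceeds \<open>y\<close>.\<close>

lemma T_reg_pos:
  assumes d: "\<delta> > 0" and g: "g \<in> ell2" and b: "bs_form w (\<lambda>q. a q + \<delta>) \<mu> g > n2 g"
  shows "Re (ip (T (reg \<delta> g)) (reg \<delta> g)) > 0"
proof -
  define f where "f = reg \<delta> g"
  define y where "y = bs_form w (\<lambda>q. a q + \<delta>) \<mu> g / \<mu>"
  define N where "N = n2 (wmul w f)"
  have f: "f \<in> ell2" unfolding f_def by (rule reg_ell2[OF d g])
  note wg = wmul_ell2[OF g]
  have y1: "ip (wmul w g) f = of_real y"
    using ip_reg[OF d g] ip_cnj[of "wmul w g" f] by (simp add: f_def y_def)
  have y0: "y > n2 g / \<mu>" "y > 0"
    using b \<mu> n2_nonneg[of g] by (auto simp: y_def divide_strict_right_mono)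
  have "ip (A f) f = ip (\<lambda>x. wmul w g x - of_real \<delta> * f x) f"
    unfolding f_def A_reg[OF d g] ..
  also have "\<dots> = ip (wmul w g) f - ip (\<lambda>x. of_real \<delta> * f x) f"
    by (rule ip_diff_left[OF wg ell2_scale[OF f] f])
  also have "\<dots> = of_real (y - \<delta> * n2 f)"
    unfolding ip_scale_left ip_self[OF f] y1 by simp
  finally have "Re (ip (A f) f) = y - \<delta> * n2 f" by simp
  moreover have "\<delta> * n2 f \<ge> 0" using d n2_nonneg[of f] by simp
  ultimately have D: "Re (ip (A f) f) \<le> y" by simp
  have "y \<le> sqrt (n2 g * N)"
    using ip_CS[OF g wmul_ell2[OF f]] y1 y0 unfolding ip_wmul N_def by simp
  then have "y\<^sup>2 \<le> (sqrt (n2 g * N))\<^sup>2" using y0 by (intro power_mono) auto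
  then have y2: "y\<^sup>2 \<le> n2 g * N" using n2_nonneg[of g] n2_nonneg[of "wmul w f"] by (simp add: N_def)
  have "\<mu> * N > y"
  proof (rule ccontr)
    assume "\<not> \<mu> * N > y"
    then have "N \<le> y / \<mu>" using \<mu> by (simp add: field_simps)
    then have "n2 g * N \<le> n2 g * (y / \<mu>)" using n2_nonneg by (rule mult_left_mono)
    also have "\<dots> < y * y" using mult_strict_right_mono[OF y0(1) y0(2)] by simp
    finally show False using y2 by (simp add: power2_eq_square)
  qed
  then show ?thesis using T_form[OF f] D unfolding f_def[symmetric] N_def by simp
qed

text \<open>Dominated convergence along \<delta> = 1 / (n + 1), with \<open>1 / a\<close> itself as
  majorant.\<close>

lemma reg_approx:
  assumes "r > 0"
  shows "\<exists>\<delta>>0. (LINT q|haar. \<bar>1 / a q - 1 / (a q + \<delta>)\<bar>) < r"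
proof -
  define s where "s = (\<lambda>n q. \<bar>1 / a q - 1 / (a q + 1 / real (Suc n))\<bar>)"
  have "(\<lambda>n. LINT q|haar. s n q) \<longlonglongrightarrow> (LINT q|(haar :: (real ^ 'd) measure). 0)"
  proof (rule integral_dominated_convergence)
    show "integrable haar (\<lambda>q. 1 / a q)" by (rule a_inv)
    show "(\<lambda>q. 0) \<in> borel_measurable (haar :: (real ^ 'd) measure)" by simp
    have "(\<lambda>q. \<bar>1 / a q - 1 / (a q + t)\<bar>) \<in> borel_measurable borel" for t
      using a_meas by simp
    then show "s n \<in> borel_measurable haar" for n unfolding s_def by (intro haar_measurable)
    show "AE q in haar. (\<lambda>n. s n q) \<longlonglongrightarrow> 0"
      using a_pos
    proof eventually_elim
      case (elim q)
      have "(\<lambda>n. 1 / (a q + 1 / real (Suc n))) \<longlonglongrightarrow> 1 / (a q + 0)"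
        using elim LIMSEQ_inverse_real_of_nat
        by (intro tendsto_divide tendsto_add tendsto_const) (auto simp: inverse_eq_divide)
      then have "(\<lambda>n. \<bar>1 / a q - 1 / (a q + 1 / real (Suc n))\<bar>) \<longlonglongrightarrow> \<bar>1 / a q - 1 / (a q + 0)\<bar>"
        by (intro tendsto_rabs tendsto_diff tendsto_const)
      then show ?case by (simp add: s_def)
    qed
    show "AE q in haar. norm (s n q) \<le> 1 / a q" for n
      using a_pos
    proof eventually_elim
      case (elim q)
      have "0 \<le> 1 / (a q + 1 / real (Suc n))" "1 / (a q + 1 / real (Suc n)) \<le> 1 / a q"
        using elim by (auto intro!: frac_le)
      then show ?case by (simp add: s_def)
    qed
  qed
  then have "(\<lambda>n. LINT q|haar. s n q) \<longlonglongrightarrow> 0" by simp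
  then obtain N where "\<forall>n\<ge>N. norm ((LINT q|haar. s n q) - 0) < r" using assms LIMSEQ_D by blast
  then have "(LINT q|haar. s N q) < r" by fastforce
  then show ?thesis by (intro exI[of _ "1 / real (Suc N)"]) (simp add: s_def)
qed

text \<open>To the right a family is multiplied by \<open>w\<close>; to the left it is mapped by
  \<open>reg \<delta>\<close>. Square-summability asks for \<delta> > 0, and \<delta> has to be
  small against the margin by which the form exceeds the norm, hence the passage to eigenvectors in
  that direction.\<close>

theorem birman_schwinger:
  "positive_family (\<lambda>f. Re (ip (T f) f)) m \<longleftrightarrow> positive_family (\<lambda>g. bs_form w a \<mu> g - n2 g) m"
proof
  assume "positive_family (\<lambda>f. Re (ip (T f) f)) m"
  then obtain g where g: "\<forall>i<m. g i \<in> l2e"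
    "\<And>c. \<exists>i<m. c i \<noteq> 0 \<Longrightarrow> Re (ip (T (comb {..<m} c g)) (comb {..<m} c g)) > 0"
    unfolding positive_family_def by blast
  show "positive_family (\<lambda>g. bs_form w a \<mu> g - n2 g) m"
    unfolding positive_family_def
  proof (intro exI conjI allI impI)
    show "wmul w (g i) \<in> l2e" if "i < m" for i using g(1) that wmul_l2e by blast
    fix c :: "nat \<Rightarrow> complex" assume c: "\<exists>i<m. c i \<noteq> 0"
    define f where "f = comb {..<m} c g"
    have f: "f \<in> ell2" unfolding f_def by (rule ell2_comb) (use g(1) l2e_ell2 in auto)
    have "Re (ip (A f) f) < \<mu> * n2 (wmul w f)" using g(2)[OF c] T_form[OF f] by (simp add: f_def)
    then have "Re (ip (A f) f) / \<mu> < n2 (wmul w f)" using \<mu> by (simp add: field_simps)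
    \<comment> \<open>At \<open>h = w f\<close> the left side is twice the squared norm of
      \<open>w f\<close>; one of the two copies absorbs the kinetic term.\<close>
    moreover have "2 * Re (ip (wmul w (wmul w f)) f) \<le> Re (ip (A f) f) / \<mu> + bs_form w a \<mu> (wmul w f)"
      by (rule weighted_duality[OF f wmul_ell2[OF f]])
    moreover have "Re (ip (wmul w (wmul w f)) f) = n2 (wmul w f)"
      using arg_cong[OF ip_self[OF wmul_ell2[OF f]], of Re] by (simp add: ip_wmul[of "wmul w f" f])
    ultimately show "0 < bs_form w a \<mu> (comb {..<m} c (\<lambda>i. wmul w (g i))) - n2 (comb {..<m} c (\<lambda>i. wmul w (g i)))"
      unfolding wmul_comb[symmetric] f_def[symmetric] by linarith
  qed
next
  assume "positive_family (\<lambda>g. bs_form w a \<mu> g - n2 g) m"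
  then obtain g where g: "\<And>i. i < m \<Longrightarrow> g i \<in> l2e"
    "\<And>c. \<exists>i<m. c i \<noteq> 0 \<Longrightarrow> bs_form w a \<mu> (comb {..<m} c g) - n2 (comb {..<m} c g) > 0"
    unfolding positive_family_def by blast
  have "\<exists>u lam. (\<forall>l<m. u l \<in> l2e \<and> B (u l) = (\<lambda>x. of_real (lam l) * u l x) \<and> lam l > 1) \<and>
     (\<forall>k<m. \<forall>l<m. ip (u k) (u l) = (if k = l then 1 else 0))"
    by (rule bs_eigenvectors_above[of m g 1]) (use g in auto)
  then obtain u lam where u: "\<And>l. l < m \<Longrightarrow> u l \<in> l2e \<and> B (u l) = (\<lambda>x. of_real (lam l) * u l x) \<and> lam l > 1"
    and on: "\<And>k l. k < m \<Longrightarrow> l < m \<Longrightarrow> ip (u k) (u l) = (if k = l then 1 else 0)"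
    by blast
  \<comment> \<open>The margin by which the finitely many eigenvalues exceed 1; the inserted 2 keeps
    the minimum defined for \<open>m = 0\<close>.\<close>
  define r where "r = Min (insert 2 (lam ` {..<m})) - 1"
  have r: "r > 0" unfolding r_def using u by (simp add: Min_gr_iff)
  have er: "u l \<in> l2e \<and> B (u l) = (\<lambda>x. of_real (lam l) * u l x) \<and> lam l \<ge> 1 + r" if "l < m" for l
    using u[OF that] that by (auto simp: r_def intro!: Min_le)
  define C where "C = \<mu> * W + 1"
  have C: "C > 0" using \<mu> W_nonneg by (simp add: C_def add_nonneg_pos)
  obtain \<delta> where d: "\<delta> > 0" "(LINT q|haar. \<bar>1 / a q - 1 / (a q + \<delta>)\<bar>) < r / C"
    using reg_approx[of "r / C"] r C by auto
  show "positive_family (\<lambda>f. Re (ip (T f) f)) m"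
    unfolding positive_family_def
  proof (intro exI conjI allI impI)
    show "reg \<delta> (u i) \<in> l2e" if "i < m" for i using u[OF that] reg_l2e[OF d(1)] by blast
    fix c :: "nat \<Rightarrow> complex" assume c: "\<exists>i<m. c i \<noteq> 0"
    define G where "G = comb {..<m} c u"
    have e2: "\<And>i. i \<in> {..<m} \<Longrightarrow> u i \<in> ell2" using u l2e_ell2 by auto
    have G: "G \<in> ell2" unfolding G_def by (rule ell2_comb) (use e2 in auto)
    have regG: "comb {..<m} c (\<lambda>i. reg \<delta> (u i)) = reg \<delta> G"
      unfolding G_def by (rule lin_comb[of "reg \<delta>", symmetric]) (use e2 reg_lin[OF d(1)] in auto)
    have "n2 G = (\<Sum>i<m. (cmod (c i))\<^sup>2)"
      unfolding G_def by (rule n2_comb_orthonormal) (use e2 on in auto)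
    moreover obtain i where "i < m" "c i \<noteq> 0" using c by blast
    ultimately have nG: "n2 G > 0" by (auto intro!: sum_pos2[of _ i])
    have m': "(\<lambda>q. a q + \<delta>) \<in> borel_measurable borel" using a_meas by simp
    have i': "integrable haar (\<lambda>q. 1 / (a q + \<delta>))"
      by (rule haar_integrable_bounded[where C="1 / \<delta>"])
         (use a_meas a_nonneg d(1) in \<open>auto intro!: frac_le simp: abs_of_nonneg add_nonneg_nonneg\<close>)
    have "bs_form w a \<mu> G - bs_form w (\<lambda>q. a q + \<delta>) \<mu> G \<le>
        \<mu> * W * (LINT q|haar. \<bar>1 / a q - 1 / (a q + \<delta>)\<bar>) * n2 G"
      using bs_form_diff[OF G a_meas a_inv m' i', of \<mu>] \<mu> by simp
    also have "\<dots> < r * n2 G"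
    proof (rule mult_strict_right_mono[OF _ nG])
      have "\<mu> * W * (LINT q|haar. \<bar>1 / a q - 1 / (a q + \<delta>)\<bar>) \<le> \<mu> * W * (r / C)"
        using d(2) \<mu> W_nonneg by (intro mult_left_mono) auto
      also have "\<dots> < C * (r / C)"
        using r C by (intro mult_strict_right_mono) (auto simp: C_def)
      finally show "\<mu> * W * (LINT q|haar. \<bar>1 / a q - 1 / (a q + \<delta>)\<bar>) < r" using C by simp
    qed
    finally have "bs_form w a \<mu> G - bs_form w (\<lambda>q. a q + \<delta>) \<mu> G < r * n2 G" .
    moreover have "bs_form w a \<mu> G \<ge> (1 + r) * n2 G"
      unfolding G_def by (rule bs_orthonormal[of m u lam]) (use er on in auto)
    ultimately have "bs_form w (\<lambda>q. a q + \<delta>) \<mu> G > n2 G" by (simp add: algebra_simps)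
    from T_reg_pos[OF d(1) G this]
    show "0 < Re (ip (T (comb {..<m} c (\<lambda>i. reg \<delta> (u i)))) (comb {..<m} c (\<lambda>i. reg \<delta> (u i))))"
      unfolding regG .
  qed
qed

end

section \<open>Nondegenerate minima\<close>

definition twice_diff :: "(real ^ 'd \<Rightarrow> real) \<Rightarrow> bool"
  where "twice_diff g \<longleftrightarrow> g differentiable_on UNIV \<and> (\<forall>i. partial_deriv i g differentiable_on UNIV) \<and>
    (\<forall>i j. continuous_on UNIV (partial_deriv j (partial_deriv i g)))"

text \<open>The quadratic form of the Hessian, nested in the way two successive derivatives along a
  line produce it.\<close>

definition quad :: "(real ^ 'd \<Rightarrow> real) \<Rightarrow> real ^ 'd \<Rightarrow> real ^ 'd \<Rightarrow> real"
  where "quad g p u = (\<Sum>i\<in>UNIV. u $ i * (\<Sum>j\<in>UNIV. u $ j * partial_deriv j (partial_deriv i g) p))"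

lemma Ck3_twice_diff: "Ck 3 g \<Longrightarrow> twice_diff g"
  by (auto simp: twice_diff_def numeral_3_eq_3 intro: differentiable_imp_continuous_on)

section \<open>Derivatives along lines and symmetry of the Hessian\<close>

lemma line_deriv:
  fixes g :: "real ^ 'd \<Rightarrow> real"
  assumes "g differentiable_on UNIV"
  shows "((\<lambda>t. g (x + t *\<^sub>R u)) has_real_derivative (\<Sum>i\<in>UNIV. u $ i * partial_deriv i g (x + t *\<^sub>R u))) (at t)"
proof -
  define y where "y = x + t *\<^sub>R u"
  define D where "D = frechet_derivative g (at y)"
  have gD: "(g has_derivative D) (at y)"
    using assms by (auto simp: D_def differentiable_on_def frechet_derivative_works[symmetric])
  then have lin: "linear D" by (rule has_derivative_linear)
  have "((\<lambda>t. x + t *\<^sub>R u) has_derivative (\<lambda>s. s *\<^sub>R u)) (at t)"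
    by (auto intro!: derivative_eq_intros)
  then have "((\<lambda>t. g (x + t *\<^sub>R u)) has_derivative (\<lambda>s. D (s *\<^sub>R u))) (at t)"
    by (rule has_derivative_compose) (use gD y_def in simp)
  moreover have "D (s *\<^sub>R u) = (\<Sum>i\<in>UNIV. u $ i * partial_deriv i g y) * s" for s
  proof -
    have "D u = D (\<Sum>i\<in>UNIV. (u $ i) *\<^sub>R axis i 1)"
      using basis_expansion[of u] by (simp add: scalar_mult_eq_scaleR)
    also have "\<dots> = (\<Sum>i\<in>UNIV. u $ i * D (axis i 1))"
      by (simp add: linear_sum[OF lin] linear_cmul[OF lin])
    finally have "D u = (\<Sum>i\<in>UNIV. u $ i * partial_deriv i g y)"
      by (simp add: partial_deriv_def D_def)
    then show ?thesis by (simp add: linear_cmul[OF lin])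
  qed
  ultimately show ?thesis by (simp add: has_field_derivative_def y_def)
qed

lemma line_deriv2:
  assumes "twice_diff g"
  shows "((\<lambda>t. \<Sum>i\<in>UNIV. u $ i * partial_deriv i g (x + t *\<^sub>R u)) has_real_derivative quad g (x + t *\<^sub>R u) u) (at t)"
  unfolding quad_def
  by (intro DERIV_sum DERIV_cmult line_deriv) (use assms in \<open>auto simp: twice_diff_def\<close>)

lemma sum_axis: "(\<Sum>j\<in>UNIV. axis i (1::real) $ j * h j) = h i"
proof -
  have "axis i (1::real) $ j * h j = (if j = i then h j else 0)" for j by (simp add: axis_def)
  then show ?thesis by simp
qed

lemma partial_deriv_axis:
  fixes g :: "real ^ 'd \<Rightarrow> real"
  assumes "g differentiable_on UNIV"
  shows "((\<lambda>t. g (x + t *\<^sub>R axis i 1)) has_real_derivative partial_deriv i g (x + t *\<^sub>R axis i 1)) (at t)"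
proof -
  have "(\<Sum>j\<in>UNIV. axis i 1 $ j * partial_deriv j g (x + t *\<^sub>R axis i 1)) = partial_deriv i g (x + t *\<^sub>R axis i 1)"
    by (rule sum_axis)
  then show ?thesis using line_deriv[OF assms, of x "axis i 1" t] by simp
qed

text \<open>Two mean value theorems, along axis \<open>i\<close> and then along axis
  \<open>j\<close>. As the second difference is symmetric in \<open>i\<close> and \<open>j\<close>,
  small \<open>h\<close> then yields Schwarz's theorem.\<close>

lemma mixed_difference:
  fixes g :: "real ^ 'd \<Rightarrow> real"
  assumes g: "twice_diff g" and h: "h > 0"
  shows "\<exists>s t. 0 < s \<and> s < h \<and> 0 < t \<and> t < h \<and>
    g (p + h *\<^sub>R axis i 1 + h *\<^sub>R axis j 1) - g (p + h *\<^sub>R axis i 1) - g (p + h *\<^sub>R axis j 1) + g p =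
    h\<^sup>2 * partial_deriv j (partial_deriv i g) (p + s *\<^sub>R axis i 1 + t *\<^sub>R axis j 1)"
proof -
  have d: "g differentiable_on UNIV" "partial_deriv i g differentiable_on UNIV"
    using g by (auto simp: twice_diff_def)
  define \<phi> where "\<phi> = (\<lambda>s. g ((p + h *\<^sub>R axis j 1) + s *\<^sub>R axis i 1) - g (p + s *\<^sub>R axis i 1))"
  have "(\<phi> has_real_derivative partial_deriv i g ((p + h *\<^sub>R axis j 1) + s *\<^sub>R axis i 1) - partial_deriv i g (p + s *\<^sub>R axis i 1)) (at s)" for s
    unfolding \<phi>_def by (intro DERIV_diff partial_deriv_axis d)
  then obtain s where s: "0 < s" "s < h" and
    1: "\<phi> h - \<phi> 0 = (h - 0) * (partial_deriv i g ((p + h *\<^sub>R axis j 1) + s *\<^sub>R axis i 1) - partial_deriv i g (p + s *\<^sub>R axis i 1))"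
    using MVT2[OF h, of \<phi> "\<lambda>s. partial_deriv i g ((p + h *\<^sub>R axis j 1) + s *\<^sub>R axis i 1) - partial_deriv i g (p + s *\<^sub>R axis i 1)"]
    by blast
  define \<psi> where "\<psi> = (\<lambda>t. partial_deriv i g ((p + s *\<^sub>R axis i 1) + t *\<^sub>R axis j 1))"
  have "(\<psi> has_real_derivative partial_deriv j (partial_deriv i g) ((p + s *\<^sub>R axis i 1) + t *\<^sub>R axis j 1)) (at t)" for t
    unfolding \<psi>_def by (intro partial_deriv_axis d)
  then obtain t where t: "0 < t" "t < h" and
    2: "\<psi> h - \<psi> 0 = (h - 0) * partial_deriv j (partial_deriv i g) ((p + s *\<^sub>R axis i 1) + t *\<^sub>R axis j 1)"
    using MVT2[OF h, of \<psi> "\<lambda>t. partial_deriv j (partial_deriv i g) ((p + s *\<^sub>R axis i 1) + t *\<^sub>R axis j 1)"]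
    by blast
  have "\<phi> h - \<phi> 0 = h * (\<psi> h - \<psi> 0)" using 1 by (simp add: \<psi>_def add_ac)
  then have "\<phi> h - \<phi> 0 = h\<^sup>2 * partial_deriv j (partial_deriv i g) (p + s *\<^sub>R axis i 1 + t *\<^sub>R axis j 1)"
    unfolding 2 by (simp add: power2_eq_square)
  moreover have "\<phi> h - \<phi> 0 = g (p + h *\<^sub>R axis i 1 + h *\<^sub>R axis j 1) - g (p + h *\<^sub>R axis i 1) - g (p + h *\<^sub>R axis j 1) + g p"
    by (simp add: \<phi>_def add_ac)
  ultimately show ?thesis using s t by metis
qed

lemma mixed_partials_commute:
  fixes g :: "real ^ 'd \<Rightarrow> real"
  assumes g: "twice_diff g"
  shows "partial_deriv j (partial_deriv i g) p = partial_deriv i (partial_deriv j g) p"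
proof (rule ccontr)
  define F where "F = partial_deriv j (partial_deriv i g)"
  define G where "G = partial_deriv i (partial_deriv j g)"
  assume "partial_deriv j (partial_deriv i g) p \<noteq> partial_deriv i (partial_deriv j g) p"
  then have ne: "\<bar>F p - G p\<bar> / 2 > 0" by (simp add: F_def G_def)
  have "isCont F p" "isCont G p"
    using g by (auto simp: twice_diff_def F_def G_def continuous_on_eq_continuous_at)
  then obtain r1 r2 where r1: "r1 > 0" "\<And>x. dist x p < r1 \<Longrightarrow> dist (F x) (F p) < \<bar>F p - G p\<bar> / 2"
    and r2: "r2 > 0" "\<And>x. dist x p < r2 \<Longrightarrow> dist (G x) (G p) < \<bar>F p - G p\<bar> / 2"
    using ne unfolding continuous_at_eps_delta by metis
  define h where "h = min r1 r2 / 2"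
  have h: "h > 0" "2 * h \<le> r1" "2 * h \<le> r2" using r1(1) r2(1) by (auto simp: h_def)
  have near: "dist (p + s *\<^sub>R axis i' 1 + t *\<^sub>R axis j' 1) p < 2 * h" if "0 < s" "s < h" "0 < t" "t < h"
    for s t :: real and i' j' :: 'd
  proof -
    have "dist (p + s *\<^sub>R axis i' 1 + t *\<^sub>R axis j' 1) p = norm (s *\<^sub>R axis i' (1::real) + t *\<^sub>R axis j' 1)"
      by (simp add: dist_norm)
    also have "\<dots> \<le> s + t" using norm_triangle_ineq[of "s *\<^sub>R axis i' (1::real)" "t *\<^sub>R axis j' 1"] that
      by (simp add: norm_axis_1)
    finally show ?thesis using that by simp
  qed
  obtain s t where st: "0 < s" "s < h" "0 < t" "t < h"
    "g (p + h *\<^sub>R axis i 1 + h *\<^sub>R axis j 1) - g (p + h *\<^sub>R axis i 1) - g (p + h *\<^sub>R axis j 1) + g p =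
    h\<^sup>2 * F (p + s *\<^sub>R axis i 1 + t *\<^sub>R axis j 1)"
    using mixed_difference[OF g h(1), of p i j] unfolding F_def by blast
  obtain s' t' where st': "0 < s'" "s' < h" "0 < t'" "t' < h"
    "g (p + h *\<^sub>R axis j 1 + h *\<^sub>R axis i 1) - g (p + h *\<^sub>R axis j 1) - g (p + h *\<^sub>R axis i 1) + g p =
    h\<^sup>2 * G (p + s' *\<^sub>R axis j 1 + t' *\<^sub>R axis i 1)"
    using mixed_difference[OF g h(1), of p j i] unfolding G_def by blast
  have "h\<^sup>2 * F (p + s *\<^sub>R axis i 1 + t *\<^sub>R axis j 1) = h\<^sup>2 * G (p + s' *\<^sub>R axis j 1 + t' *\<^sub>R axis i 1)"
  proof -
    have "p + h *\<^sub>R axis j 1 + h *\<^sub>R axis i 1 = p + h *\<^sub>R axis i 1 + h *\<^sub>R axis j (1::real)"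
      by (simp add: add_ac)
    then show ?thesis using st(5) st'(5) by (simp only:)
  qed
  then have "F (p + s *\<^sub>R axis i 1 + t *\<^sub>R axis j 1) = G (p + s' *\<^sub>R axis j 1 + t' *\<^sub>R axis i 1)"
    using h by simp
  moreover have "dist (F (p + s *\<^sub>R axis i 1 + t *\<^sub>R axis j 1)) (F p) < \<bar>F p - G p\<bar> / 2"
    by (rule r1(2)) (use near[OF st(1-4), of i j] h in linarith)
  moreover have "dist (G (p + s' *\<^sub>R axis j 1 + t' *\<^sub>R axis i 1)) (G p) < \<bar>F p - G p\<bar> / 2"
    by (rule r2(2)) (use near[OF st'(1-4), of j i] h in linarith)
  ultimately show False by (simp add: dist_real_def abs_if split: if_splits)
qed

text \<open>One-sided in \<open>t\<close>, so that it also applies to a minimum on the boundary of a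
  ball.\<close>

lemma min_along_line:
  assumes g: "twice_diff g" and t0: "\<And>t. 0 \<le> t \<Longrightarrow> t \<le> 1 \<Longrightarrow> g x \<le> g (x + t *\<^sub>R u)"
  shows "(\<Sum>i\<in>UNIV. u $ i * partial_deriv i g x) \<ge> 0"
proof (rule ccontr)
  assume "\<not> ?thesis"
  then have neg: "(\<Sum>i\<in>UNIV. u $ i * partial_deriv i g (x + 0 *\<^sub>R u)) < 0" by simp
  have "g differentiable_on UNIV" using g by (simp add: twice_diff_def)
  from DERIV_neg_dec_right[OF line_deriv[OF this, of x u 0] neg]
  obtain d where d: "d > 0" "\<forall>h>0. h < d \<longrightarrow> g (x + (0 + h) *\<^sub>R u) < g (x + 0 *\<^sub>R u)" by blast
  define h where "h = min (d / 2) 1"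
  have h: "0 < h" "h < d" "h \<le> 1" using d(1) by (auto simp: h_def)
  have "g (x + h *\<^sub>R u) < g x" using d(2) h by auto
  then show False using t0[of h] h by simp
qed

text \<open>Along the segment from \<open>m\<close> to \<open>p\<close> the first derivative starts
  out nonnegative, even if \<open>m\<close> lies on the boundary of \<open>C\<close>, and grows at
  rate at least \<gamma>; integrating twice gives the quadratic bound.\<close>

lemma strong_min:
  assumes g: "twice_diff g" and C: "convex C" "m \<in> C" "p \<in> C"
    and min: "\<And>q. q \<in> C \<Longrightarrow> g m \<le> g q"
    and conv: "\<And>q u. q \<in> C \<Longrightarrow> quad g q u \<ge> c * (norm u)\<^sup>2"
  shows "g p \<ge> g m + c / 2 * (norm (p - m))\<^sup>2"
proof -
  define u where "u = p - m"
  define \<gamma> where "\<gamma> = c * (norm u)\<^sup>2"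
  have inC: "m + t *\<^sub>R u \<in> C" if "0 \<le> t" "t \<le> 1" for t
  proof -
    have "(1 - t) *\<^sub>R m + t *\<^sub>R p \<in> C" using C that by (intro convexD) auto
    then show ?thesis by (simp add: u_def algebra_simps)
  qed
  define \<phi> where "\<phi> = (\<lambda>t. g (m + t *\<^sub>R u))"
  define \<phi>' where "\<phi>' = (\<lambda>t. \<Sum>i\<in>UNIV. u $ i * partial_deriv i g (m + t *\<^sub>R u))"
  have d1: "(\<phi> has_real_derivative \<phi>' t) (at t)" for t
    unfolding \<phi>_def \<phi>'_def by (rule line_deriv) (use g in \<open>simp add: twice_diff_def\<close>)
  have d2: "(\<phi>' has_real_derivative quad g (m + t *\<^sub>R u) u) (at t)" for t
    unfolding \<phi>'_def by (rule line_deriv2[OF g])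
  have p0: "\<phi>' 0 \<ge> 0"
    unfolding \<phi>'_def using min_along_line[OF g, of m u] min inC by simp
  have p1: "\<phi>' t \<ge> \<gamma> * t" if t: "0 \<le> t" "t \<le> 1" for t
  proof -
    have "\<phi>' 0 - \<gamma> * 0 \<le> \<phi>' t - \<gamma> * t"
    proof (rule DERIV_nonneg_imp_nondecreasing[OF t(1), where f="\<lambda>s. \<phi>' s - \<gamma> * s"])
      fix s assume s: "0 \<le> s" "s \<le> t"
      have "((\<lambda>s. \<phi>' s - \<gamma> * s) has_real_derivative quad g (m + s *\<^sub>R u) u - \<gamma>) (at s)"
        by (rule derivative_eq_intros d2 refl | simp)+
      moreover have "quad g (m + s *\<^sub>R u) u - \<gamma> \<ge> 0"
        using conv[OF inC, of s u] s t by (simp add: \<gamma>_def)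
      ultimately show "\<exists>y. ((\<lambda>s. \<phi>' s - \<gamma> * s) has_real_derivative y) (at s) \<and> 0 \<le> y" by blast
    qed
    then show ?thesis using p0 by simp
  qed
  have "\<phi> 0 - \<gamma> / 2 * 0\<^sup>2 \<le> \<phi> 1 - \<gamma> / 2 * 1\<^sup>2"
  proof (rule DERIV_nonneg_imp_nondecreasing[where f="\<lambda>s. \<phi> s - \<gamma> / 2 * s\<^sup>2"])
    fix s :: real assume s: "0 \<le> s" "s \<le> 1"
    have "((\<lambda>s. \<phi> s - \<gamma> / 2 * s\<^sup>2) has_real_derivative \<phi>' s - \<gamma> * s) (at s)"
      by (rule derivative_eq_intros d1 refl | simp)+
    moreover have "\<phi>' s - \<gamma> * s \<ge> 0" using p1[OF s] by simp
    ultimately show "\<exists>y. ((\<lambda>s. \<phi> s - \<gamma> / 2 * s\<^sup>2) has_real_derivative y) (at s) \<and> 0 \<le> y" by blast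
  qed simp
  then show ?thesis by (simp add: \<phi>_def \<gamma>_def u_def)
qed

lemma quad_min:
  assumes g: "twice_diff g" and min: "\<And>q. g m \<le> g q"
  shows "partial_deriv i g m = 0" "quad g m u \<ge> 0"
proof -
  have le: "(\<Sum>i\<in>UNIV. u $ i * partial_deriv i g m) \<ge> 0" for u by (rule min_along_line[OF g min])
  have eq: "(\<Sum>j\<in>UNIV. (r *\<^sub>R axis i 1) $ j * partial_deriv j g m) = r * partial_deriv i g m" for r i
    using sum_axis[of i "\<lambda>j. r * partial_deriv j g m"] by (simp add: mult_ac)
  have grad: "partial_deriv i g m = 0" for i
    using le[of "1 *\<^sub>R axis i 1"] le[of "(-1) *\<^sub>R axis i 1"] unfolding eq by simp
  then show "partial_deriv i g m = 0" .
  show "quad g m u \<ge> 0"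
  proof (rule ccontr)
    assume "\<not> quad g m u \<ge> 0"
    then have neg: "quad g (m + 0 *\<^sub>R u) u < 0" by simp
    define \<phi>' where "\<phi>' = (\<lambda>t. \<Sum>i\<in>UNIV. u $ i * partial_deriv i g (m + t *\<^sub>R u))"
    have d1: "((\<lambda>t. g (m + t *\<^sub>R u)) has_real_derivative \<phi>' t) (at t)" for t
      unfolding \<phi>'_def by (rule line_deriv) (use g in \<open>simp add: twice_diff_def\<close>)
    have d2: "(\<phi>' has_real_derivative quad g (m + 0 *\<^sub>R u) u) (at 0)"
      unfolding \<phi>'_def by (rule line_deriv2[OF g])
    from DERIV_neg_dec_right[OF d2 neg] obtain d where d: "d > 0" "\<forall>h>0. h < d \<longrightarrow> \<phi>' (0 + h) < \<phi>' 0" by blast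
    have z: "\<phi>' 0 = 0" by (simp add: \<phi>'_def grad)
    have dh: "0 < d / 2" using d by simp
    obtain s where s: "0 < s" "s < d / 2" "g (m + (d/2) *\<^sub>R u) - g (m + 0 *\<^sub>R u) = (d / 2 - 0) * \<phi>' s"
      using MVT2[OF dh, of "\<lambda>t. g (m + t *\<^sub>R u)" \<phi>'] d1 by blast
    have "\<phi>' s < 0" using d s z by simp
    then have "(d / 2) * \<phi>' s < 0" using d by (simp add: mult_pos_neg)
    then show False using s(3) min[of "m + (d/2) *\<^sub>R u"] by simp
  qed
qed

text \<open>At a minimum the Hessian is positive semidefinite. A vector on which a semidefinite
  symmetric form vanishes lies in its kernel, and the Morse condition makes the kernel trivial;
  compactness of the sphere then provides \<open>c\<close>.\<close>

lemma morse_min_pos: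
  fixes g :: "real ^ 'd \<Rightarrow> real"
  assumes g: "twice_diff g" and min: "\<And>q. g m \<le> g q" and mo: "morse g"
  shows "\<exists>c>0. \<forall>u. quad g m u \<ge> c * (norm u)\<^sup>2"
proof -
  define M where "M = hessian g m"
  have sym: "M $ i $ j = M $ j $ i" for i j
    unfolding M_def hessian_def using mixed_partials_commute[OF g, of i j m] by simp
  have det: "det M \<noteq> 0" using mo quad_min(1)[OF g min] by (simp add: morse_def M_def)
  define b where "b = (\<lambda>u v. \<Sum>i\<in>UNIV. u $ i * (\<Sum>j\<in>UNIV. v $ j * M $ j $ i))"
  have q: "quad g m u = b u u" for u by (simp add: quad_def b_def M_def hessian_def)
  have bsym: "b u v = b v u" for u v
    unfolding b_def sum_distrib_left
    by (subst sum.swap) (intro sum.cong refl, simp add: sym mult_ac)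
  have badd: "b (u + t *\<^sub>R v) (u + t *\<^sub>R v) = b u u + 2 * t * b u v + t\<^sup>2 * b v v" for u v t
  proof -
    have "b (u + t *\<^sub>R v) (u + t *\<^sub>R v) = b u u + t * b u v + t * b v u + t\<^sup>2 * b v v"
      by (simp add: b_def algebra_simps sum.distrib sum_distrib_left power2_eq_square)
    then show ?thesis using bsym[of v u] by simp
  qed
  have bnn: "b u u \<ge> 0" for u using quad_min(2)[OF g min, of u] by (simp add: q)
  have pos: "b u u > 0" if "u \<noteq> 0" for u
  proof (rule ccontr)
    assume "\<not> b u u > 0"
    then have u0: "b u u = 0" using bnn[of u] by simp
    have "b u v = 0" for v
    proof (rule ccontr)
      assume nz: "b u v \<noteq> 0"
      define K where "K = b v v + 1"
      have K: "K > 0" "b v v \<le> K" using bnn[of v] by (auto simp: K_def)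
      \<comment> \<open>The minimizer of \<open>2 * t * b u v + t^2 * K\<close>; the
        \<open>+ 1\<close> in \<open>K\<close> keeps it meaningful when
        \<open>b v v = 0\<close>.\<close>
      define t where "t = - b u v / K"
      have "0 \<le> 2 * t * b u v + t\<^sup>2 * b v v" using bnn[of "u + t *\<^sub>R v"] by (simp add: badd u0)
      also have "\<dots> \<le> 2 * t * b u v + t\<^sup>2 * K" using K by (simp add: mult_left_mono)
      also have "\<dots> = - (b u v)\<^sup>2 / K" using K by (simp add: t_def power2_eq_square)
      finally show False using nz K by (simp add: divide_less_0_iff not_less[symmetric])
    qed
    then have "(M *v u) $ i = 0" for i
    proof -
      have "b u (axis i 1) = (\<Sum>k\<in>UNIV. u $ k * M $ i $ k)"
        unfolding b_def sum_axis ..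
      then show ?thesis using \<open>b u (axis i 1) = 0\<close> by (simp add: matrix_vector_mult_def mult.commute)
    qed
    then have "M *v u = 0" by (simp add: vec_eq_iff)
    moreover have "invertible M" using det by (simp add: invertible_det_nz)
    ultimately have "u = 0" using matrix_left_invertible_ker[of M] by (auto simp: invertible_def)
    with that show False by simp
  qed
  define S where "S = sphere (0 :: real ^ 'd) 1"
  have S: "compact S" "S \<noteq> {}" by (simp_all add: S_def)
  have "continuous_on S (\<lambda>u. b u u)" unfolding b_def by (intro continuous_intros)
  from continuous_attains_inf[OF S this]
  obtain u0 where u0: "u0 \<in> S" "\<And>u. u \<in> S \<Longrightarrow> b u0 u0 \<le> b u u" by blast
  have c: "b u0 u0 > 0" by (rule pos) (use u0 in \<open>auto simp: S_def\<close>)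
  have "quad g m u \<ge> b u0 u0 * (norm u)\<^sup>2" for u
  proof (cases "u = 0")
    case True then show ?thesis using bnn[of u] by (simp add: q)
  next
    case False
    define v where "v = (1 / norm u) *\<^sub>R u"
    have "v \<in> S" using False by (simp add: S_def v_def)
    then have "b u0 u0 \<le> b v v" by (rule u0(2))
    also have "b v v = b u u / (norm u)\<^sup>2"
      by (simp add: b_def v_def sum_divide_distrib power2_eq_square sum_distrib_left mult_ac)
    finally show ?thesis using False by (simp add: q pos_le_divide_eq)
  qed
  then show ?thesis using c by blast
qed

text \<open>The sign \<sigma> makes this class of reflected sums stable under differentiation, which
  replaces \<sigma> by its negative; two applications give the second derivatives of
  \<open>disp\<close>.\<close>

lemma partial_deriv_reflect:
  fixes g :: "real ^ 'd \<Rightarrow> real"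
  assumes g: "g differentiable_on UNIV"
  shows "(\<lambda>p. g (h + p) + \<sigma> * g (h - p)) differentiable_on UNIV"
    and "partial_deriv i (\<lambda>p. g (h + p) + \<sigma> * g (h - p)) = (\<lambda>p. partial_deriv i g (h + p) + - \<sigma> * partial_deriv i g (h - p))"
proof -
  have gd: "(g has_derivative frechet_derivative g (at y)) (at y)" for y
    using g by (auto simp: differentiable_on_def frechet_derivative_works[symmetric])
  have lin: "linear (frechet_derivative g (at y))" for y using gd by (rule has_derivative_linear)
  have d: "((\<lambda>p. g (h + p) + \<sigma> * g (h - p)) has_derivative
      (\<lambda>v. frechet_derivative g (at (h + p)) v + \<sigma> * frechet_derivative g (at (h - p)) (- v))) (at p)" for p
  proof -
    have 1: "((\<lambda>p. g (h + p)) has_derivative (\<lambda>v. frechet_derivative g (at (h + p)) v)) (at p)"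
      by (rule has_derivative_compose[OF _ gd]) (auto intro!: derivative_eq_intros)
    have 2: "((\<lambda>p. g (h - p)) has_derivative (\<lambda>v. frechet_derivative g (at (h - p)) (- v))) (at p)"
      by (rule has_derivative_compose[OF _ gd]) (auto intro!: derivative_eq_intros)
    show ?thesis by (intro has_derivative_add has_derivative_mult_right 1 2)
  qed
  then show "(\<lambda>p. g (h + p) + \<sigma> * g (h - p)) differentiable_on UNIV"
    by (auto simp: differentiable_on_def differentiable_def)
  show "partial_deriv i (\<lambda>p. g (h + p) + \<sigma> * g (h - p)) = (\<lambda>p. partial_deriv i g (h + p) + - \<sigma> * partial_deriv i g (h - p))"
    unfolding partial_deriv_def frechet_derivative_at[OF d, symmetric]
    by (simp add: linear_neg[OF lin])
qed

lemma disp_reflect: "disp \<epsilon> k = (\<lambda>p. \<epsilon> (k /\<^sub>R 2 + p) + 1 * \<epsilon> (k /\<^sub>R 2 - p))"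
  by (simp add: disp_def fun_eq_iff)

lemma
  assumes e: "twice_diff \<epsilon>"
  shows twice_diff_disp: "twice_diff (disp \<epsilon> k)"
    and quad_disp: "quad (disp \<epsilon> k) p u = quad \<epsilon> (k /\<^sub>R 2 + p) u + quad \<epsilon> (k /\<^sub>R 2 - p) u"
proof -
  have d: "\<epsilon> differentiable_on UNIV" "\<And>i. partial_deriv i \<epsilon> differentiable_on UNIV"
    and c: "\<And>i j. continuous_on UNIV (partial_deriv j (partial_deriv i \<epsilon>))"
    using e by (auto simp: twice_diff_def)
  have 1: "partial_deriv i (disp \<epsilon> k) = (\<lambda>p. partial_deriv i \<epsilon> (k /\<^sub>R 2 + p) + (- 1) * partial_deriv i \<epsilon> (k /\<^sub>R 2 - p))" for i
    unfolding disp_reflect by (rule partial_deriv_reflect(2)[OF d(1)])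
  have 2: "partial_deriv j (partial_deriv i (disp \<epsilon> k)) = (\<lambda>p. partial_deriv j (partial_deriv i \<epsilon>) (k /\<^sub>R 2 + p) + - (- 1) * partial_deriv j (partial_deriv i \<epsilon>) (k /\<^sub>R 2 - p))" for i j
    unfolding 1 by (rule partial_deriv_reflect(2)[OF d(2)])
  show "twice_diff (disp \<epsilon> k)"
    unfolding twice_diff_def
  proof (intro conjI allI)
    show "disp \<epsilon> k differentiable_on UNIV" unfolding disp_reflect by (rule partial_deriv_reflect(1)[OF d(1)])
    show "partial_deriv i (disp \<epsilon> k) differentiable_on UNIV" for i
      unfolding 1 by (rule partial_deriv_reflect(1)[OF d(2)])
    show "continuous_on UNIV (partial_deriv j (partial_deriv i (disp \<epsilon> k)))" for i j
      unfolding 2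
      by (intro continuous_intros continuous_on_compose2[OF c]) auto
  qed
  show "quad (disp \<epsilon> k) p u = quad \<epsilon> (k /\<^sub>R 2 + p) u + quad \<epsilon> (k /\<^sub>R 2 - p) u"
    unfolding quad_def 2 by (simp add: algebra_simps sum.distrib sum_distrib_left)
qed

lemma quad_continuous:
  fixes \<epsilon> :: "real ^ 'd \<Rightarrow> real"
  assumes e: "twice_diff \<epsilon>" and t: "\<tau> > 0"
  shows "\<exists>r>0. \<forall>x. dist x y < r \<longrightarrow> (\<forall>u. \<bar>quad \<epsilon> x u - quad \<epsilon> y u\<bar> \<le> \<tau> * (norm u)\<^sup>2)"
proof -
  \<comment> \<open>The number of Hessian entries, among which the tolerance \<tau> is
    divided.\<close>
  define N where "N = real (CARD('d)) ^ 2"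
  have N: "N > 0" by (simp add: N_def)
  define H where "H = (\<lambda>i j. partial_deriv j (partial_deriv i \<epsilon>))"
  have "\<exists>r>0. \<forall>x. dist x y < r \<longrightarrow> dist (H i j x) (H i j y) < \<tau> / N" for i j
  proof -
    have "isCont (H i j) y" using e by (auto simp: twice_diff_def H_def continuous_on_eq_continuous_at)
    then show ?thesis using t N unfolding continuous_at_eps_delta by simp
  qed
  then obtain R where R: "\<And>i j. R i j > 0" "\<And>i j x. dist x y < R i j \<Longrightarrow> dist (H i j x) (H i j y) < \<tau> / N"
    by metis
  define r where "r = Min ((\<lambda>(i, j). R i j) ` UNIV)"
  have r: "r > 0" unfolding r_def using R(1) by (subst Min_gr_iff) auto
  have rR: "r \<le> R i j" for i j unfolding r_def by (rule Min_le) auto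
  have "\<bar>quad \<epsilon> x u - quad \<epsilon> y u\<bar> \<le> \<tau> * (norm u)\<^sup>2" if x: "dist x y < r" for x u
  proof -
    have "quad \<epsilon> x u - quad \<epsilon> y u = (\<Sum>i\<in>UNIV. \<Sum>j\<in>UNIV. u $ i * u $ j * (H i j x - H i j y))"
      unfolding quad_def H_def by (simp add: sum_distrib_left sum_subtractf[symmetric] algebra_simps)
    also have "\<bar>\<dots>\<bar> \<le> (\<Sum>i\<in>UNIV. \<Sum>j\<in>UNIV. \<bar>u $ i * u $ j * (H i j x - H i j y)\<bar>)"
      by (rule order.trans[OF sum_abs sum_mono[OF sum_abs]])
    also have "\<dots> \<le> (\<Sum>i\<in>(UNIV :: 'd set). \<Sum>j\<in>(UNIV :: 'd set). (norm u)\<^sup>2 * (\<tau> / N))"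
    proof (intro sum_mono)
      fix i j
      have "\<bar>u $ i * u $ j\<bar> \<le> norm u * norm u"
        unfolding abs_mult by (intro mult_mono component_le_norm_cart) auto
      moreover have "\<bar>H i j x - H i j y\<bar> \<le> \<tau> / N"
        using R(2)[of x i j] x rR[of i j] by (force simp: dist_real_def)
      ultimately show "\<bar>u $ i * u $ j * (H i j x - H i j y)\<bar> \<le> (norm u)\<^sup>2 * (\<tau> / N)"
        unfolding abs_mult[of "u $ i * u $ j"] power2_eq_square by (intro mult_mono) auto
    qed
    also have "\<dots> = \<tau> * (norm u)\<^sup>2" using N by (simp add: N_def power2_eq_square)
    finally show ?thesis .
  qed
  then show ?thesis using r by blast
qed

section \<open>Dispersion relations\<close>

definition shift :: "int ^ 'd \<Rightarrow> real ^ 'd"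
  where "shift n = (\<chi> i. 2 * pi * of_int (n $ i))"

lemma torus_proj_shift: "\<exists>n. torus_proj x = x - shift n"
proof
  show "torus_proj x = x - shift (\<chi> i. \<lfloor>(x $ i + pi) / (2 * pi)\<rfloor>)"
    by (simp add: torus_proj_def shift_def vec_eq_iff)
qed

definition idot :: "int ^ 'd \<Rightarrow> int ^ 'd \<Rightarrow> int"
  where "idot n x = (\<Sum>j\<in>UNIV. n $ j * x $ j)"

lemma lattice_pair_shift: "lattice_pair (shift n) x = 2 * pi * of_int (idot n x)"
  by (simp add: lattice_pair_def shift_def idot_def sum_distrib_left mult_ac)

locale dispersion =
  fixes \<epsilon> :: "real ^ 'd \<Rightarrow> real" and \<epsilon>_hat :: "int ^ 'd \<Rightarrow> real"
  assumes hat_l1: "(\<lambda>x. \<bar>\<epsilon>_hat x\<bar>) summable_on UNIV"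
    and hat_even: "\<And>x. \<epsilon>_hat (- x) = \<epsilon>_hat x"
    and series: "\<And>p. ((\<lambda>x. cis (lattice_pair p x) * of_real (\<epsilon>_hat x)) has_sum complex_of_real (\<epsilon> p)) UNIV"
    and td: "twice_diff \<epsilon>" and even: "\<And>p. \<epsilon> (- p) = \<epsilon> p"
begin

lemma eps_cont: "continuous_on UNIV \<epsilon>"
  using td by (simp add: twice_diff_def differentiable_imp_continuous_on)

lemma eps_periodic: "\<epsilon> (p + shift n) = \<epsilon> p"
proof -
  have "cis (lattice_pair (p + shift n) x) = cis (lattice_pair p x)" for x
  proof -
    have "cis (lattice_pair (p + shift n) x) = cis (lattice_pair p x) * cis (2 * pi * of_int (idot n x))"
      by (simp add: lattice_pair_simps lattice_pair_shift flip: cis_mult)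
    moreover have "cis (2 * pi * of_int (idot n x)) = 1" by (rule cis_multiple_2pi) simp
    ultimately show ?thesis by (simp only: mult_1_right)
  qed
  then have "complex_of_real (\<epsilon> (p + shift n)) = complex_of_real (\<epsilon> p)"
    using has_sum_unique[OF series[of "p + shift n"]] series[of p] by simp
  then show ?thesis by simp
qed

lemma eps_bound: "\<bar>\<epsilon> p\<bar> \<le> (\<Sum>\<^sub>\<infinity>x. \<bar>\<epsilon>_hat x\<bar>)"
proof -
  have "complex_of_real (\<epsilon> p) = (\<Sum>\<^sub>\<infinity>x. cis (lattice_pair p x) * of_real (\<epsilon>_hat x))"
    using infsumI[OF series[of p]] by simp
  then have "cmod (complex_of_real (\<epsilon> p)) \<le> (\<Sum>\<^sub>\<infinity>x. cmod (cis (lattice_pair p x) * of_real (\<epsilon>_hat x)))"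
    using norm_infsum_bound[of "\<lambda>x. cis (lattice_pair p x) * of_real (\<epsilon>_hat x)" UNIV] hat_l1
    by (simp add: norm_mult)
  then show ?thesis by (simp add: norm_mult)
qed

lemma disp_periodic: "disp \<epsilon> k (p - shift n) = disp \<epsilon> k p"
  using eps_periodic[of "k /\<^sub>R 2 + (p - shift n)" n] eps_periodic[of "k /\<^sub>R 2 - p" n]
  by (simp add: disp_def algebra_simps)

text \<open>A full period in \<open>k\<close> is half a period in \<open>k / 2\<close>. A
  translation of \<open>p\<close> absorbs it in the first summand, and one full period corrects the
  second. Hence the minimum is periodic in \<open>k\<close>, although \<open>disp\<close> at fixed
  \<open>p\<close> need not be.\<close>

lemma disp_shift: "disp \<epsilon> (k - shift n) p = disp \<epsilon> k (p - shift n /\<^sub>R 2)"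
proof -
  have eq: "k /\<^sub>R 2 - shift n /\<^sub>R 2 - p + shift n = k /\<^sub>R 2 - (p - shift n /\<^sub>R 2)"
    by (simp add: algebra_simps flip: scaleR_add_left)
  have "\<epsilon> (k /\<^sub>R 2 - shift n /\<^sub>R 2 - p) = \<epsilon> (k /\<^sub>R 2 - (p - shift n /\<^sub>R 2))"
    unfolding eq[symmetric] by (rule eps_periodic[symmetric])
  then show ?thesis by (simp add: disp_def algebra_simps)
qed

lemma disp_range: "disp \<epsilon> k ` torus = range (disp \<epsilon> k)"
proof -
  have "disp \<epsilon> k p \<in> disp \<epsilon> k ` torus" for p
  proof -
    obtain n where n: "torus_proj p = p - shift n" using torus_proj_shift by blast
    have "disp \<epsilon> k p = disp \<epsilon> k (torus_proj p)" unfolding n by (simp add: disp_periodic)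
    then show ?thesis using torus_proj_in_torus by blast
  qed
  then show ?thesis by blast
qed

lemma disp_bdd: "bdd_below (range (disp \<epsilon> k))"
proof (rule bdd_belowI2)
  show "- (2 * (\<Sum>\<^sub>\<infinity>x. \<bar>\<epsilon>_hat x\<bar>)) \<le> disp \<epsilon> k p" for p
    using eps_bound[of "k /\<^sub>R 2 + p"] eps_bound[of "k /\<^sub>R 2 - p"] by (simp add: disp_def)
qed

lemma disp_min_range: "disp_min \<epsilon> k = Inf (range (disp \<epsilon> k))"
  by (simp add: disp_min_def disp_range)

lemma disp_min_le: "disp_min \<epsilon> k \<le> disp \<epsilon> k p"
  unfolding disp_min_range by (rule cInf_lower[OF _ disp_bdd]) simp

lemma disp_min_shift: "disp_min \<epsilon> (k - shift n) = disp_min \<epsilon> k"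
proof -
  have "range (disp \<epsilon> (k - shift n)) = range (disp \<epsilon> k)"
  proof (intro equalityI subsetI)
    fix y assume "y \<in> range (disp \<epsilon> k)"
    then obtain p where "y = disp \<epsilon> k p" by blast
    then have "y = disp \<epsilon> (k - shift n) (p + shift n /\<^sub>R 2)" by (simp add: disp_shift)
    then show "y \<in> range (disp \<epsilon> (k - shift n))" by blast
  qed (auto simp: disp_shift)
  then show ?thesis by (simp add: disp_min_range)
qed

definition gap where "gap k p = disp \<epsilon> k p - disp_min \<epsilon> k"

lemma gap_nonneg: "gap k p \<ge> 0"
  using disp_min_le by (simp add: gap_def)

lemma disp_cont: "continuous_on UNIV (disp \<epsilon> k)"
  unfolding disp_def by (intro continuous_intros continuous_on_compose2[OF eps_cont]) auto

section \<open>Uniform dependence of the gap on the quasi-momentum\<close>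

lemma torus_norm: "(p :: real ^ 'd) \<in> torus \<Longrightarrow> norm p \<le> real CARD('d) * pi"
proof -
  assume p: "(p :: real ^ 'd) \<in> torus"
  have "norm p \<le> (\<Sum>i\<in>UNIV. \<bar>p $ i\<bar>)" by (rule norm_le_l1_cart)
  also have "\<dots> \<le> (\<Sum>i\<in>(UNIV :: 'd set). pi)" 
  proof (rule sum_mono)
    fix i
    have "- pi \<le> p $ i" "p $ i < pi" using p by (auto simp: torus_def)
    then show "\<bar>p $ i\<bar> \<le> pi" by linarith
  qed
  finally show ?thesis by simp
qed

lemma disp_uniform:
  assumes r: "r > 0"
  shows "\<exists>d>0. \<forall>k\<in>ball k0 d. \<forall>p\<in>torus. \<bar>disp \<epsilon> k p - disp \<epsilon> k0 p\<bar> \<le> r"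
proof -
  \<comment> \<open>A compact ball containing every argument of \<epsilon> that occurs for
    \<open>norm k \<le> norm k0 + 1\<close> and \<open>p\<close> in the box.\<close>
  define C where "C = cball (0 :: real ^ 'd) (norm k0 + 1 + real CARD('d) * pi)"
  have "uniformly_continuous_on C \<epsilon>"
    by (rule compact_uniformly_continuous[OF continuous_on_subset[OF eps_cont]]) (auto simp: C_def)
  then obtain d where d: "d > 0" "\<And>x y. x \<in> C \<Longrightarrow> y \<in> C \<Longrightarrow> dist y x < d \<Longrightarrow> dist (\<epsilon> y) (\<epsilon> x) < r / 2"
    using r unfolding uniformly_continuous_on_def by (meson half_gt_zero)
  have inC: "k /\<^sub>R 2 + p \<in> C \<and> k /\<^sub>R 2 - p \<in> C" if "p \<in> torus" "norm k \<le> norm k0 + 1" for k p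
  proof -
    have "norm (k /\<^sub>R 2) = norm k / 2" by simp
    then have "norm (k /\<^sub>R 2) \<le> norm k0 + 1" using that(2) norm_ge_zero[of k0] by linarith
    then show ?thesis
      using torus_norm[OF that(1)] norm_triangle_ineq[of "k /\<^sub>R 2" p] norm_triangle_ineq4[of "k /\<^sub>R 2" p]
      unfolding C_def mem_cball_0 by linarith
  qed
  have "\<bar>disp \<epsilon> k p - disp \<epsilon> k0 p\<bar> \<le> r" if k: "k \<in> ball k0 (min 1 d)" and p: "p \<in> torus" for k p
  proof -
    have nk: "norm (k - k0) < 1" "norm (k - k0) < d" using k by (auto simp: dist_norm norm_minus_commute)
    have "norm k \<le> norm k0 + 1" using norm_triangle_sub[of k k0] nk by linarith
    note c = inC[OF p this] inC[OF p, of k0]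
    have "norm ((k - k0) /\<^sub>R 2) = norm (k - k0) / 2" by simp
    then have h: "norm ((k - k0) /\<^sub>R 2) < d" using nk norm_ge_zero[of "k - k0"] by linarith
    have "dist (k /\<^sub>R 2 + p) (k0 /\<^sub>R 2 + p) < d" "dist (k /\<^sub>R 2 - p) (k0 /\<^sub>R 2 - p) < d"
      using h by (simp_all add: dist_norm algebra_simps)
    then have "dist (\<epsilon> (k /\<^sub>R 2 + p)) (\<epsilon> (k0 /\<^sub>R 2 + p)) < r / 2" "dist (\<epsilon> (k /\<^sub>R 2 - p)) (\<epsilon> (k0 /\<^sub>R 2 - p)) < r / 2"
      using d(2) c by auto
    then show ?thesis unfolding disp_def dist_real_def by linarith
  qed
  then show ?thesis using d(1) by (intro exI[of _ "min 1 d"]) auto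
qed

lemma disp_min_uniform:
  assumes "\<And>p. p \<in> torus \<Longrightarrow> \<bar>disp \<epsilon> k p - disp \<epsilon> k0 p\<bar> \<le> r"
  shows "\<bar>disp_min \<epsilon> k - disp_min \<epsilon> k0\<bar> \<le> r"
proof -
  have ne: "(torus :: (real ^ 'd) set) \<noteq> {}" using torus_proj_in_torus by blast
  have 1: "disp_min \<epsilon> k1 - r \<le> disp_min \<epsilon> k2" if "\<And>p. p \<in> torus \<Longrightarrow> disp \<epsilon> k1 p \<le> disp \<epsilon> k2 p + r" for k1 k2
    unfolding disp_min_def[of _ k2]
  proof (rule cINF_greatest[OF ne])
    fix p :: "real ^ 'd" assume "p \<in> torus"
    then show "disp_min \<epsilon> k1 - r \<le> disp \<epsilon> k2 p" using that[of p] disp_min_le[of k1 p] by linarith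
  qed
  have "disp_min \<epsilon> k - r \<le> disp_min \<epsilon> k0" "disp_min \<epsilon> k0 - r \<le> disp_min \<epsilon> k"
    using assms by (intro 1; fastforce simp: abs_le_iff)+
  then show ?thesis by linarith
qed

lemma gap_uniform:
  assumes r: "r > 0"
  shows "\<exists>d>0. \<forall>k\<in>ball k0 d. \<forall>p\<in>torus. \<bar>gap k p - gap k0 p\<bar> \<le> r"
proof -
  obtain d where d: "d > 0" "\<And>k p. k \<in> ball k0 d \<Longrightarrow> p \<in> torus \<Longrightarrow> \<bar>disp \<epsilon> k p - disp \<epsilon> k0 p\<bar> \<le> r / 2"
    using disp_uniform[of "r / 2" k0] r by auto
  have "\<bar>gap k p - gap k0 p\<bar> \<le> r" if k: "k \<in> ball k0 d" and p: "p \<in> torus" for k p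
    using d(2)[OF k p] disp_min_uniform[of k k0 "r / 2", OF d(2)[OF k]] unfolding gap_def by linarith
  then show ?thesis using d(1) by blast
qed

lemma gap_periodic: "gap k (p - shift n) = gap k p"
  by (simp add: gap_def disp_periodic)

lemma gap_uniform_all:
  assumes r: "r > 0"
  shows "\<exists>d>0. \<forall>k\<in>ball k0 d. \<forall>p. \<bar>gap k p - gap k0 p\<bar> \<le> r"
proof -
  obtain d where d: "d > 0" "\<forall>k\<in>ball k0 d. \<forall>p\<in>torus. \<bar>gap k p - gap k0 p\<bar> \<le> r"
    using gap_uniform[OF r] by blast
  have "\<bar>gap k p - gap k0 p\<bar> \<le> r" if "k \<in> ball k0 d" for k p
  proof -
    obtain n where "torus_proj p = p - shift n" using torus_proj_shift by blast
    then have "\<bar>gap k (p - shift n) - gap k0 (p - shift n)\<bar> \<le> r" using d(2) that torus_proj_in_torus by metis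
    then show ?thesis by (simp add: gap_periodic)
  qed
  then show ?thesis using d(1) by blast
qed

text \<open>Where the gap for \<open>k0\<close> is positive it stays bounded below. Where it
  vanishes, \<open>z\<close> is a nondegenerate minimum for \<open>k0\<close>, and the Hessian forms
  for nearby \<open>k\<close> remain positive on a ball of fixed radius. The zero may move or
  disappear with \<open>k\<close>, so \<open>m\<close> depends on \<open>k\<close> while
  \<open>r\<close> and \<open>c\<close> do not.\<close>

lemma local_bound:
  assumes mo: "morse (disp \<epsilon> k0)"
  shows "\<exists>r>0. \<exists>c>0. \<forall>k\<in>ball k0 r. \<exists>m. \<forall>p\<in>ball z r. gap k p \<ge> c * (norm (p - m))\<^sup>2"
proof (cases "gap k0 z > 0")
  case True
  define g where "g = gap k0 z"
  have g: "g > 0" using True by (simp add: g_def)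
  obtain d where d: "d > 0" "\<And>k p. k \<in> ball k0 d \<Longrightarrow> \<bar>gap k p - gap k0 p\<bar> \<le> g / 4"
    using gap_uniform_all[of "g / 4" k0] g by auto
  have "isCont (disp \<epsilon> k0) z" using disp_cont by (auto simp: continuous_on_eq_continuous_at)
  then obtain d2 where d2: "d2 > 0" "\<And>p. dist p z < d2 \<Longrightarrow> dist (disp \<epsilon> k0 p) (disp \<epsilon> k0 z) < g / 4"
    using g unfolding continuous_at_eps_delta by (meson divide_pos_pos zero_less_numeral)
  \<comment> \<open>A radius of at most 1 lets the constant lower bound imply the quadratic one with
    \<open>m = z\<close>.\<close>
  define r where "r = min 1 (min d d2)"
  have r: "r > 0" "r \<le> 1" "r \<le> d" "r \<le> d2" using d d2 by (auto simp: r_def)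
  have "gap k p \<ge> g / 2 * (norm (p - z))\<^sup>2" if k: "k \<in> ball k0 r" and p: "p \<in> ball z r" for k p
  proof -
    have kd: "k \<in> ball k0 d" using k r by auto
    have "dist p z < r" using p by (simp add: dist_commute)
    then have pz: "norm (p - z) < 1" "dist p z < d2" using r by (auto simp: dist_norm)
    have "gap k p \<ge> g / 2"
      using d(2)[OF kd, of p] d2(2)[OF pz(2)]
      unfolding g_def gap_def dist_real_def abs_le_iff abs_less_iff by (simp add: field_simps)
    moreover have "g / 2 * (norm (p - z))\<^sup>2 \<le> g / 2 * 1"
      using g pz by (intro mult_left_mono) (auto simp: power_le_one)
    ultimately show ?thesis by simp
  qed
  then have "\<forall>k\<in>ball k0 r. \<exists>m. \<forall>p\<in>ball z r. gap k p \<ge> g / 2 * (norm (p - m))\<^sup>2" by blast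
  moreover have "g / 2 > 0" using g by simp
  ultimately show ?thesis using r(1) by blast
next
  case False
  then have z: "disp \<epsilon> k0 z = disp_min \<epsilon> k0" using gap_nonneg[of k0 z] by (simp add: gap_def)
  have "disp \<epsilon> k0 z \<le> disp \<epsilon> k0 q" for q unfolding z by (rule disp_min_le)
  then obtain c where c: "c > 0" "\<And>u. quad (disp \<epsilon> k0) z u \<ge> c * (norm u)\<^sup>2"
    using morse_min_pos[OF twice_diff_disp[OF td] _ mo, of z] by blast
  have c4: "c / 4 > 0" using c by simp
  obtain r1 where r1: "r1 > 0" "\<And>x u. dist x (k0 /\<^sub>R 2 + z) < r1 \<Longrightarrow> \<bar>quad \<epsilon> x u - quad \<epsilon> (k0 /\<^sub>R 2 + z) u\<bar> \<le> c / 4 * (norm u)\<^sup>2"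
    using quad_continuous[OF td c4] by blast
  obtain r2 where r2: "r2 > 0" "\<And>x u. dist x (k0 /\<^sub>R 2 - z) < r2 \<Longrightarrow> \<bar>quad \<epsilon> x u - quad \<epsilon> (k0 /\<^sub>R 2 - z) u\<bar> \<le> c / 4 * (norm u)\<^sup>2"
    using quad_continuous[OF td c4] by blast
  define r where "r = min r1 r2 / 2"
  have r: "r > 0" "2 * r \<le> r1" "2 * r \<le> r2" using r1 r2 by (auto simp: r_def)
  have "\<exists>m. \<forall>p\<in>ball z r. gap k p \<ge> c / 4 * (norm (p - m))\<^sup>2" if k: "k \<in> ball k0 r" for k
  proof -
    have "norm ((k - k0) /\<^sub>R 2) = norm (k - k0) / 2" "norm (k - k0) < r"
      using k by (simp_all add: dist_norm norm_minus_commute)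
    then have kk: "norm ((k - k0) /\<^sub>R 2) < r" using norm_ge_zero[of "k - k0"] by linarith
    \<comment> \<open>Each of the two Hessian forms of \<epsilon> loses at most
      \<open>c / 4\<close>, which leaves \<open>c / 2\<close>.\<close>
    have conv: "quad (disp \<epsilon> k) p u \<ge> c / 2 * (norm u)\<^sup>2" if p: "p \<in> cball z r" for p u
    proof -
      have pz: "norm (p - z) \<le> r" using p by (simp add: dist_norm norm_minus_commute)
      have "dist (k /\<^sub>R 2 + p) (k0 /\<^sub>R 2 + z) = norm ((k - k0) /\<^sub>R 2 + (p - z))"
        "dist (k /\<^sub>R 2 - p) (k0 /\<^sub>R 2 - z) = norm ((k - k0) /\<^sub>R 2 - (p - z))"
        by (simp_all add: dist_norm algebra_simps)
      then have "dist (k /\<^sub>R 2 + p) (k0 /\<^sub>R 2 + z) < r1" "dist (k /\<^sub>R 2 - p) (k0 /\<^sub>R 2 - z) < r2"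
        using norm_triangle_ineq[of "(k - k0) /\<^sub>R 2" "p - z"] norm_triangle_ineq4[of "(k - k0) /\<^sub>R 2" "p - z"] kk pz r
        by linarith+
      from r1(2)[OF this(1), of u] r2(2)[OF this(2), of u] c(2)[of u]
      show ?thesis unfolding quad_disp[OF td] by linarith
    qed
    have cb: "compact (cball z r)" "cball z r \<noteq> {}" using r by auto
    \<comment> \<open>A minimizer over the closed ball, possibly on its boundary and possibly not
      global; the bound survives since \<open>gap k m\<close> is nonnegative anyway.\<close>
    obtain m where m: "m \<in> cball z r" "\<And>q. q \<in> cball z r \<Longrightarrow> disp \<epsilon> k m \<le> disp \<epsilon> k q"
      using continuous_attains_inf[OF cb continuous_on_subset[OF disp_cont]] by blast
    have "gap k p \<ge> c / 4 * (norm (p - m))\<^sup>2" if p: "p \<in> ball z r" for p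
    proof -
      have "p \<in> cball z r" using p by auto
      from strong_min[OF twice_diff_disp[OF td] convex_cball m(1) this m(2) conv]
      have "disp \<epsilon> k p \<ge> disp \<epsilon> k m + c / 2 / 2 * (norm (p - m))\<^sup>2" .
      then show ?thesis using disp_min_le[of k m] by (simp add: gap_def)
    qed
    then show ?thesis by blast
  qed
  then show ?thesis using r(1) c4 by blast
qed

end

section \<open>Integrability of the inverse gap\<close>

lemma AE_haarI:
  assumes "AE p :: real ^ 'd in lborel. P p"
  shows "AE p in haar. P p"
proof -
  have "AE p in restrict_space lborel (torus :: (real ^ 'd) set). P p"
    by (subst AE_restrict_space_iff) (use assms in auto)
  then show ?thesis unfolding haar_density by (subst AE_density) auto
qed

lemma nn_integral_lborel_prod_vec:
  fixes f :: "'d::finite \<Rightarrow> real \<Rightarrow> ennreal"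
  assumes f[measurable]: "\<And>i. f i \<in> borel_measurable borel"
  shows "(\<integral>\<^sup>+p. (\<Prod>i\<in>UNIV. f i ((p :: real ^ 'd) $ i)) \<partial>lborel) = (\<Prod>i\<in>UNIV. \<integral>\<^sup>+x. f i x \<partial>lborel)"
proof -
  define F where "F = (\<lambda>b :: real ^ 'd. f (THE i. b = axis i 1))"
  have Fa: "F (axis i 1) = f i" for i
  proof -
    have "(THE j. axis i (1::real) = axis j 1) = i"
      by (rule the_equality) (auto simp: axis_eq_axis)
    then show ?thesis by (simp add: F_def)
  qed
  have B: "(Basis :: (real ^ 'd) set) = (\<lambda>i. axis i 1) ` UNIV"
    by (auto simp: Basis_vec_def)
  have inj: "inj_on (\<lambda>i :: 'd. axis i (1::real)) UNIV"
    by (auto simp: inj_on_def axis_eq_axis)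
  have eq: "(\<Prod>i\<in>UNIV. f i ((p :: real ^ 'd) $ i)) = (\<Prod>b\<in>Basis. F b (p \<bullet> b))" for p
    unfolding B prod.reindex[OF inj] by (simp add: Fa cart_eq_inner_axis)
  have "(\<integral>\<^sup>+p. (\<Prod>b\<in>Basis. F b ((p :: real ^ 'd) \<bullet> b)) \<partial>lborel) = (\<Prod>b\<in>Basis. \<integral>\<^sup>+x. F b x \<partial>lborel)"
    by (rule nn_integral_lborel_prod) (auto simp: F_def)
  then show ?thesis unfolding eq B prod.reindex[OF inj] by (simp add: Fa)
qed

text \<open>The value is \<open>1 / (1 - s)\<close>, at most 6 for
  \<open>s \<le> 5/6\<close>.\<close>

lemma nn_integral_powr_01:
  assumes s: "0 < s" "s \<le> 5/6"
  shows "(\<integral>\<^sup>+u. ennreal (indicator {0..1} u * u powr (- s)) \<partial>lborel) \<le> ennreal 6"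
proof -
  have "((\<lambda>u. u powr (- s)) has_integral (1 powr (- s + 1) / (- s + 1))) {0..1}"
    by (rule has_integral_powr_from_0) (use s in auto)
  then have "((\<lambda>u. if u \<in> {0..1} then u powr (- s) else 0) has_integral (1 / (1 - s))) UNIV"
    unfolding has_integral_restrict_UNIV by simp
  moreover have "(\<lambda>u. if u \<in> {0..1} then u powr (- s) else 0) = (\<lambda>u. indicator {0..1} u * u powr (- s))"
    by (auto simp: indicator_def)
  ultimately have "(\<integral>\<^sup>+u. ennreal (indicator {0..1} u * u powr (- s)) \<partial>lborel) = ennreal (1 / (1 - s))"
    by (intro nn_integral_has_integral_lborel) auto
  also have "\<dots> \<le> ennreal 6" using s by (intro ennreal_leI) (simp add: field_simps)
  finally show ?thesis .
qed

text \<open>Uniform in the singular point \<open>m\<close>: within distance 1 of it the integrand is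
  covered by two mirror images of the integrand on [0,1], beyond that by 1, which gives 6 + 6 + 2
  pi.\<close>

lemma nn_integral_powr_shift:
  assumes s: "0 < s" "s \<le> 5/6"
  shows "(\<integral>\<^sup>+t. ennreal (indicator {-pi..<pi} t * \<bar>t - m\<bar> powr (- s)) \<partial>lborel) \<le> ennreal (2 * pi + 12)"
proof -
  define h where "h = (\<lambda>u. ennreal (indicator {0..1} u * u powr (- s)))"
  have [measurable]: "h \<in> borel_measurable borel" unfolding h_def by measurable
  have h6: "(\<integral>\<^sup>+u. h u \<partial>lborel) \<le> ennreal 6" unfolding h_def by (rule nn_integral_powr_01[OF s])
  have 1: "(\<integral>\<^sup>+t. h (- m + 1 * t) \<partial>lborel) = (\<integral>\<^sup>+u. h u \<partial>lborel)"
    using nn_integral_real_affine[of h 1 "- m"] by simp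
  have 2: "(\<integral>\<^sup>+t. h (m + (-1) * t) \<partial>lborel) = (\<integral>\<^sup>+u. h u \<partial>lborel)"
    using nn_integral_real_affine[of h "-1" m] by simp
  have "(\<integral>\<^sup>+t. ennreal (indicator {-pi..<pi} t * \<bar>t - m\<bar> powr (- s)) \<partial>lborel) \<le>
     (\<integral>\<^sup>+t. indicator {-pi..<pi} t + (h (- m + 1 * t) + h (m + (-1) * t)) \<partial>lborel)"
  proof (rule nn_integral_mono)
    fix t
    have "indicator {-pi..<pi} t * \<bar>t - m\<bar> powr (- s) \<le>
        indicator {-pi..<pi} t + (indicator {0..1} (- m + 1 * t) * (- m + 1 * t) powr (- s) + indicator {0..1} (m + (-1) * t) * (m + (-1) * t) powr (- s))"
    proof (cases "\<bar>t - m\<bar> \<le> 1")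
      case True
      then show ?thesis
        by (cases "t \<ge> m") (auto simp: indicator_def abs_if)
    next
      case False
      then have "\<bar>t - m\<bar> powr (- s) \<le> 1"
        using powr_mono2'[of "- s" 1 "\<bar>t - m\<bar>"] s by simp
      then show ?thesis by (auto simp: indicator_def)
    qed
    then have "ennreal (indicator {-pi..<pi} t * \<bar>t - m\<bar> powr (- s)) \<le>
        ennreal (indicator {-pi..<pi} t + (indicator {0..1} (- m + 1 * t) * (- m + 1 * t) powr (- s) + indicator {0..1} (m + (-1) * t) * (m + (-1) * t) powr (- s)))"
      by (rule ennreal_leI)
    also have "\<dots> = indicator {-pi..<pi} t + (h (- m + 1 * t) + h (m + (-1) * t))"
      unfolding h_def by (subst ennreal_plus, simp, simp, subst ennreal_plus) (auto simp: ennreal_indicator)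
    finally show "ennreal (indicator {-pi..<pi} t * \<bar>t - m\<bar> powr (- s)) \<le> indicator {-pi..<pi} t + (h (- m + 1 * t) + h (m + (-1) * t))" .
  qed
  also have "\<dots> = (\<integral>\<^sup>+t. indicator {-pi..<pi} t \<partial>lborel) + ((\<integral>\<^sup>+t. h (- m + 1 * t) \<partial>lborel) + (\<integral>\<^sup>+t. h (m + (-1) * t) \<partial>lborel))"
    by (subst nn_integral_add, measurable, subst nn_integral_add) auto
  also have "\<dots> \<le> ennreal (2 * pi) + (ennreal 6 + ennreal 6)"
    unfolding 1 2 by (intro add_mono h6) auto
  also have "ennreal 6 + ennreal 6 = ennreal 12" by (subst ennreal_plus[symmetric]) auto
  also have "ennreal (2 * pi) + ennreal 12 = ennreal (2 * pi + 12)" by (rule ennreal_plus[symmetric]) auto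
  finally show ?thesis .
qed

text \<open>
  Since \<open>\<bar>p - m\<bar> \<ge> \<bar>p\<^sub>i - m\<^sub>i\<bar>\<close> for each \<open>i\<close>, the integrand is at most \<open>\<Prod>\<^sub>i \<bar>p\<^sub>i - m\<^sub>i\<bar>\<^bsup>-5/(2d)\<^esup>\<close>, with
  exponents at least \<open>-5/6\<close> for \<open>d \<ge> 3\<close>; so Fubini suffices and polar coordinates are not needed.
\<close>

lemma nn_integral_norm_powr:
  fixes m :: "real ^ 'd"
  assumes dim: "CARD('d) \<ge> 3"
  shows "(\<integral>\<^sup>+p. ennreal (norm (p - m) powr (- 5/2)) \<partial>haar) \<le> ennreal ((2 * pi + 12) ^ CARD('d))"
proof -
  define s where "s = 5 / (2 * real CARD('d))"
  have s: "0 < s" "s \<le> 5/6" using dim by (auto simp: s_def field_simps)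
  have sd: "real CARD('d) * s = 5/2" using dim by (simp add: s_def)
  define f where "f = (\<lambda>i t. ennreal (indicator {-pi..<pi} t * \<bar>t - m $ i\<bar> powr (- s)))"
  have [measurable]: "f i \<in> borel_measurable borel" for i unfolding f_def by measurable
  have "\<forall>b\<in>Basis. AE p :: real ^ 'd in lborel. p \<bullet> b \<noteq> m \<bullet> b"
    using AE_lborel_inner_neq by blast
  then have "AE p :: real ^ 'd in lborel. \<forall>b\<in>Basis. p \<bullet> b \<noteq> m \<bullet> b" by (simp add: AE_finite_all)
  then have ae: "AE p :: real ^ 'd in lborel. \<forall>i. p $ i \<noteq> m $ i"
    by eventually_elim (auto simp: cart_eq_inner_axis axis_in_Basis_iff)
  have "(\<integral>\<^sup>+p. ennreal (norm (p - m) powr (- 5/2)) * indicator torus p \<partial>lborel) \<le>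
     (\<integral>\<^sup>+p. (\<Prod>i\<in>UNIV. f i (p $ i)) \<partial>lborel)"
  proof (rule nn_integral_mono_AE)
    show "AE p in lborel. ennreal (norm (p - m) powr (- 5/2)) * indicator torus p \<le> (\<Prod>i\<in>UNIV. f i (p $ i))"
      using ae
    proof eventually_elim
      case (elim p)
      show ?case
      proof (cases "p \<in> torus")
        case True
        have pm: "p \<noteq> m" using elim by (metis)
        then have np: "norm (p - m) > 0" by simp
        have "norm (p - m) powr (- 5/2) = (norm (p - m) powr (- s)) ^ CARD('d)"
        proof -
          have "real CARD('d) * (- s) = - 5/2" using sd by simp
          moreover have "(norm (p - m) powr (- s)) ^ CARD('d) = norm (p - m) powr (real CARD('d) * (- s))"
            by (rule powr_power) (use np in auto)
          ultimately show ?thesis by (simp only:)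
        qed
        also have "\<dots> = (\<Prod>i\<in>(UNIV :: 'd set). norm (p - m) powr (- s))" by simp
        also have "\<dots> \<le> (\<Prod>i\<in>UNIV. \<bar>p $ i - m $ i\<bar> powr (- s))"
        proof (rule prod_mono)
          fix i :: 'd
          have "\<bar>p $ i - m $ i\<bar> \<le> norm (p - m)" using component_le_norm_cart[of "p - m" i] by simp
          then have "norm (p - m) powr (- s) \<le> \<bar>p $ i - m $ i\<bar> powr (- s)"
            using elim s by (intro powr_mono2') auto
          then show "0 \<le> norm (p - m) powr (- s) \<and> norm (p - m) powr (- s) \<le> \<bar>p $ i - m $ i\<bar> powr (- s)" by simp
        qed
        finally have "ennreal (norm (p - m) powr (- 5/2)) \<le> ennreal (\<Prod>i\<in>UNIV. \<bar>p $ i - m $ i\<bar> powr (- s))"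
          by (rule ennreal_leI)
        also have "\<dots> = (\<Prod>i\<in>UNIV. f i (p $ i))"
        proof -
          have "f i (p $ i) = ennreal (\<bar>p $ i - m $ i\<bar> powr (- s))" for i
            using True by (simp add: f_def torus_def indicator_def)
          then show ?thesis by (simp add: prod_ennreal)
        qed
        finally show ?thesis using True by simp
      qed simp
    qed
  qed
  also have "\<dots> = (\<Prod>i\<in>UNIV. \<integral>\<^sup>+x. f i x \<partial>lborel)" by (rule nn_integral_lborel_prod_vec) simp
  also have "\<dots> \<le> (\<Prod>i\<in>(UNIV :: 'd set). ennreal (2 * pi + 12))"
    unfolding f_def by (intro prod_mono_ennreal nn_integral_powr_shift s)
  also have "\<dots> = ennreal ((2 * pi + 12) ^ CARD('d))" unfolding prod_constant by (rule ennreal_power) simp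
  finally have le: "(\<integral>\<^sup>+p. ennreal (norm (p - m) powr (- 5/2)) * indicator torus p \<partial>lborel) \<le> ennreal ((2 * pi + 12) ^ CARD('d))" .
  have c1: "1 / (2 * pi) ^ CARD('d) \<le> (1::real)"
  proof -
    have "(1::real) \<le> (2 * pi) ^ CARD('d)" by (rule one_le_power) (use pi_gt3 in simp)
    then show ?thesis by (subst divide_le_eq_1_pos) auto
  qed
  have "(\<integral>\<^sup>+p. ennreal (norm (p - m) powr (- 5/2)) \<partial>haar) =
     ennreal (1 / (2 * pi) ^ CARD('d)) * (\<integral>\<^sup>+p. ennreal (norm (p - m) powr (- 5/2)) * indicator torus p \<partial>lborel)"
    by (rule nn_integral_haar) measurable
  also have "\<dots> \<le> 1 * ennreal ((2 * pi + 12) ^ CARD('d))"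
    using c1 by (intro mult_mono le) (auto simp: ennreal_le_1)
  finally show ?thesis by simp
qed

text \<open>Interpolation between the trivial bound and the one linear in \<tau>. If
  \<open>a\<close> is the smaller number, the ratio \<open>x = (b - a) / b\<close> lies in [0,1], so
  \<open>x \<le> x powr (1/4)\<close>; gaining the factor \<open>\<tau> powr (1/4)\<close> costs a
  quarter in the exponent of \<open>a\<close>.\<close>

lemma inverse_diff_bound:
  fixes a b \<tau> :: real
  assumes "a > 0" "b > 0" "\<bar>a - b\<bar> \<le> \<tau>"
  shows "\<bar>1 / a - 1 / b\<bar> \<le> \<tau> powr (1/4) * (a powr (- 5/4) + b powr (- 5/4))"
proof -
  have *: "1 / a - 1 / b \<le> \<tau> powr (1/4) * a powr (- 5/4)" if "0 < a" "a \<le> b" "b - a \<le> \<tau>" for a b :: real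
  proof -
    define x where "x = (b - a) / b"
    have x: "0 \<le> x" "x \<le> 1" using that by (auto simp: x_def)
    have xt: "x \<le> \<tau> / a"
      unfolding x_def using that by (intro frac_le) auto
    have "x \<le> x powr (1/4)"
      using powr_mono'[of "1/4" 1 x] x by (cases "x = 0") auto
    also have "\<dots> \<le> (\<tau> / a) powr (1/4)" using x xt by (intro powr_mono2) auto
    also have "\<dots> = \<tau> powr (1/4) * a powr (- (1/4))"
    proof -
      have "(\<tau> / a) powr (1/4) = \<tau> powr (1/4) / a powr (1/4)" by (rule powr_divide)
      then show ?thesis by (simp only: powr_minus_divide times_divide_eq_right mult_1_right)
    qed
    finally have "x / a \<le> \<tau> powr (1/4) * a powr (- (1/4)) / a" using that by (intro divide_right_mono) auto
    also have "\<dots> = \<tau> powr (1/4) * (a powr (- (1/4)) * a powr (- 1))"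
    proof -
      have "a powr (- 1) = 1 / a" using that by (simp add: powr_minus_divide)
      then show ?thesis by (simp only: times_divide_eq_right mult_1_right)
    qed
    also have "a powr (- (1/4)) * a powr (- 1) = a powr (- 5/4)" by (simp only: powr_add[symmetric]) simp
    also have "x / a = 1 / a - 1 / b" using that by (simp add: x_def field_simps)
    finally show ?thesis .
  qed
  show ?thesis
  proof (cases "a \<le> b")
    case True
    have "1 / b \<le> 1 / a" using assms True by (intro frac_le) auto
    then show ?thesis using *[of a b] assms True by (simp add: distrib_left add_increasing2)
  next
    case False
    have "1 / a \<le> 1 / b" using assms False by (intro frac_le) auto
    then show ?thesis using *[of b a] assms False by (simp add: distrib_left add_increasing)
  qed
qed

context dispersion
begin

lemma gap_measurable: "gap k \<in> borel_measurable borel"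
  unfolding gap_def[abs_def]
  by (intro borel_measurable_diff borel_measurable_continuous_onI[OF disp_cont]) simp

text \<open>Compactness of the closed box around the torus reduces \<open>local_bound\<close> to
  finitely many centres with common \<open>d\<close> and \<open>c\<close>; the points
  \<open>m z\<close> still depend on \<open>k\<close>.\<close>

lemma uniform_lower_bound:
  assumes mo: "morse (disp \<epsilon> k0)"
  shows "\<exists>d>0. \<exists>c>0. \<exists>Z :: (real ^ 'd) set. finite Z \<and>
    (\<forall>k\<in>ball k0 d. \<exists>m. \<forall>p\<in>torus. \<exists>z\<in>Z. gap k p \<ge> c * (norm (p - m z))\<^sup>2)"
proof -
  have "\<forall>z. \<exists>r c. r > 0 \<and> c > 0 \<and> (\<forall>k\<in>ball k0 r. \<exists>m. \<forall>p\<in>ball z r. gap k p \<ge> c * (norm (p - m))\<^sup>2)"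
    using local_bound[OF mo] by blast
  then obtain r c where rc: "\<And>z. r z > 0" "\<And>z. c z > 0"
    "\<And>z k. k \<in> ball k0 (r z) \<Longrightarrow> \<exists>m. \<forall>p\<in>ball z (r z). gap k p \<ge> c z * (norm (p - m))\<^sup>2"
    by metis
  define T where "T = cbox (\<chi> i. - pi) ((\<chi> i. pi) :: real ^ 'd)"
  have "compact T" unfolding T_def by (rule compact_cbox)
  moreover have "T \<subseteq> (\<Union>z\<in>T. ball z (r z))" using rc(1) by auto
  ultimately obtain Z where Z: "Z \<subseteq> T" "finite Z" "T \<subseteq> (\<Union>z\<in>Z. ball z (r z))"
    using compactE_image[of T T "\<lambda>z. ball z (r z)"] by auto
  have tT: "torus \<subseteq> T" by (auto simp: T_def torus_def mem_box_cart less_imp_le)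
  have Zne: "Z \<noteq> {}" using Z(3) tT torus_proj_in_torus by blast
  define d where "d = Min (r ` Z)"
  define c0 where "c0 = Min (c ` Z)"
  have d: "d > 0" "\<And>z. z \<in> Z \<Longrightarrow> d \<le> r z" unfolding d_def using Z(2) Zne rc(1) by auto
  have c0: "c0 > 0" "\<And>z. z \<in> Z \<Longrightarrow> c0 \<le> c z" unfolding c0_def using Z(2) Zne rc(2) by auto
  have "\<exists>m. \<forall>p\<in>torus. \<exists>z\<in>Z. gap k p \<ge> c0 * (norm (p - m z))\<^sup>2" if k: "k \<in> ball k0 d" for k
  proof -
    have "\<forall>z. z \<in> Z \<longrightarrow> (\<exists>m. \<forall>p\<in>ball z (r z). gap k p \<ge> c z * (norm (p - m))\<^sup>2)"
      using rc(3) k d(2) by (meson less_le_trans mem_ball)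
    then obtain m where m: "\<And>z p. z \<in> Z \<Longrightarrow> p \<in> ball z (r z) \<Longrightarrow> gap k p \<ge> c z * (norm (p - m z))\<^sup>2"
      by metis
    have "\<exists>z\<in>Z. gap k p \<ge> c0 * (norm (p - m z))\<^sup>2" if "p \<in> torus" for p
    proof -
      obtain z where z: "z \<in> Z" "p \<in> ball z (r z)" using Z(3) tT \<open>p \<in> torus\<close> by blast
      have "c0 * (norm (p - m z))\<^sup>2 \<le> c z * (norm (p - m z))\<^sup>2" using c0(2)[OF z(1)] by (rule mult_right_mono) simp
      then show ?thesis using m[OF z] z(1) by force
    qed
    then show ?thesis by blast
  qed
  then have "\<forall>k\<in>ball k0 d. \<exists>m. \<forall>p\<in>torus. \<exists>z\<in>Z. gap k p \<ge> c0 * (norm (p - m z))\<^sup>2" ..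
  with d(1) c0(1) Z(2) show ?thesis
    by blast
qed

text \<open>Which \<open>z\<close> serves depends on \<open>p\<close>, so the majorant is the sum
  over all of \<open>Z\<close>. The exponent -5/4 of a squared norm is the -5/2 of
  \<open>nn_integral_norm_powr\<close>, whose bound is the same for every position of
  \<open>m z\<close> and therefore for every \<open>k\<close>.\<close>

lemma uniform_integral:
  assumes dim: "CARD('d) \<ge> 3" and mo: "morse (disp \<epsilon> k0)"
  shows "\<exists>d>0. \<exists>C\<ge>0. \<forall>k\<in>ball k0 d. (AE p in haar. gap k p > 0) \<and>
    integrable haar (\<lambda>p. gap k p powr (- 5/4)) \<and> (LINT p|haar. gap k p powr (- 5/4)) \<le> C"
proof -
  obtain d c and Z :: "(real ^ 'd) set" where d: "d > 0" and c: "c > 0" and Z: "finite Z"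
    and low: "\<And>k. k \<in> ball k0 d \<Longrightarrow> \<exists>m. \<forall>p\<in>torus. \<exists>z\<in>Z. gap k p \<ge> c * (norm (p - m z))\<^sup>2"
    using uniform_lower_bound[OF mo] by blast
  define C where "C = (\<Sum>z\<in>Z. c powr (- 5/4) * (2 * pi + 12) ^ CARD('d))"
  have C: "C \<ge> 0" unfolding C_def by (intro sum_nonneg mult_nonneg_nonneg) auto
  have "(AE p in haar. gap k p > 0) \<and>
    integrable haar (\<lambda>p. gap k p powr (- 5/4)) \<and> (LINT p|haar. gap k p powr (- 5/4)) \<le> C" if k: "k \<in> ball k0 d" for k
  proof -
    obtain m where m: "\<And>p. p \<in> torus \<Longrightarrow> \<exists>z\<in>Z. gap k p \<ge> c * (norm (p - m z))\<^sup>2"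
      using low[OF k] by blast
    have "m ` Z \<in> null_sets lborel" using Z by (intro finite_imp_null_set_lborel) auto
    then have "AE p in lborel. p \<notin> m ` Z" by (rule AE_not_in)
    then have ae: "AE p in haar. p \<notin> m ` Z" by (rule AE_haarI)
    have aet: "AE p in haar. p \<in> torus" by (rule AE_I2) (simp add: space_haar)
    have pos: "AE p in haar. gap k p > 0"
      using ae aet
    proof eventually_elim
      case (elim p)
      obtain z where z: "z \<in> Z" "gap k p \<ge> c * (norm (p - m z))\<^sup>2" using m elim by blast
      have "p \<noteq> m z" using elim(1) z(1) by blast
      then have "c * (norm (p - m z))\<^sup>2 > 0" using c by simp
      then show ?case using z(2) by linarith
    qed
    have meas[measurable]: "gap k \<in> borel_measurable borel" by (rule gap_measurable)
    have m1: "(\<lambda>p. gap k p powr (- 5/4)) \<in> borel_measurable haar" by (intro haar_measurable) measurable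
    have m2: "(\<lambda>p. ennreal (norm (p - m z) powr (- 5/2))) \<in> borel_measurable haar" for z
      by (intro haar_measurable) measurable
    have "(\<integral>\<^sup>+p. ennreal (gap k p powr (- 5/4)) \<partial>haar) \<le>
        (\<integral>\<^sup>+p. (\<Sum>z\<in>Z. ennreal (c powr (- 5/4)) * ennreal (norm (p - m z) powr (- 5/2))) \<partial>haar)"
    proof (rule nn_integral_mono_AE)
      show "AE p in haar. ennreal (gap k p powr (- 5/4)) \<le> (\<Sum>z\<in>Z. ennreal (c powr (- 5/4)) * ennreal (norm (p - m z) powr (- 5/2)))"
        using ae aet
      proof eventually_elim
        case (elim p)
        obtain z where z: "z \<in> Z" "gap k p \<ge> c * (norm (p - m z))\<^sup>2" using m elim by blast
        have "p \<noteq> m z" using elim(1) z(1) by blast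
        then have np: "norm (p - m z) > 0" by simp
        have "gap k p powr (- 5/4) \<le> (c * (norm (p - m z))\<^sup>2) powr (- 5/4)"
          using c np z(2) by (intro powr_mono2') auto
        also have "\<dots> = c powr (- 5/4) * ((norm (p - m z) powr 2) powr (- 5/4))"
          using c np by (simp add: powr_mult)
        also have "(norm (p - m z) powr 2) powr (- 5/4) = norm (p - m z) powr (- 5/2)"
          by (simp only: powr_powr) simp
        finally have "ennreal (gap k p powr (- 5/4)) \<le> ennreal (c powr (- 5/4)) * ennreal (norm (p - m z) powr (- 5/2))"
          by (simp add: ennreal_leI flip: ennreal_mult)
        also have "\<dots> \<le> (\<Sum>z\<in>Z. ennreal (c powr (- 5/4)) * ennreal (norm (p - m z) powr (- 5/2)))"
          using z(1) Z by (intro member_le_sum) auto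
        finally show ?case .
      qed
    qed
    also have "\<dots> = (\<Sum>z\<in>Z. ennreal (c powr (- 5/4)) * (\<integral>\<^sup>+p. ennreal (norm (p - m z) powr (- 5/2)) \<partial>haar))"
      using m2 by (subst nn_integral_sum) (auto simp: nn_integral_cmult)
    also have "\<dots> \<le> (\<Sum>z\<in>Z. ennreal (c powr (- 5/4)) * ennreal ((2 * pi + 12) ^ CARD('d)))"
      by (intro sum_mono mult_left_mono nn_integral_norm_powr dim) auto
    also have "\<dots> = ennreal C"
      unfolding C_def by (subst sum_ennreal[symmetric]) (auto simp: ennreal_mult)
    finally have le: "(\<integral>\<^sup>+p. ennreal (gap k p powr (- 5/4)) \<partial>haar) \<le> ennreal C" .
    then have "integrable haar (\<lambda>p. gap k p powr (- 5/4))"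
      by (intro integrableI_nonneg m1) (auto simp: le_less_trans[OF _ ennreal_less_top])
    moreover have "(LINT p|haar. gap k p powr (- 5/4)) \<le> C" by (rule integral_real_bounded[OF C le])
    ultimately show ?thesis using pos by blast
  qed
  then show ?thesis using d C by blast
qed

lemma inverse_gap_L1:
  assumes dim: "CARD('d) \<ge> 3" and mo: "morse (disp \<epsilon> k0)"
  shows "\<exists>d0>0. (\<forall>k\<in>ball k0 d0. (AE p in haar. gap k p > 0) \<and> integrable haar (\<lambda>p. 1 / gap k p)) \<and>
    (\<forall>r>0. \<exists>d>0. \<forall>k\<in>ball k0 d. k \<in> ball k0 d0 \<longrightarrow> (LINT p|haar. \<bar>1 / gap k p - 1 / gap k0 p\<bar>) \<le> r)"
proof -
  obtain d0 C where d0: "d0 > 0" and C: "C \<ge> 0" and U: "\<And>k. k \<in> ball k0 d0 \<Longrightarrow> (AE p in haar. gap k p > 0) \<and>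
    integrable haar (\<lambda>p. gap k p powr (- 5/4)) \<and> (LINT p|haar. gap k p powr (- 5/4)) \<le> C"
    using uniform_integral[OF dim mo] by blast
  interpret finite_measure "haar :: (real ^ 'd) measure" by (rule haar_finite)
  have i1: "integrable haar (\<lambda>p. 1 / gap k p)" if k: "k \<in> ball k0 d0" for k
  proof (rule Bochner_Integration.integrable_bound)
    show "integrable haar (\<lambda>p. 1 + gap k p powr (- 5/4))" using U[OF k] by simp
    show "(\<lambda>p. 1 / gap k p) \<in> borel_measurable haar"
      using gap_measurable[of k] by (intro haar_measurable) simp
    have "AE p in haar. gap k p > 0" using U[OF k] by blast
    then show "AE p in haar. norm (1 / gap k p) \<le> norm (1 + gap k p powr (- 5/4))"
    proof eventually_elim
      case (elim p)
      have "1 / gap k p \<le> 1 + gap k p powr (- 5/4)"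
      proof (cases "gap k p \<ge> 1")
        case True
        then have "1 / gap k p \<le> 1" by simp
        then show ?thesis using powr_ge_zero[of "gap k p" "- 5/4"] by linarith
      next
        case False
        have "gap k p powr (- 1) \<le> gap k p powr (- 5/4)" using elim False by (intro powr_mono') auto
        moreover have "gap k p powr (- 1) = 1 / gap k p" using elim by (simp add: powr_minus divide_inverse)
        ultimately show ?thesis by linarith
      qed
      moreover have "norm (1 / gap k p) = 1 / gap k p" using elim by simp
      moreover have "norm (1 + gap k p powr (- 5/4)) = 1 + gap k p powr (- 5/4)"
        unfolding real_norm_def by (rule abs_of_nonneg) (simp add: add_nonneg_nonneg)
      ultimately show ?case by simp
    qed
  qed
  have "\<exists>d>0. \<forall>k\<in>ball k0 d. k \<in> ball k0 d0 \<longrightarrow> (LINT p|haar. \<bar>1 / gap k p - 1 / gap k0 p\<bar>) \<le> r" if r: "r > 0" for r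
  proof -
    \<comment> \<open>The final bound is \<open>q * (C + C)\<close>, which is at most
      \<open>r\<close>; \<tau> is a fourth power because \<open>inverse_diff_bound\<close> takes the
      fourth root.\<close>
    define q where "q = r / (2 * C + 1)"
    define \<tau> where "\<tau> = q ^ 4"
    have t0: "q > 0" using r C by (simp add: q_def)
    have \<tau>: "\<tau> > 0" using t0 by (simp add: \<tau>_def)
    have tq: "\<tau> powr (1/4) = q"
    proof -
      have "\<tau> = q powr 4" using t0 by (simp add: \<tau>_def)
      then have "\<tau> powr (1/4) = q powr (4 * (1/4))" by (simp only: powr_powr)
      then show ?thesis using t0 by simp
    qed
    obtain d where d: "d > 0" "\<And>k p. k \<in> ball k0 d \<Longrightarrow> \<bar>gap k p - gap k0 p\<bar> \<le> \<tau>"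
      using gap_uniform_all[OF \<tau>, of k0] by blast
    have "(LINT p|haar. \<bar>1 / gap k p - 1 / gap k0 p\<bar>) \<le> r" if k: "k \<in> ball k0 d" "k \<in> ball k0 d0" for k
    proof -
      have k00: "k0 \<in> ball k0 d0" using d0 by simp
      have "(LINT p|haar. \<bar>1 / gap k p - 1 / gap k0 p\<bar>) \<le>
          (LINT p|haar. \<tau> powr (1/4) * (gap k p powr (- 5/4) + gap k0 p powr (- 5/4)))"
      proof (rule integral_mono_AE)
        show "integrable haar (\<lambda>p. \<bar>1 / gap k p - 1 / gap k0 p\<bar>)" using i1[OF k(2)] i1[OF k00] by simp
        show "integrable haar (\<lambda>p. \<tau> powr (1/4) * (gap k p powr (- 5/4) + gap k0 p powr (- 5/4)))"
          using U[OF k(2)] U[OF k00] by simp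
        have "AE p in haar. gap k p > 0" "AE p in haar. gap k0 p > 0" using U[OF k(2)] U[OF k00] by auto
        then show "AE p in haar. \<bar>1 / gap k p - 1 / gap k0 p\<bar> \<le> \<tau> powr (1/4) * (gap k p powr (- 5/4) + gap k0 p powr (- 5/4))"
          by eventually_elim (rule inverse_diff_bound[OF _ _ d(2)[OF k(1)]])
      qed
      also have "\<dots> = \<tau> powr (1/4) * ((LINT p|haar. gap k p powr (- 5/4)) + (LINT p|haar. gap k0 p powr (- 5/4)))"
        using U[OF k(2)] U[OF k00] by simp
      also have "\<dots> \<le> \<tau> powr (1/4) * (C + C)"
        using U[OF k(2)] U[OF k00] by (intro mult_left_mono add_mono) auto
      also have "\<dots> \<le> r" unfolding tq q_def using r C by (simp add: field_simps)
      finally show ?thesis .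
    qed
    then show ?thesis using d(1) by blast
  qed
  then show ?thesis using d0 U i1 by blast
qed

end

section \<open>Stability of the number of eigenvalues\<close>

text \<open>Either positivity hypothesis puts \<open>bs_form\<close> above \<open>1 - \<eta>\<close>
  times the squared norm. Courant-Fischer turns this into eigenvalues above
  \<open>1 - \<eta>\<close>, the spectral gap lifts them above \<open>1 + \<eta>\<close>, and their
  eigenvectors have enough margin to serve both forms. One \<eta> works for every
  \<open>m\<close>.\<close>

lemma (in threshold) bs_form_perturb:
  assumes no: "\<And>f. f \<in> l2e \<Longrightarrow> B f = f \<Longrightarrow> f = (\<lambda>_. 0)"
  shows "\<exists>\<eta>>0. \<forall>Q. (\<forall>g\<in>ell2. \<bar>Q g - bs_form w a \<mu> g\<bar> \<le> \<eta> * n2 g) \<longrightarrow>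
    (\<forall>m. positive_family (\<lambda>g. Q g - n2 g) m \<longleftrightarrow> positive_family (\<lambda>g. bs_form w a \<mu> g - n2 g) m)"
proof -
  obtain \<eta> where \<eta>: "\<eta> > 0" "\<eta> < 1" and
    gp: "\<And>f s. f \<in> l2e \<Longrightarrow> n2 f = 1 \<Longrightarrow> B f = (\<lambda>x. of_real s * f x) \<Longrightarrow> 1 - \<eta> < s \<Longrightarrow> 1 + \<eta> < s"
    using B_spectral_gap[OF no] by blast
  have spec: "\<exists>u. (\<forall>l<m. u l \<in> l2e) \<and> (\<forall>c. (\<exists>i<m. c i \<noteq> 0) \<longrightarrow> n2 (comb {..<m} c u) > 0 \<and>
      bs_form w a \<mu> (comb {..<m} c u) \<ge> (1 + \<eta>) * n2 (comb {..<m} c u))"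
    if g: "\<And>i. i < m \<Longrightarrow> g i \<in> l2e" and
      p: "\<And>c. \<exists>i<m. c i \<noteq> 0 \<Longrightarrow> bs_form w a \<mu> (comb {..<m} c g) > (1 - \<eta>) * n2 (comb {..<m} c g)"
    for m :: nat and g
  proof -
    have "\<exists>u lam. (\<forall>l<m. u l \<in> l2e \<and> B (u l) = (\<lambda>x. of_real (lam l) * u l x) \<and> lam l > 1 - \<eta>) \<and>
       (\<forall>k<m. \<forall>l<m. ip (u k) (u l) = (if k = l then 1 else 0))"
      by (rule bs_eigenvectors_above[of m g "1 - \<eta>"]) (use g p \<eta> in auto)
    then obtain u lam where u: "\<And>l. l < m \<Longrightarrow> u l \<in> l2e \<and> B (u l) = (\<lambda>x. of_real (lam l) * u l x) \<and> lam l > 1 - \<eta>"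
      and on: "\<And>k l. k < m \<Longrightarrow> l < m \<Longrightarrow> ip (u k) (u l) = (if k = l then 1 else 0)"
      by blast
    have u2: "\<And>i. i \<in> {..<m} \<Longrightarrow> u i \<in> ell2" using u l2e_ell2 by auto
    have lam: "lam l \<ge> 1 + \<eta>" if "l < m" for l
    proof -
      have "n2 (u l) = 1" using arg_cong[OF ip_self[OF u2, of l], of Re] on[OF that that] that by simp
      then show ?thesis using gp[of "u l" "lam l"] u[OF that] by simp
    qed
    have "n2 (comb {..<m} c u) > 0 \<and> bs_form w a \<mu> (comb {..<m} c u) \<ge> (1 + \<eta>) * n2 (comb {..<m} c u)"
      if c: "\<exists>i<m. c i \<noteq> 0" for c
    proof
      have "n2 (comb {..<m} c u) = (\<Sum>i<m. (cmod (c i))\<^sup>2)"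
        by (rule n2_comb_orthonormal) (use u2 on in auto)
      moreover obtain i where "i < m" "c i \<noteq> 0" using c by blast
      ultimately show "n2 (comb {..<m} c u) > 0" by (auto intro!: sum_pos2[of _ i])
      show "bs_form w a \<mu> (comb {..<m} c u) \<ge> (1 + \<eta>) * n2 (comb {..<m} c u)"
        by (rule bs_orthonormal[of m u lam]) (use u lam on in auto)
    qed
    then show ?thesis using u by blast
  qed
  \<comment> \<open>A tolerance of \<open>\<eta> / 2\<close> uses up only half of the margin \<eta>
    on either side of 1.\<close>
  have "positive_family (\<lambda>g. Q g - n2 g) m \<longleftrightarrow> positive_family (\<lambda>g. bs_form w a \<mu> g - n2 g) m"
    if Q: "\<forall>g\<in>ell2. \<bar>Q g - bs_form w a \<mu> g\<bar> \<le> \<eta> / 2 * n2 g" for Q m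
  proof -
    have Q': "\<bar>Q (comb {..<m} c g) - bs_form w a \<mu> (comb {..<m} c g)\<bar> \<le> \<eta> / 2 * n2 (comb {..<m} c g)"
      if "\<And>i. i < m \<Longrightarrow> g i \<in> l2e" for c g
    proof -
      have "comb {..<m} c g \<in> ell2" by (rule ell2_comb) (use that l2e_ell2 in auto)
      then show ?thesis using Q by blast
    qed
    have half: "0 \<le> \<eta> / 2 * n2 f" for f :: "int ^ 'd \<Rightarrow> complex"
      using \<eta> n2_nonneg[of f] by simp
    have hh: "\<eta> * n2 f = 2 * (\<eta> / 2 * n2 f)" for f :: "int ^ 'd \<Rightarrow> complex" by simp
    show ?thesis
    proof
      assume "positive_family (\<lambda>g. Q g - n2 g) m"
      then obtain g where g: "\<And>i. i < m \<Longrightarrow> g i \<in> l2e"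
        "\<And>c. \<exists>i<m. c i \<noteq> 0 \<Longrightarrow> Q (comb {..<m} c g) - n2 (comb {..<m} c g) > 0"
        unfolding positive_family_def by blast
      have "bs_form w a \<mu> (comb {..<m} c g) > (1 - \<eta>) * n2 (comb {..<m} c g)" if "\<exists>i<m. c i \<noteq> 0" for c
        using g(2)[OF that] Q'[of g c, OF g(1)] half[of "comb {..<m} c g"] hh[of "comb {..<m} c g"]
        unfolding left_diff_distrib by linarith
      from spec[of m g, OF g(1) this] obtain u where u: "\<forall>l<m. u l \<in> l2e"
        "\<And>c. \<exists>i<m. c i \<noteq> 0 \<Longrightarrow> n2 (comb {..<m} c u) > 0 \<and>
      bs_form w a \<mu> (comb {..<m} c u) \<ge> (1 + \<eta>) * n2 (comb {..<m} c u)" by blast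
      show "positive_family (\<lambda>g. bs_form w a \<mu> g - n2 g) m"
        unfolding positive_family_def
      proof (intro exI[of _ u] conjI allI impI)
        show "u i \<in> l2e" if "i < m" for i using u(1) that by blast
        fix c :: "nat \<Rightarrow> complex" assume "\<exists>i<m. c i \<noteq> 0"
        from u(2)[OF this] have 1: "n2 (comb {..<m} c u) > 0"
          "bs_form w a \<mu> (comb {..<m} c u) \<ge> (1 + \<eta>) * n2 (comb {..<m} c u)" by auto
        have "\<eta> * n2 (comb {..<m} c u) > 0" using \<eta> 1(1) by simp
        then show "0 < bs_form w a \<mu> (comb {..<m} c u) - n2 (comb {..<m} c u)"
          using 1(2) unfolding distrib_right by linarith
      qed
    next
      assume "positive_family (\<lambda>g. bs_form w a \<mu> g - n2 g) m"
      then obtain g where g: "\<And>i. i < m \<Longrightarrow> g i \<in> l2e"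
        "\<And>c. \<exists>i<m. c i \<noteq> 0 \<Longrightarrow> bs_form w a \<mu> (comb {..<m} c g) - n2 (comb {..<m} c g) > 0"
        unfolding positive_family_def by blast
      have "bs_form w a \<mu> (comb {..<m} c g) > (1 - \<eta>) * n2 (comb {..<m} c g)" if "\<exists>i<m. c i \<noteq> 0" for c
        using g(2)[OF that] half[of "comb {..<m} c g"] hh[of "comb {..<m} c g"]
        unfolding left_diff_distrib by linarith
      from spec[of m g, OF g(1) this] obtain u where u: "\<forall>l<m. u l \<in> l2e"
        "\<And>c. \<exists>i<m. c i \<noteq> 0 \<Longrightarrow> n2 (comb {..<m} c u) > 0 \<and>
      bs_form w a \<mu> (comb {..<m} c u) \<ge> (1 + \<eta>) * n2 (comb {..<m} c u)" by blast
      show "positive_family (\<lambda>g. Q g - n2 g) m"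
        unfolding positive_family_def
      proof (intro exI[of _ u] conjI allI impI)
        show "u i \<in> l2e" if "i < m" for i using u(1) that by blast
        fix c :: "nat \<Rightarrow> complex" assume "\<exists>i<m. c i \<noteq> 0"
        from u(2)[OF this] have 1: "n2 (comb {..<m} c u) > 0"
          "bs_form w a \<mu> (comb {..<m} c u) \<ge> (1 + \<eta>) * n2 (comb {..<m} c u)" by auto
        have "\<eta> / 2 * n2 (comb {..<m} c u) > 0" using \<eta> 1(1) by simp
        then show "0 < Q (comb {..<m} c u) - n2 (comb {..<m} c u)"
          using 1(2) Q'[of u c, OF u(1)[rule_format]] hh[of "comb {..<m} c u"]
          unfolding distrib_right by linarith
      qed
    qed
  qed
  then show ?thesis using \<eta>(1) by (intro exI[of _ "\<eta> / 2"]) auto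
qed

lemma enat_le_if:
  assumes "\<And>n. enat n \<le> a \<Longrightarrow> enat n \<le> b"
  shows "a \<le> b"
proof (cases a)
  case (enat n)
  then show ?thesis using assms[of n] by simp
next
  case infinity
  then have "enat n \<le> b" for n using assms by simp
  then have "b = \<infinity>" by (metis Suc_n_not_le_n enat_ord_simps(1) not_infinity_eq)
  then show ?thesis by simp
qed

text \<open>A multiplier without zeros preserves independence. Equality follows by applying the
  bound to the inverse multiplier as well, which for a sign is the multiplier itself.\<close>

lemma cdim_multiplier:
  fixes \<sigma> :: "'a \<Rightarrow> complex"
  assumes nz: "\<And>x. \<sigma> x \<noteq> 0"
  shows "cdim V \<le> cdim ((\<lambda>f x. \<sigma> x * f x) ` V)"
proof (rule enat_le_if)
  fix n assume "enat n \<le> cdim V"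
  then obtain B where B: "B \<subseteq> V" "finite B" "cfun.independent B" "card B = n"
    by (rule le_cdimE)
  define U where "U = (\<lambda>f x. \<sigma> x * f x)"
  have inj: "inj_on U B"
    by (rule inj_onI) (use nz in \<open>auto simp: U_def fun_eq_iff\<close>)
  have "cfun.independent (U ` B)"
  proof (rule cfun.independent_if_scalars_zero)
    fix f x assume s: "(\<Sum>x\<in>U ` B. fun_scale (f x) x) = 0" and "x \<in> U ` B"
    then obtain b where b: "b \<in> B" "x = U b" by blast
    have "comb (U ` B) f (\<lambda>x. x) = (\<lambda>_. 0)" using s unfolding sum_fun_scale by (simp add: zero_fun_def)
    then have "comb B (\<lambda>b. f (U b)) U = (\<lambda>_. 0)"
      unfolding comb_def sum.reindex[OF inj] o_def .
    then have "\<sigma> y * comb B (\<lambda>b. f (U b)) (\<lambda>b. b) y = 0" for y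
      by (simp add: comb_def U_def fun_eq_iff sum_distrib_left mult_ac)
    then have "comb B (\<lambda>b. f (U b)) (\<lambda>b. b) = (\<lambda>_. 0)" using nz by (simp add: fun_eq_iff)
    from comb_independent[OF B(2,3) this b(1)] show "f x = 0" by (simp add: b(2))
  qed (use B in auto)
  moreover have "U ` B \<subseteq> U ` V" using B(1) by blast
  ultimately have "enat (card (U ` B)) \<le> cdim (U ` V)" using B(2) by (intro cdim_ge) auto
  then have "enat n \<le> cdim (U ` V)" unfolding card_image[OF inj] B(4) .
  then show "enat n \<le> cdim ((\<lambda>f x. \<sigma> x * f x) ` V)" unfolding U_def .
qed

section \<open>The two-particle Hamiltonian as a convolution operator\<close>

context dispersion
begin

text \<open>The Fourier coefficients of \<open>disp \<epsilon> k\<close>: by evenness of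
  \<open>\<epsilon>_hat\<close> the two phases coming from \<open>k / 2\<close> combine into a
  cosine. Being real and even, they give a symmetric lattice kernel.\<close>

definition disp_coeff where "disp_coeff k x = 2 * \<epsilon>_hat x * cos (lattice_pair k x / 2)"

lemma disp_coeff_l1: "(\<lambda>x. \<bar>disp_coeff k x\<bar>) summable_on UNIV"
proof (rule summable_on_comparison_test)
  show "(\<lambda>x. 2 * \<bar>\<epsilon>_hat x\<bar>) summable_on UNIV" by (intro summable_on_cmult_right hat_l1)
  show "\<bar>disp_coeff k x\<bar> \<le> 2 * \<bar>\<epsilon>_hat x\<bar>" for x
    using mult_left_mono[OF abs_cos_le_one, of "2 * \<bar>\<epsilon>_hat x\<bar>" "lattice_pair k x / 2"]
    by (simp add: disp_coeff_def abs_mult)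
qed simp

lemma disp_coeff_even: "disp_coeff k (- x) = disp_coeff k x"
  by (simp add: disp_coeff_def hat_even lattice_pair_simps)

lemma ft_disp_coeff: "ft (\<lambda>x. of_real (disp_coeff k x)) p = of_real (disp \<epsilon> k p)"
proof -
  have bij: "bij_betw uminus (UNIV :: (int ^ 'd) set) UNIV"
    by (rule bij_betw_byWitness[of _ uminus]) auto
  have "((\<lambda>x. cis (lattice_pair (k /\<^sub>R 2 + p) (- x)) * of_real (\<epsilon>_hat (- x))) has_sum complex_of_real (\<epsilon> (k /\<^sub>R 2 + p))) UNIV"
    using series[of "k /\<^sub>R 2 + p"] has_sum_reindex_bij_betw[OF bij, of "\<lambda>x. cis (lattice_pair (k /\<^sub>R 2 + p) x) * of_real (\<epsilon>_hat x)"] by simp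
  from has_sum_add[OF this series[of "k /\<^sub>R 2 - p"]]
  have "((\<lambda>x. cis (lattice_pair (k /\<^sub>R 2 + p) (- x)) * of_real (\<epsilon>_hat (- x)) + cis (lattice_pair (k /\<^sub>R 2 - p) x) * of_real (\<epsilon>_hat x))
     has_sum complex_of_real (disp \<epsilon> k p)) UNIV" by (simp add: disp_def)
  moreover have "cis (lattice_pair (k /\<^sub>R 2 + p) (- x)) * of_real (\<epsilon>_hat (- x)) + cis (lattice_pair (k /\<^sub>R 2 - p) x) * of_real (\<epsilon>_hat x)
      = of_real (disp_coeff k x) * cis (- lattice_pair p x)" for x
  proof -
    define t where "t = lattice_pair k x / 2"
    have "cis (- t) + cis t = complex_of_real (2 * cos t)" by (simp add: complex_eq_iff)
    then have "(cis (- t) + cis t) * cis (- lattice_pair p x) * of_real (\<epsilon>_hat x) = of_real (disp_coeff k x) * cis (- lattice_pair p x)"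
      by (simp add: disp_coeff_def t_def)
    moreover have "cis (lattice_pair (k /\<^sub>R 2 + p) (- x)) = cis (- t) * cis (- lattice_pair p x)"
      "cis (lattice_pair (k /\<^sub>R 2 - p) x) = cis t * cis (- lattice_pair p x)"
      by (simp_all add: lattice_pair_simps t_def cis_mult)
    ultimately show ?thesis by (simp add: hat_even algebra_simps)
  qed
  ultimately show ?thesis unfolding ft_def by (simp add: infsumI)
qed

lemma disp_hat_eq: "disp_hat \<epsilon> k x = of_real (disp_coeff k x)"
proof -
  have "disp_hat \<epsilon> k x = fc (ft (\<lambda>x. of_real (disp_coeff k x))) (- x)"
    unfolding fc_def ft_disp_coeff disp_hat_def by (simp add: lattice_pair_simps)
  also have "\<dots> = of_real (disp_coeff k (- x))"
    by (rule fc_ft) (use disp_coeff_l1[of k] in simp)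
  finally show ?thesis by (simp add: disp_coeff_even)
qed

lemma H0_eq: "H0 \<epsilon> k f = convol (disp_coeff k) f"
  by (simp add: H0_def convol_def disp_hat_eq fun_eq_iff)

text \<open>
  Points of the torus near \<open>k\<close> may wrap around the box, which is not harmless because \<open>k / 2\<close> then
  jumps by half a period. Conjugation by the character \<open>(-1)\<^bsup>n x\<^esup>\<close> compensates for this jump.
\<close>

lemma H_shift:
  fixes v :: "int ^ 'd \<Rightarrow> real" and n :: "int ^ 'd"
  defines "\<sigma> \<equiv> (\<lambda>x. complex_of_real (cos (pi * of_int (idot n x))))"
  shows "H \<epsilon> v \<mu> (k - shift n) (\<lambda>x. \<sigma> x * f x) = (\<lambda>x. \<sigma> x * H \<epsilon> v \<mu> k f x)"
proof
  fix x
  have s0: "sin (pi * of_int i) = 0" for i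
    using sin_times_pi_eq_0[of "of_int i"] by (simp add: mult.commute)
  have add: "cos (pi * of_int (i + j)) = cos (pi * of_int i) * cos (pi * of_int j)" for i j
    by (simp add: distrib_left cos_add s0)
  have sq: "cos (pi * of_int i) * cos (pi * of_int i) = 1" for i
    using sin_cos_squared_add3[of "pi * of_int i"] by (simp add: s0)
  have idot: "idot n (x - s) + idot n s = idot n x" for s
    by (simp add: idot_def algebra_simps flip: sum.distrib)
  have K: "of_real (disp_coeff (k - shift n) (x - s)) * \<sigma> s = \<sigma> x * of_real (disp_coeff k (x - s))" for s
  proof -
    have L: "lattice_pair (k - shift n) (x - s) / 2 = lattice_pair k (x - s) / 2 - pi * of_int (idot n (x - s))"
      by (simp add: lattice_pair_simps(6) lattice_pair_shift diff_divide_distrib)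
    have "disp_coeff (k - shift n) (x - s) = disp_coeff k (x - s) * cos (pi * of_int (idot n (x - s)))"
      unfolding disp_coeff_def L cos_diff s0 by (simp only: mult_zero_right add_0_right mult.assoc)
    moreover have "cos (pi * of_int (idot n (x - s))) * cos (pi * of_int (idot n s)) = cos (pi * of_int (idot n x))"
      using add[of "idot n (x - s)" "idot n s"] by (simp only: idot)
    ultimately have "disp_coeff (k - shift n) (x - s) * cos (pi * of_int (idot n s)) = cos (pi * of_int (idot n x)) * disp_coeff k (x - s)"
      by (simp only: mult.assoc) (simp add: mult.commute)
    then show ?thesis unfolding \<sigma>_def of_real_mult[symmetric] by (simp only:)
  qed
  have "H0 \<epsilon> (k - shift n) (\<lambda>x. \<sigma> x * f x) x = (\<Sum>\<^sub>\<infinity>s. \<sigma> x * (of_real (disp_coeff k (x - s)) * f s))"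
    unfolding H0_eq convol_def by (rule infsum_cong) (simp only: mult.assoc[symmetric] K)
  also have "\<dots> = \<sigma> x * H0 \<epsilon> k f x" unfolding H0_eq convol_def by (rule infsum_cmult_right')
  finally show "H \<epsilon> v \<mu> (k - shift n) (\<lambda>x. \<sigma> x * f x) x = \<sigma> x * H \<epsilon> v \<mu> k f x"
    by (simp add: H_def algebra_simps)
qed

lemma eigenvalues_shift:
  fixes v :: "int ^ 'd \<Rightarrow> real"
  shows "eigenvalues_below (H \<epsilon> v \<mu> (k - shift n)) z = eigenvalues_below (H \<epsilon> v \<mu> k) z"
proof -
  define \<sigma> where "\<sigma> = (\<lambda>(n :: int ^ 'd) x. complex_of_real (cos (pi * of_int (idot n x))))"
  have cs: "(cos (pi * of_int i))\<^sup>2 = 1" for i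
  proof -
    have "sin (pi * of_int i) = 0"
      using sin_times_pi_eq_0[of "of_int i"] by (simp add: mult.commute)
    then show ?thesis using sin_cos_squared_add[of "pi * of_int i"] by simp
  qed
  have sq: "\<sigma> n x * \<sigma> n x = 1" for n x
    unfolding \<sigma>_def of_real_mult[symmetric] using cs[of "idot n x"] by (simp add: power2_eq_square)
  have nz: "\<sigma> n x \<noteq> 0" for n x using sq[of n x] by auto
  have neg: "\<sigma> (- n) = \<sigma> n" for n by (simp add: \<sigma>_def idot_def sum_negf fun_eq_iff)
  have ev: "\<sigma> n (- x) = \<sigma> n x" for n x by (simp add: \<sigma>_def idot_def sum_negf)
  have cm: "cmod (\<sigma> n x) \<le> 1" for n x unfolding \<sigma>_def norm_of_real by (rule abs_cos_le_one)
  \<comment> \<open>Stated for all \<open>k\<close> and \<open>n\<close> so as to give the converse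
    inclusion too: the shift by \<open>- n\<close> undoes the one by \<open>n\<close>, with the same
    sign \<sigma>.\<close>
  have fwd: "(\<lambda>x. \<sigma> n x * f x) \<in> eigenspace (H \<epsilon> v \<mu> (k - shift n)) w" if f: "f \<in> eigenspace (H \<epsilon> v \<mu> k) w" for f k n w
  proof -
    have fl: "f \<in> l2e" and Hf: "H \<epsilon> v \<mu> k f = fun_scale (of_real w) f" using f by (auto simp: eigenspace_def)
    have "(\<lambda>x. \<sigma> n x * f x) \<in> l2e"
    proof (rule l2eI)
      show "(\<lambda>x. \<sigma> n x * f x) \<in> ell2"
        by (rule ell2_le(1)[OF l2e_ell2[OF fl], of _ 1]) (use cm in \<open>auto simp: norm_mult mult_left_le_one_le\<close>)
      show "\<sigma> n (- x) * f (- x) = \<sigma> n x * f x" for x by (simp add: ev l2e_even[OF fl])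
    qed
    moreover have "H \<epsilon> v \<mu> (k - shift n) (\<lambda>x. \<sigma> n x * f x) = fun_scale (of_real w) (\<lambda>x. \<sigma> n x * f x)"
      unfolding \<sigma>_def H_shift Hf by (simp add: fun_scale_def mult_ac)
    ultimately show ?thesis by (simp add: eigenspace_def)
  qed
  have unshift: "k - shift n - shift (- n) = k" by (simp add: shift_def vec_eq_iff)
  have img: "eigenspace (H \<epsilon> v \<mu> (k - shift n)) w = (\<lambda>f x. \<sigma> n x * f x) ` eigenspace (H \<epsilon> v \<mu> k) w" for w
  proof (intro equalityI subsetI)
    fix f assume f: "f \<in> eigenspace (H \<epsilon> v \<mu> (k - shift n)) w"
    have "(\<lambda>x. \<sigma> n x * f x) \<in> eigenspace (H \<epsilon> v \<mu> k) w"
      using fwd[OF f, of "- n"] unfolding unshift neg .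
    moreover have "f = (\<lambda>x. \<sigma> n x * (\<sigma> n x * f x))" by (simp add: sq flip: mult.assoc)
    ultimately show "f \<in> (\<lambda>f x. \<sigma> n x * f x) ` eigenspace (H \<epsilon> v \<mu> k) w" by (metis imageI)
  qed (use fwd in auto)
  have img2: "eigenspace (H \<epsilon> v \<mu> k) w = (\<lambda>f x. \<sigma> n x * f x) ` eigenspace (H \<epsilon> v \<mu> (k - shift n)) w" for w
    unfolding img image_image by (simp add: sq flip: mult.assoc)
  have dim: "cdim (eigenspace (H \<epsilon> v \<mu> (k - shift n)) w) = cdim (eigenspace (H \<epsilon> v \<mu> k) w)" for w
    using cdim_multiplier[of "\<sigma> n" "eigenspace (H \<epsilon> v \<mu> k) w"] cdim_multiplier[of "\<sigma> n" "eigenspace (H \<epsilon> v \<mu> (k - shift n)) w"] nz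
    unfolding img[symmetric] img2[symmetric] by (intro order.antisym) auto
  have ie: "is_eigenvalue (H \<epsilon> v \<mu> (k - shift n)) w \<longleftrightarrow> is_eigenvalue (H \<epsilon> v \<mu> k) w" for w
  proof -
    have "(\<lambda>x. \<sigma> n x * f x) \<noteq> (\<lambda>_. 0) \<longleftrightarrow> f \<noteq> (\<lambda>_. 0)" for f using nz by (simp add: fun_eq_iff)
    then show ?thesis unfolding is_eigenvalue_def img by auto
  qed
  show ?thesis unfolding eigenvalues_below_def ie dim ..
qed

lemma lattice_ham_gap:
  assumes w: "(\<lambda>x. (w x)\<^sup>2) summable_on UNIV" "\<And>x. w (- x) = w x" and \<mu>: "\<mu> > 0"
    and k: "AE p in haar. gap k p > 0" "integrable haar (\<lambda>p. 1 / gap k p)"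
  shows "lattice_ham w (gap k) \<mu> (disp_coeff k) (disp_min \<epsilon> k)"
proof
  show "gap k (- p) = gap k p" for p by (simp add: gap_def disp_def add.commute)
  show "ft (\<lambda>x. of_real (disp_coeff k x)) q = of_real (gap k q + disp_min \<epsilon> k)" for q
    by (simp add: ft_disp_coeff gap_def)
qed (use w \<mu> k gap_measurable gap_nonneg disp_coeff_l1 disp_coeff_even in auto)

text \<open>The sign of the potential enters through
  \<open>v x = - (sqrt \<bar>v x\<bar>)^2\<close>, which identifies \<open>T\<close> with the
  threshold minus the Hamiltonian.\<close>

lemma count_iff_positive_family:
  fixes v :: "int ^ 'd \<Rightarrow> real"
  assumes v: "(\<lambda>x. \<bar>v x\<bar>) summable_on UNIV" "\<And>x. v x \<le> 0" "\<And>x. v (- x) = v x" and \<mu>: "\<mu> > 0"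
    and k: "AE p in haar. gap k p > 0" "integrable haar (\<lambda>p. 1 / gap k p)"
  shows "enat m \<le> eigenvalues_below (H \<epsilon> v \<mu> k) (disp_min \<epsilon> k) \<longleftrightarrow>
    positive_family (\<lambda>g. bs_form (\<lambda>x. sqrt \<bar>v x\<bar>) (gap k) \<mu> g - n2 g) m"
proof -
  interpret lattice_ham "\<lambda>x. sqrt \<bar>v x\<bar>" "gap k" \<mu> "disp_coeff k" "disp_min \<epsilon> k"
    by (rule lattice_ham_gap) (use v \<mu> k in auto)
  have TH: "T f = (\<lambda>x. of_real (disp_min \<epsilon> k) * f x - H \<epsilon> v \<mu> k f x)" for f
  proof
    fix x
    have "complex_of_real (sqrt \<bar>v x\<bar>) * of_real (sqrt \<bar>v x\<bar>) = of_real (- v x)"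
      using v(2)[of x] unfolding of_real_mult[symmetric] by simp
    then have "wmul (\<lambda>x. sqrt \<bar>v x\<bar>) (wmul (\<lambda>x. sqrt \<bar>v x\<bar>) f) x = of_real (- v x) * f x"
      unfolding wmul_def mult.assoc[symmetric] by (simp only:)
    then show "T f x = of_real (disp_min \<epsilon> k) * f x - H \<epsilon> v \<mu> k f x"
      by (simp add: T_def A_def H_def H0_eq)
  qed
  show ?thesis
    unfolding birman_schwinger[symmetric] by (rule eigenvalues_below_iff[OF usc_form_op_T TH])
qed

text \<open>The kernel is a convolution kernel between two factors
  \<open>sqrt \<bar>v\<bar>\<close>, so \<open>convolution_fc\<close> applies with the inverse gap
  for \<open>F\<close>.\<close>

lemma BS_eq:
  fixes v :: "int ^ 'd \<Rightarrow> real"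
  assumes "threshold (\<lambda>x. sqrt \<bar>v x\<bar>) (gap k) \<mu>" and f: "f \<in> ell2"
  shows "BS \<epsilon> v \<mu> k f = threshold.B (\<lambda>x. sqrt \<bar>v x\<bar>) (gap k) \<mu> f"
proof
  interpret threshold "\<lambda>x. sqrt \<bar>v x\<bar>" "gap k" \<mu> by fact
  fix x
  define F where "F = (\<lambda>q. complex_of_real (1 / gap k q))"
  have F: "integrable haar F" unfolding F_def by (rule integrable_of_real[OF a_inv])
  define u where "u = wmul (\<lambda>x. sqrt \<bar>v x\<bar>) f"
  have "((\<lambda>s. u (x - s) * fc F s) has_sum fc (\<lambda>q. ft u q * F q) x) UNIV"
    by (rule convolution_fc[OF _ F]) (simp add: u_def wmul_summable[OF f])
  then have "((\<lambda>y. u y * fc F (x - y)) has_sum fc (\<lambda>q. ft u q * F q) x) UNIV"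
    using has_sum_reindex_bij_betw[OF bij_diff[of x], of "\<lambda>y. u y * fc F (x - y)"] by simp
  then have s: "(\<Sum>\<^sub>\<infinity>y. u y * fc F (x - y)) = fc (\<lambda>q. ft u q * F q) x" by (rule infsumI)
  have r: "(\<lambda>q. ft u q * F q) = res f" by (simp add: res_def u_def F_def fun_eq_iff)
  have "BS_kernel \<epsilon> v \<mu> k x y * f y = of_real (\<mu> * sqrt \<bar>v x\<bar>) * (u y * fc F (x - y))" for y
  proof -
    have "(LINT q|haar. cis (lattice_pair q (x - y)) / of_real (disp \<epsilon> k q - disp_min \<epsilon> k)) = fc F (x - y)"
      by (simp add: fc_def F_def gap_def divide_inverse)
    then show ?thesis by (simp add: BS_kernel_def u_def wmul_def)
  qed
  then have "BS \<epsilon> v \<mu> k f x = of_real (\<mu> * sqrt \<bar>v x\<bar>) * (\<Sum>\<^sub>\<infinity>y. u y * fc F (x - y))"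
    unfolding BS_def by (simp only: infsum_cmult_right')
  then show "BS \<epsilon> v \<mu> k f x = B f x" unfolding s r by (simp only: B_def)
qed

text \<open>The tolerance \<eta> is split in halves between changing \<open>k\<close> at fixed \<mu>
  and changing \<mu> at \<open>k0\<close>. The motion of the threshold with \<open>k\<close> is
  already contained in the gap.\<close>

lemma local_constancy:
  fixes v :: "int ^ 'd \<Rightarrow> real"
  assumes dim: "CARD('d) \<ge> 3" and mo: "morse (disp \<epsilon> k0)"
    and v: "(\<lambda>x. \<bar>v x\<bar>) summable_on UNIV" "\<And>x. v x \<le> 0" "\<And>x. v (- x) = v x"
    and \<mu>0: "\<mu>0 > 0" and reg: "regular_threshold \<epsilon> v \<mu>0 k0"
  shows "\<exists>\<rho> d. \<rho> > 0 \<and> \<rho> \<le> \<mu>0 \<and> d > 0 \<and> (\<forall>\<mu>\<in>ball \<mu>0 \<rho>. \<forall>k\<in>ball k0 d.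
    eigenvalues_below (H \<epsilon> v \<mu> k) (disp_min \<epsilon> k) = eigenvalues_below (H \<epsilon> v \<mu>0 k0) (disp_min \<epsilon> k0))"
proof -
  define w where "w = (\<lambda>x. sqrt \<bar>v x\<bar>)"
  have w: "(\<lambda>x. (w x)\<^sup>2) summable_on UNIV" "\<And>x. w (- x) = w x" using v by (auto simp: w_def)
  obtain d0 where d0: "d0 > 0"
    and I: "\<And>k. k \<in> ball k0 d0 \<Longrightarrow> (AE p in haar. gap k p > 0) \<and> integrable haar (\<lambda>p. 1 / gap k p)"
    and L: "\<And>r. r > 0 \<Longrightarrow> \<exists>d>0. \<forall>k\<in>ball k0 d. k \<in> ball k0 d0 \<longrightarrow> (LINT p|haar. \<bar>1 / gap k p - 1 / gap k0 p\<bar>) \<le> r"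
    using inverse_gap_L1[OF dim mo] by blast
  have k00: "k0 \<in> ball k0 d0" using d0 by simp
  interpret lattice_ham w "gap k0" \<mu>0 "disp_coeff k0" "disp_min \<epsilon> k0"
    by (rule lattice_ham_gap[OF w \<mu>0]) (use I[OF k00] in auto)
  have "f = (\<lambda>_. 0)" if f: "f \<in> l2e" "B f = f" for f
  proof (rule ccontr)
    assume "f \<noteq> (\<lambda>_. 0)"
    moreover have "BS \<epsilon> v \<mu>0 k0 f = f"
      using BS_eq[of v k0 \<mu>0 f] f l2e_ell2[OF f(1)] threshold_axioms by (simp add: w_def)
    ultimately have "is_eigenvalue (BS \<epsilon> v \<mu>0 k0) 1"
      using f(1) by (auto simp: is_eigenvalue_def eigenspace_def fun_scale_def intro!: bexI[of _ f])
    then show False using reg by (simp add: regular_threshold_def)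
  qed
  then obtain \<eta> where \<eta>: "\<eta> > 0" and P: "\<And>Q m. \<forall>g\<in>ell2. \<bar>Q g - bs_form w (gap k0) \<mu>0 g\<bar> \<le> \<eta> * n2 g \<Longrightarrow>
    positive_family (\<lambda>g. Q g - n2 g) m \<longleftrightarrow> positive_family (\<lambda>g. bs_form w (gap k0) \<mu>0 g - n2 g) m"
    using bs_form_perturb by blast
  \<comment> \<open>Dominates \<open>\<mu> * W\<close> for \<open>\<mu> \<le> 2 * \<mu>0\<close>;
    the \<open>+ 1\<close> guards against \<open>W = 0\<close>, as it does in
    \<open>E\<close>.\<close>
  define D where "D = 2 * \<mu>0 * W + 1"
  have D: "D > 0" using \<mu>0 W_nonneg by (simp add: D_def add_nonneg_pos)
  define r where "r = \<eta> / (2 * D)"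
  have r: "r > 0" using \<eta> D by (simp add: r_def)
  obtain d1 where d1: "d1 > 0" "\<And>k. k \<in> ball k0 d1 \<Longrightarrow> k \<in> ball k0 d0 \<Longrightarrow> (LINT p|haar. \<bar>1 / gap k p - 1 / gap k0 p\<bar>) \<le> r"
    using L[OF r] by blast
  have WJ: "W * J \<ge> 0" using W_nonneg J_nonneg by simp
  define E where "E = W * J + 1"
  have E: "E > 0" using WJ by (simp add: E_def)
  \<comment> \<open>The first bound keeps \<mu> positive and at most \<open>2 * \<mu>0\<close>; the
    second makes the change of \<mu> cost at most \<open>\<eta> / 2\<close>.\<close>
  define \<rho> where "\<rho> = min \<mu>0 (\<eta> / (2 * E))"
  have \<rho>: "\<rho> > 0" "\<rho> \<le> \<mu>0" using \<mu>0 \<eta> E by (auto simp: \<rho>_def)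
  have "eigenvalues_below (H \<epsilon> v \<mu> k) (disp_min \<epsilon> k) = eigenvalues_below (H \<epsilon> v \<mu>0 k0) (disp_min \<epsilon> k0)"
    if \<mu>: "\<mu> \<in> ball \<mu>0 \<rho>" and k: "k \<in> ball k0 (min d0 d1)" for \<mu> k
  proof -
    have kd: "k \<in> ball k0 d0" "k \<in> ball k0 d1" using k by auto
    have m1: "\<bar>\<mu> - \<mu>0\<bar> < \<rho>" using \<mu> by (simp add: dist_real_def abs_minus_commute)
    then have m2: "\<mu> > 0" "\<mu> \<le> 2 * \<mu>0" using \<rho> by linarith+
    have close: "\<bar>bs_form w (gap k) \<mu> g - bs_form w (gap k0) \<mu>0 g\<bar> \<le> \<eta> * n2 g" if g: "g \<in> ell2" for g
    proof -
      define X where "X = (LINT q|haar. (cmod (ft (wmul w g) q))\<^sup>2 / gap k0 q)"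
      have X0: "X \<ge> 0" unfolding X_def by (rule Bochner_Integration.integral_nonneg) (simp add: gap_nonneg)
      have "\<mu>0 * X \<le> \<mu>0 * (W * J * n2 g)"
        using bs_form_bound[OF g] by (simp add: bs_form_def X_def mult.assoc)
      then have X1: "X \<le> W * J * n2 g" using \<mu>0 by simp
      have "\<bar>bs_form w (gap k) \<mu> g - bs_form w (gap k0) \<mu> g\<bar> \<le> \<mu> * W * (LINT q|haar. \<bar>1 / gap k q - 1 / gap k0 q\<bar>) * n2 g"
        by (rule bs_form_diff) (use g gap_measurable I[OF kd(1)] I[OF k00] m2 in auto)
      also have "\<dots> \<le> \<eta> / 2 * n2 g"
      proof (rule mult_right_mono[OF _ n2_nonneg])
        have "\<mu> * W * (LINT q|haar. \<bar>1 / gap k q - 1 / gap k0 q\<bar>) \<le> (2 * \<mu>0 * W) * r"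
          using d1(2)[OF kd(2,1)] m2 W_nonneg r \<mu>0
          by (intro mult_mono) (auto intro!: Bochner_Integration.integral_nonneg mult_right_mono)
        also have "\<dots> \<le> D * r" using r by (simp add: D_def distrib_right)
        also have "\<dots> = \<eta> / 2" using D by (simp add: r_def)
        finally show "\<mu> * W * (LINT q|haar. \<bar>1 / gap k q - 1 / gap k0 q\<bar>) \<le> \<eta> / 2" .
      qed
      finally have 1: "\<bar>bs_form w (gap k) \<mu> g - bs_form w (gap k0) \<mu> g\<bar> \<le> \<eta> / 2 * n2 g" .
      have "\<bar>bs_form w (gap k0) \<mu> g - bs_form w (gap k0) \<mu>0 g\<bar> = \<bar>\<mu> - \<mu>0\<bar> * X"
        using X0 by (simp add: bs_form_def X_def[symmetric] abs_mult flip: left_diff_distrib)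
      also have "\<dots> \<le> (\<eta> / (2 * E)) * (W * J * n2 g)"
        using m1 X0 X1 by (intro mult_mono) (auto simp: \<rho>_def)
      also have "\<dots> \<le> \<eta> / 2 * n2 g"
      proof -
        have "(\<eta> / (2 * E)) * (W * J) \<le> (\<eta> / (2 * E)) * E"
          using \<eta> E by (intro mult_left_mono) (auto simp: E_def)
        also have "\<dots> = \<eta> / 2" using E by simp
        finally show ?thesis unfolding mult.assoc[symmetric] by (rule mult_right_mono[OF _ n2_nonneg])
      qed
      finally have 2: "\<bar>bs_form w (gap k0) \<mu> g - bs_form w (gap k0) \<mu>0 g\<bar> \<le> \<eta> / 2 * n2 g" .
      have "\<eta> * n2 g = \<eta> / 2 * n2 g + \<eta> / 2 * n2 g" by simp
      then show ?thesis using 1 2 by linarith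
    qed
    have iff: "enat m \<le> eigenvalues_below (H \<epsilon> v \<mu> k) (disp_min \<epsilon> k) \<longleftrightarrow> enat m \<le> eigenvalues_below (H \<epsilon> v \<mu>0 k0) (disp_min \<epsilon> k0)" for m
    proof -
      have "enat m \<le> eigenvalues_below (H \<epsilon> v \<mu> k) (disp_min \<epsilon> k) \<longleftrightarrow> positive_family (\<lambda>g. bs_form w (gap k) \<mu> g - n2 g) m"
        unfolding w_def by (rule count_iff_positive_family) (use v m2 I[OF kd(1)] in auto)
      also have "\<dots> \<longleftrightarrow> positive_family (\<lambda>g. bs_form w (gap k0) \<mu>0 g - n2 g) m"
        by (rule P) (use close in blast)
      also have "\<dots> \<longleftrightarrow> enat m \<le> eigenvalues_below (H \<epsilon> v \<mu>0 k0) (disp_min \<epsilon> k0)"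
        unfolding w_def by (rule count_iff_positive_family[symmetric]) (use v \<mu>0 I[OF k00] in auto)
      finally show ?thesis .
    qed
    show ?thesis
    proof (rule order.antisym)
      show "eigenvalues_below (H \<epsilon> v \<mu> k) (disp_min \<epsilon> k) \<le> eigenvalues_below (H \<epsilon> v \<mu>0 k0) (disp_min \<epsilon> k0)"
        by (rule enat_le_if) (simp only: iff)
      show "eigenvalues_below (H \<epsilon> v \<mu>0 k0) (disp_min \<epsilon> k0) \<le> eigenvalues_below (H \<epsilon> v \<mu> k) (disp_min \<epsilon> k)"
        by (rule enat_le_if) (simp only: iff)
    qed
  qed
  then have "\<forall>\<mu>\<in>ball \<mu>0 \<rho>. \<forall>k\<in>ball k0 (min d0 d1).
    eigenvalues_below (H \<epsilon> v \<mu> k) (disp_min \<epsilon> k) = eigenvalues_below (H \<epsilon> v \<mu>0 k0) (disp_min \<epsilon> k0)"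
    by blast
  moreover have "min d0 d1 > 0" using d0 d1(1) by simp
  ultimately show ?thesis using \<rho> by blast
qed

end

lemma torus_open_Union: "(\<And>U. U \<in> \<U> \<Longrightarrow> torus_open U) \<Longrightarrow> torus_open (\<Union>\<U>)"
  unfolding torus_open_def by (auto simp: vimage_Union)

lemma torus_open_Int: "torus_open U \<Longrightarrow> torus_open V \<Longrightarrow> torus_open (U \<inter> V)"
  unfolding torus_open_def by (auto simp: vimage_Int)

theorem theorem4p9:
  fixes \<epsilon> :: "real ^ 'd \<Rightarrow> real"
    and \<epsilon>_hat v_hat :: "int ^ 'd \<Rightarrow> real"
    and \<mu>\<^sub>0 :: real
    and k\<^sub>0 :: "real ^ 'd"
  assumes dim: "CARD('d) \<ge> 3"
    and eps_hat_l1: "(\<lambda>x. \<bar>\<epsilon>_hat x\<bar>) summable_on UNIV"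
    and eps_hat_even: "\<And>x. \<epsilon>_hat (- x) = \<epsilon>_hat x"
    and eps_series: "\<And>p. ((\<lambda>x. cis (lattice_pair p x) * of_real (\<epsilon>_hat x))
                          has_sum complex_of_real (\<epsilon> p)) UNIV"
    and eps_C3: "Ck 3 \<epsilon>"
    and eps_even: "\<And>p. \<epsilon> (- p) = \<epsilon> p"
    and eps_morse: "morse \<epsilon>"
    and eps_unique_min: "\<And>p. p \<in> torus \<Longrightarrow> p \<noteq> 0 \<Longrightarrow> \<epsilon> 0 < \<epsilon> p"
    and v_l1: "(\<lambda>x. \<bar>v_hat x\<bar>) summable_on UNIV"
    and v_nonpos: "\<And>x. v_hat x \<le> 0"
    and v_even: "\<And>x. v_hat (- x) = v_hat x"
    and mu0: "\<mu>\<^sub>0 > 0"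
    and k0: "k\<^sub>0 \<in> GG \<epsilon>"
    and regular: "regular_threshold \<epsilon> v_hat \<mu>\<^sub>0 k\<^sub>0"
  shows "\<exists>U G. open U \<and> \<mu>\<^sub>0 \<in> U \<and> U \<subseteq> {0<..} \<and>
    torus_open G \<and> k\<^sub>0 \<in> G \<and> G \<subseteq> GG \<epsilon> \<and>
    (\<forall>\<mu>\<in>U. \<forall>\<mu>'\<in>U. \<forall>k\<in>G. \<forall>k'\<in>G.
      eigenvalues_below (H \<epsilon> v_hat \<mu> k) (disp_min \<epsilon> k)
      = eigenvalues_below (H \<epsilon> v_hat \<mu>' k') (disp_min \<epsilon> k'))"
proof -
  interpret dispersion \<epsilon> \<epsilon>_hat
    by unfold_locales (use eps_hat_l1 eps_hat_even eps_series Ck3_twice_diff[OF eps_C3] eps_even in auto)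
  obtain U0 where U0: "torus_open U0" "k\<^sub>0 \<in> U0" "morse (disp \<epsilon> k\<^sub>0)"
    using k0 by (auto simp: GG_def)
  have k0t: "k\<^sub>0 \<in> torus" using U0 by (auto simp: torus_open_def)
  obtain \<rho> d where \<rho>: "\<rho> > 0" "\<rho> \<le> \<mu>\<^sub>0" and d: "d > 0" and
    const: "\<And>\<mu> k. \<mu> \<in> ball \<mu>\<^sub>0 \<rho> \<Longrightarrow> k \<in> ball k\<^sub>0 d \<Longrightarrow>
      eigenvalues_below (H \<epsilon> v_hat \<mu> k) (disp_min \<epsilon> k) = eigenvalues_below (H \<epsilon> v_hat \<mu>\<^sub>0 k\<^sub>0) (disp_min \<epsilon> k\<^sub>0)"
    using local_constancy[OF dim U0(3) v_l1 v_nonpos v_even mu0 regular] by blast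
  define G0 where "G0 = {k \<in> torus. \<exists>n. k + shift n \<in> ball k\<^sub>0 d}"
  have G0: "torus_open G0"
    unfolding torus_open_def
  proof
    have "torus_proj -` G0 = (\<Union>n. {x. x + shift n \<in> ball k\<^sub>0 d})"
    proof (intro equalityI subsetI)
      fix x assume "x \<in> torus_proj -` G0"
      then obtain n where n: "torus_proj x + shift n \<in> ball k\<^sub>0 d" by (auto simp: G0_def)
      obtain m where "torus_proj x = x - shift m" using torus_proj_shift by blast
      moreover have "x - shift m + shift n = x + shift (n - m)" by (simp add: shift_def vec_eq_iff algebra_simps)
      ultimately have "x + shift (n - m) \<in> ball k\<^sub>0 d" using n by (simp only:)
      then show "x \<in> (\<Union>n. {x. x + shift n \<in> ball k\<^sub>0 d})" by blast
    next
      fix x assume "x \<in> (\<Union>n. {x. x + shift n \<in> ball k\<^sub>0 d})"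
      then obtain n where n: "x + shift n \<in> ball k\<^sub>0 d" by blast
      obtain m where "torus_proj x = x - shift m" using torus_proj_shift by blast
      moreover have "x - shift m + shift (n + m) = x + shift n" by (simp add: shift_def vec_eq_iff algebra_simps)
      ultimately have "torus_proj x + shift (n + m) \<in> ball k\<^sub>0 d" using n by (simp only:)
      then show "x \<in> torus_proj -` G0" using torus_proj_in_torus by (auto simp: G0_def)
    qed
    moreover have "open {x. x + shift n \<in> ball k\<^sub>0 d}" for n
      using open_vimage[OF open_ball, of "\<lambda>x. x + shift n" k\<^sub>0 d]
      by (simp add: vimage_def continuous_on_add)
    ultimately show "open (torus_proj -` G0)" by auto
  qed (auto simp: G0_def)
  define G where "G = G0 \<inter> GG \<epsilon>"
  have "torus_open (GG \<epsilon>)" unfolding GG_def by (rule torus_open_Union) auto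
  then have Gopen: "torus_open G" unfolding G_def by (intro torus_open_Int G0)
  have "k\<^sub>0 + shift 0 \<in> ball k\<^sub>0 d" using d by (simp add: shift_def zero_vec_def[symmetric])
  then have kG: "k\<^sub>0 \<in> G" using k0 k0t by (auto simp: G_def G0_def)
  have val: "eigenvalues_below (H \<epsilon> v_hat \<mu> k) (disp_min \<epsilon> k) = eigenvalues_below (H \<epsilon> v_hat \<mu>\<^sub>0 k\<^sub>0) (disp_min \<epsilon> k\<^sub>0)"
    if "\<mu> \<in> ball \<mu>\<^sub>0 \<rho>" "k \<in> G" for \<mu> k
  proof -
    \<comment> \<open>A representative inside the ball, where constancy is known; neither the count
      nor the threshold changes under the period.\<close>
    obtain n where n: "k + shift n \<in> ball k\<^sub>0 d" using \<open>k \<in> G\<close> by (auto simp: G_def G0_def)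
    have e: "k = (k + shift n) - shift n" by simp
    have "eigenvalues_below (H \<epsilon> v_hat \<mu> k) (disp_min \<epsilon> k) =
        eigenvalues_below (H \<epsilon> v_hat \<mu> (k + shift n)) (disp_min \<epsilon> (k + shift n))"
      using eigenvalues_shift[of v_hat \<mu> "k + shift n" n] disp_min_shift[of "k + shift n" n] by simp
    also have "\<dots> = eigenvalues_below (H \<epsilon> v_hat \<mu>\<^sub>0 k\<^sub>0) (disp_min \<epsilon> k\<^sub>0)"
      by (rule const[OF that(1) n])
    finally show ?thesis .
  qed
  show ?thesis
  proof (rule exI[of _ "ball \<mu>\<^sub>0 \<rho>"], rule exI[of _ G], intro conjI ballI)
    show "ball \<mu>\<^sub>0 \<rho> \<subseteq> {0<..}" using \<rho> by (auto simp: dist_real_def)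
    show "\<mu>\<^sub>0 \<in> ball \<mu>\<^sub>0 \<rho>" using \<rho>(1) by simp
    show "G \<subseteq> GG \<epsilon>" by (simp add: G_def)
    fix \<mu> \<mu>' k k' assume "\<mu> \<in> ball \<mu>\<^sub>0 \<rho>" "\<mu>' \<in> ball \<mu>\<^sub>0 \<rho>" "k \<in> G" "k' \<in> G"
    then show "eigenvalues_below (H \<epsilon> v_hat \<mu> k) (disp_min \<epsilon> k)
      = eigenvalues_below (H \<epsilon> v_hat \<mu>' k') (disp_min \<epsilon> k')"
      by (simp only: val)
  qed (fact open_ball Gopen kG)+
qed

end
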